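(* Assume $\xi\in L^8$, the BSDE $Y_t=\xi+\int_{t\wedge\tau}^{\tau} f(s,Y_s)ds-\int_{t\wedge\tau}^{\tau} Z_sdW_s$ has a solution $(Y,Z)\in\mathcal S^8\times\mathcal H^8$, and (h), (R-q) with $q=8$, ($\pi$-F) with some $p>16$ and ($\pi$-T) with $p=16$. Assume furthermore there is $\alpha>0$ such that for every $p\ge2$ there is $C_p>0$ with $\mathbb E[|Y_s-Y_t|^p]\le C_p|s-t|^{\alpha p}$ for all $s,t\ge0$ with $|s-t|\le1$. Then there is a random variable $V\in L^4$ not depending on $h$ such that for every $\varepsilon>0$ there is a constant $C>0$ not depending on $h$ with, for all $h\in(0,h_0]$, $$\mathcal E^2(Y)\le Ch^{2(\alpha-\varepsilon)}+Ch+C\,\mathbb E\big[e^{6L_f(\tau\vee\tau_h)}|\xi-\bar\xi|^4\big]^{1/2}+C\,\mathbb E\big[e^{6L_f(\tau\vee\tau_h)}V^2|\tau-\tau_h|^2\big]^{1/2}+C\,\mathbb E\Big[e^{6L_f(\tau\vee\tau_h)}\Big(\int_0^\tau\Delta F_s^2ds\Big)^2\Big]^{1/2},$$ where $\mathcal E^2(Y)=\mathbb E\big[\sup_{\ell\in\pi_h}\sup_{t\in[\ell,\ell+h]}|Y_t-\bar Y_\ell|^2\big]$ and $\Delta F_s=f(s,Y_s)-f_h(\phi(s),Y_s)$.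
   Context: Let $(\Omega,\mathcal F,(\mathcal F_t)_{t\ge0},\mathbb P)$ be a filtered probability space whose filtration is generated by a $d$-dimensional Brownian motion $W$ and augmented by all $\mathbb P$-null sets; write $\mathbb E_t[\cdot]=\mathbb E[\cdot\mid\mathcal F_t]$. Let $\tau$ be a stopping time with $\exp(m\tau)\in L^1$ for some $m>0$, let $\xi\in L^{p_0}(\mathcal F_\tau)$ for some $p_0\ge4$, and let $f:[0,\infty)\times\Omega\times\mathbb R\to\mathbb R$ be Lipschitz in its last variable with constant $L_f>0$. $\mathcal S^p=\{Y:\mathbb E[\sup_{s\ge0}|Y_s|^p]<\infty\}$, $\mathcal H^p=\{Z:\mathbb E[(\int_0^\infty\|Z_s\|^2ds)^{p/2}]<\infty\}$. For $h>0$ let $\pi_h=\{nh:n\in\mathbb N_0\}$ and $\phi(s)=\max\{t\in\pi_h:t\le s\}$. For each $h\in(0,h_0]$ there are given a finite $\pi_h$-valued stopping time $\tau_h$, an $\mathcal F_{\tau_h}$-measurable random variable $\bar\xi$ (depending on $h$), and a map $f_h:\pi_h\times\Omega\times\mathbb R\to\mathbb R$. The discrete approximation $(\bar Y_t)_{t\in\pi_h}$ is the solution of $\bar Y_t=1_{\{t\ge\tau_h\}}\bar\xi+1_{\{t<\tau_h\}}(\mathbb E_t[\bar Y_{t+h}]+hf_h(t,\bar Y_t))$, $t\in\pi_h$, given by $\bar Y_t=1_{\{t\ge\tau_h\}}\bar\xi+1_{\{t<\tau_h\}}\bar Y^*_t$, where $\bar Y^*$ is the unique fixed point of $T(R)_t=1_{\{t<\tau_h\}}\mathbb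 E_t[R_{t+h}]+1_{\{t<\tau_h\}}hf_h(t,R_t)+1_{\{t=\tau_h\}}\bar\xi$ in the Banach space of adapted sequences $(R_t)_{t\in\pi_h}$ with $R_t\in L^2(\mathcal F_t)$, $1_{\{t>\tau_h\}}R_t=0$ and $\sum_{t\in\pi_h}(1-3L_fh)^{-t/h}\|1_{\{t\le\tau_h\}}R_t\|_{L^2}<\infty$. Assumptions: (h) $h_0<\min\{L_f,\frac1{12L_f}\}$ and $h\in(0,h_0]$. (R-q) for a parameter $q\ge2$: there is $\rho>4qL_f$ with $\exp(\rho\tau)\in L^1$ and $\sup_{h\in(0,h_0]}\exp(\rho\tau_h)\in L^1$. ($\pi$-F) for a parameter $p$: each $f_h$ is Lipschitz in its last variable with the constant $L_f$, $f_h(t,A)$ is $\mathcal F_t$-measurable for every $\mathcal F_t$-measurable $A$, and $\mathbb E[\sup_{h\in(0,h_0]}\sup_{t\in\pi_h\cap[0,\tau\vee\tau_h]}|f_h(t,0)|^p]<\infty$. ($\pi$-T) for a parameter $p$: $\bar\xi$ is $\mathcal F_{\tau_h}$-measurable and $\mathbb E[\sup_{h\in(0,h_0]}|\bar\xi|^p]<\infty$. *)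

theory Defs
  imports "HOL-Probability.Probability"
begin

definition bm_increment ::
  "nat \<Rightarrow> (nat \<Rightarrow> real \<Rightarrow> 'a \<Rightarrow> real) \<Rightarrow> real \<Rightarrow> real \<Rightarrow> 'a \<Rightarrow> (nat \<Rightarrow> real)" where
  "bm_increment d W s t w = (\<lambda>i\<in>{..<d}. W i t w - W i s w)"

definition brownian_motion ::
  "'a measure \<Rightarrow> nat \<Rightarrow> (nat \<Rightarrow> real \<Rightarrow> 'a \<Rightarrow> real) \<Rightarrow> bool" where
  "brownian_motion M d W \<longleftrightarrow>
     (\<forall>i<d. \<forall>t\<ge>0. W i t \<in> borel_measurable M) \<and>
     (\<forall>w\<in>space M. \<forall>i<d. W i 0 w = 0 \<and> continuous_on {0..} (\<lambda>t. W i t w)) \<and>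
     (\<forall>ts::real list. sorted_wrt (<) ts \<and> (\<forall>t\<in>set ts. 0 \<le> t) \<longrightarrow>
        prob_space.indep_vars M (\<lambda>_. PiM {..<d} (\<lambda>_. borel))
          (\<lambda>k. bm_increment d W (ts ! k) (ts ! Suc k)) {k. Suc k < length ts}) \<and>
     (\<forall>s t. 0 \<le> s \<and> s < t \<longrightarrow>
        distributed M (PiM {..<d} (\<lambda>_. lborel)) (bm_increment d W s t)
          (\<lambda>x. ennreal (\<Prod>i<d. normal_density 0 (sqrt (t - s)) (x i))))"

definition null_sets_of :: "'a measure \<Rightarrow> 'a set set" where
  "null_sets_of M = {N \<in> sets M. emeasure M N = 0}"

definition bm_filtration ::
  "'a measure \<Rightarrow> nat \<Rightarrow> (nat \<Rightarrow> real \<Rightarrow> 'a \<Rightarrow> real) \<Rightarrow> real \<Rightarrow> 'a measure" where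
  "bm_filtration M d W t = sigma (space M)
     ({W i s -` B \<inter> space M | i s B. i < d \<and> 0 \<le> s \<and> s \<le> t \<and> B \<in> sets borel}
      \<union> null_sets_of M)"

definition bm_filtration_inf ::
  "'a measure \<Rightarrow> nat \<Rightarrow> (nat \<Rightarrow> real \<Rightarrow> 'a \<Rightarrow> real) \<Rightarrow> 'a measure" where
  "bm_filtration_inf M d W = sigma (space M)
     ({W i s -` B \<inter> space M | i s B. i < d \<and> 0 \<le> s \<and> B \<in> sets borel}
      \<union> null_sets_of M)"

definition is_stopping_time ::
  "'a measure \<Rightarrow> (real \<Rightarrow> 'a measure) \<Rightarrow> ('a \<Rightarrow> real) \<Rightarrow> bool" where
  "is_stopping_time M F \<tau> \<longleftrightarrow>
     (\<forall>w\<in>space M. 0 \<le> \<tau> w) \<and> (\<forall>t\<ge>0. {w\<in>space M. \<tau> w \<le> t} \<in> sets (F t))"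

definition stopped_sigma ::
  "'a measure \<Rightarrow> (real \<Rightarrow> 'a measure) \<Rightarrow> 'a measure \<Rightarrow> ('a \<Rightarrow> real) \<Rightarrow> 'a measure" where
  "stopped_sigma M F Finf \<tau> = sigma (space M)
     {A \<in> sets Finf. \<forall>t\<ge>0. A \<inter> {w\<in>space M. \<tau> w \<le> t} \<in> sets (F t)}"

definition progressive ::
  "(real \<Rightarrow> 'a measure) \<Rightarrow> (real \<Rightarrow> 'a \<Rightarrow> real) \<Rightarrow> bool" where
  "progressive F X \<longleftrightarrow>
     (\<forall>t\<ge>0. (\<lambda>(s, w). X s w) \<in> borel_measurable (restrict_space lborel {0..t} \<Otimes>\<^sub>M F t))"

definition simple_integrand ::
  "'a measure \<Rightarrow> (real \<Rightarrow> 'a measure) \<Rightarrow> nat \<Rightarrow> real list \<Rightarrow> (nat \<Rightarrow> nat \<Rightarrow> 'a \<Rightarrow> real) \<Rightarrow> bool" where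
  "simple_integrand M F d ts z \<longleftrightarrow>
     ts \<noteq> [] \<and> hd ts = 0 \<and> sorted_wrt (<) ts \<and>
     (\<forall>k i. Suc k < length ts \<and> i < d \<longrightarrow>
        z k i \<in> borel_measurable (F (ts ! k)) \<and> integrable M (\<lambda>w. (z k i w)\<^sup>2))"

definition simple_process ::
  "real list \<Rightarrow> (nat \<Rightarrow> nat \<Rightarrow> 'a \<Rightarrow> real) \<Rightarrow> nat \<Rightarrow> real \<Rightarrow> 'a \<Rightarrow> real" where
  "simple_process ts z i s w =
     (\<Sum>k | Suc k < length ts. if ts ! k \<le> s \<and> s < ts ! Suc k then z k i w else 0)"

definition simple_ito ::
  "nat \<Rightarrow> (nat \<Rightarrow> real \<Rightarrow> 'a \<Rightarrow> real) \<Rightarrow> real list \<Rightarrow> (nat \<Rightarrow> nat \<Rightarrow> 'a \<Rightarrow> real) \<Rightarrow> real \<Rightarrow> 'a \<Rightarrow> real" where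
  "simple_ito d W ts z t w =
     (\<Sum>k | Suc k < length ts. \<Sum>i<d.
        z k i w * (W i (min t (ts ! Suc k)) w - W i (min t (ts ! k)) w))"

text \<open>I is (a continuous version of) the Ito integral process t |-> int_0^t Z_s dW_s,
  for Z (components Z i, i < d) progressive with E int_0^oo |Z_s|^2 ds finite.\<close>
definition is_ito_integral ::
  "'a measure \<Rightarrow> (real \<Rightarrow> 'a measure) \<Rightarrow> nat \<Rightarrow> (nat \<Rightarrow> real \<Rightarrow> 'a \<Rightarrow> real)
     \<Rightarrow> (nat \<Rightarrow> real \<Rightarrow> 'a \<Rightarrow> real) \<Rightarrow> (real \<Rightarrow> 'a \<Rightarrow> real) \<Rightarrow> bool" where
  "is_ito_integral M F d W Z I \<longleftrightarrow>
     (\<forall>t\<ge>0. I t \<in> borel_measurable (F t)) \<and>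
     (AE w in M. continuous_on {0..} (\<lambda>t. I t w)) \<and>
     (\<exists>tss zs. (\<forall>n. simple_integrand M F d (tss n) (zs n)) \<and>
        ((\<lambda>n. \<integral>\<^sup>+ w. (\<integral>\<^sup>+ s\<in>{0..}.
             ennreal (\<Sum>i<d. (simple_process (tss n) (zs n) i s w - Z i s w)\<^sup>2) \<partial>lborel) \<partial>M)
          \<longlonglongrightarrow> 0) \<and>
        (\<forall>t\<ge>0. (\<lambda>n. \<integral>\<^sup>+ w. ennreal ((simple_ito d W (tss n) (zs n) t w - I t w)\<^sup>2) \<partial>M)
          \<longlonglongrightarrow> 0))"

definition bsde_solution ::
  "'a measure \<Rightarrow> nat \<Rightarrow> (nat \<Rightarrow> real \<Rightarrow> 'a \<Rightarrow> real) \<Rightarrow> ('a \<Rightarrow> real) \<Rightarrow> ('a \<Rightarrow> real)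
    \<Rightarrow> (real \<Rightarrow> 'a \<Rightarrow> real \<Rightarrow> real) \<Rightarrow> nat
    \<Rightarrow> (real \<Rightarrow> 'a \<Rightarrow> real) \<Rightarrow> (nat \<Rightarrow> real \<Rightarrow> 'a \<Rightarrow> real) \<Rightarrow> bool" where
  "bsde_solution M d W \<tau> \<xi> f p Y Z \<longleftrightarrow>
     (let F = bm_filtration M d W in
     (\<forall>t\<ge>0. Y t \<in> borel_measurable (F t)) \<and>
     (\<forall>i<d. progressive F (Z i)) \<and>
     (\<integral>\<^sup>+ w. (SUP t\<in>{0..}. ennreal (\<bar>Y t w\<bar> ^ p)) \<partial>M) < \<infinity> \<and>
     (\<integral>\<^sup>+ w. (\<integral>\<^sup>+ s\<in>{0..}. ennreal (\<Sum>i<d. (Z i s w)\<^sup>2) \<partial>lborel) ^ (p div 2) \<partial>M) < \<infinity> \<and>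
     (\<exists>I. is_ito_integral M F d W Z I \<and>
        (AE w in M. set_integrable lborel {0..\<tau> w} (\<lambda>s. f s w (Y s w)) \<and>
           (\<forall>t\<ge>0. Y t w = \<xi> w
              + (LINT s:{min t (\<tau> w)..\<tau> w}|lborel. f s w (Y s w))
              - (I (\<tau> w) w - I (min t (\<tau> w)) w)))))"

text \<open>Time grid pi_h is indexed by n, t = n*h.  R is the fixed point Ybar* of the map T
  in the weighted Banach space described in the paper (elements up to a.s. equality).\<close>
definition scheme_fixed_point ::
  "'a measure \<Rightarrow> (real \<Rightarrow> 'a measure) \<Rightarrow> real \<Rightarrow> real \<Rightarrow> ('a \<Rightarrow> real) \<Rightarrow> ('a \<Rightarrow> real)
    \<Rightarrow> (nat \<Rightarrow> 'a \<Rightarrow> real \<Rightarrow> real) \<Rightarrow> (nat \<Rightarrow> 'a \<Rightarrow> real) \<Rightarrow> bool" where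
  "scheme_fixed_point M F Lf h \<tau>h \<xi>b fh R \<longleftrightarrow>
     (\<forall>n. R n \<in> borel_measurable (F (real n * h)) \<and> integrable M (\<lambda>w. (R n w)\<^sup>2)) \<and>
     (\<forall>n. AE w in M. real n * h > \<tau>h w \<longrightarrow> R n w = 0) \<and>
     summable (\<lambda>n. inverse (1 - 3 * Lf * h) ^ n *
        sqrt (\<integral>w. (indicator {w. real n * h \<le> \<tau>h w} w * R n w)\<^sup>2 \<partial>M)) \<and>
     (\<forall>n. AE w in M. R n w =
        indicator {w. real n * h < \<tau>h w} w * real_cond_exp M (F (real n * h)) (R (Suc n)) w
        + indicator {w. real n * h < \<tau>h w} w * h * fh n w (R n w)
        + indicator {w. real n * h = \<tau>h w} w * \<xi>b w)"

definition scheme_value ::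
  "real \<Rightarrow> ('a \<Rightarrow> real) \<Rightarrow> ('a \<Rightarrow> real) \<Rightarrow> (nat \<Rightarrow> 'a \<Rightarrow> real) \<Rightarrow> nat \<Rightarrow> 'a \<Rightarrow> real" where
  "scheme_value h \<tau>h \<xi>b R n w = (if real n * h \<ge> \<tau>h w then \<xi>b w else R n w)"

definition esqrt :: "ennreal \<Rightarrow> ennreal" where
  "esqrt x = (if x = \<top> then \<top> else ennreal (sqrt (enn2real x)))"

end

theory Submission
  imports Defs
begin

text \<open>
  On the grid the error \<open>D\<^sub>n = Y\<^bsub>nh\<^esub> - \<bar>Y\<^bsub>nh\<^esub>\<close> satisfies
  \<open>(1 - L\<^sub>f h 1[nh < \<tau>\<^sub>h]) |D\<^sub>n| \<le> E\<^sub>n[|D\<^bsub>n+1\<^esub>| + |e\<^sub>n|]\<close>, where the local error \<open>e\<^sub>n\<close> compares the driver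
  integral over one grid cell with \<open>h f\<^sub>h(nh, Y\<^bsub>nh\<^esub>)\<close>; the stochastic integral drops out by optional stopping
  on that bounded cell, so no integrability of the driver is needed. Multiplying by the adapted weights
  \<open>(1 - L\<^sub>f h)\<^bsup>-#{k < n. kh < \<tau>\<^sub>h}\<^esup> \<le> exp(3/2 L\<^sub>f \<tau>\<^sub>h)\<close> and iterating bounds \<open>|D\<^sub>n|\<close> by a conditional
  expectation, and Doob's inequality gives the supremum. Pathwise, the local errors sum to at most
  \<open>V |\<tau> - \<tau>\<^sub>h| + L\<^sub>f \<tau> osc + (\<tau> \<integral>\<Delta>F\<^sup>2)\<^bsup>1/2\<^esup>\<close>, with \<open>osc\<close> the oscillation of \<open>Y\<close> over grid cells, and
  Cauchy-Schwarz separates the exponential weights. The oscillation is of order \<open>h\<^bsup>\<alpha>-\<epsilon>\<^esup>\<close> by dyadic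
  chaining with a high moment, the cells \<open>nh \<le> \<tau>\<close> being summable by the exponential moment of \<open>\<tau>\<close>.
\<close>

section \<open>Integral inequalities, Doob maximal inequality and essential suprema\<close>

text \<open>A bound of the form |D_n| \<le> E_n[X] is always stated in tested form, as an inequality
  of integrals against every nonnegative F_n-measurable \<open>\<phi>\<close>. This needs no
  integrability of X and lets adapted weights be absorbed into \<open>\<phi>\<close>. The grid is
  infinite, so the iteration starts at a finite N and the remainder there has to vanish as N grows.
  Before \<open>\<tau>h\<close> this is the purpose of the weighted norm of the fixed point: (1 - 3
  L_f h)^(-N) dominates the Gronwall weight. The rate 3/2 comes from 1/(1 - x) \<le> 1 + 3x/2 for
  small x = L_f h; squaring for the L2 estimate gives 3, and one Cauchy-Schwarz gives the 6 of the
  theorem. The other obstacle is measurability. Suprema over h and t are uncountable, and f is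
  controlled only along paths, so the integrands of the theorem may fail to be measurable.
  Monotonicity of the nonnegative integral survives this, additivity does not; measurable majorants
  or minorants are therefore inserted before any integral is split.\<close>

lemma esqrt_power2: "(esqrt x)\<^sup>2 = x"
  by (cases x) (auto simp: esqrt_def ennreal_power power2_eq_square ennreal_mult'[symmetric])

lemma ennreal_power2_le_imp_le: "(x::ennreal)\<^sup>2 \<le> y\<^sup>2 \<Longrightarrow> x \<le> y"
proof (rule ccontr)
  assume *: "x\<^sup>2 \<le> y\<^sup>2" "\<not> x \<le> y"
  then have "y < x" by simp
  then have "y * y < x * x"
    by (cases x; cases y) (auto simp: ennreal_less_iff ennreal_mult[symmetric] mult_strict_mono
        ennreal_mult_top ennreal_top_mult less_top[symmetric] ennreal_mult_less_top)
  with *(1) show False by (simp add: power2_eq_square)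
qed

lemma le_esqrt: "y\<^sup>2 \<le> x \<Longrightarrow> y \<le> esqrt x"
  by (rule ennreal_power2_le_imp_le) (simp add: esqrt_power2)

lemma esqrt_mono: "x \<le> y \<Longrightarrow> esqrt x \<le> esqrt y"
  by (rule le_esqrt) (simp add: esqrt_power2)

lemma esqrt_le: "x \<le> y\<^sup>2 \<Longrightarrow> esqrt x \<le> y"
  by (rule ennreal_power2_le_imp_le) (simp add: esqrt_power2)

lemma esqrt_ennreal: "0 \<le> x \<Longrightarrow> esqrt (ennreal x) = ennreal (sqrt x)"
  by (simp add: esqrt_def)

lemma esqrt_mult: "esqrt x * esqrt y = esqrt (x * y)"
proof (rule antisym)
  have *: "(esqrt x * esqrt y)\<^sup>2 = x * y"
    by (simp add: power_mult_distrib esqrt_power2)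
  show "esqrt x * esqrt y \<le> esqrt (x * y)" using * by (intro le_esqrt) simp
  show "esqrt (x * y) \<le> esqrt x * esqrt y" using * by (intro esqrt_le) simp
qed

lemma nn_integral_mult_le_esqrt:
  assumes "f \<in> borel_measurable M" "g \<in> borel_measurable M"
  shows "(\<integral>\<^sup>+x. f x * g x \<partial>M) \<le> esqrt (\<integral>\<^sup>+x. (f x)\<^sup>2 \<partial>M) * esqrt (\<integral>\<^sup>+x. (g x)\<^sup>2 \<partial>M)"
  unfolding esqrt_mult using Cauchy_Schwarz_nn_integral[OF assms] by (rule le_esqrt)

lemma (in prob_space) nn_integral_le_esqrt:
  assumes "f \<in> borel_measurable M"
  shows "(\<integral>\<^sup>+x. f x \<partial>M) \<le> esqrt (\<integral>\<^sup>+x. (f x)\<^sup>2 \<partial>M)"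
  using nn_integral_mult_le_esqrt[OF assms, of "\<lambda>_. 1"] esqrt_ennreal[of 1]
  by (simp add: emeasure_space_1)

lemma ennreal_add_power2_le: "((x::ennreal) + y)\<^sup>2 \<le> 2 * x\<^sup>2 + 2 * y\<^sup>2"
proof (cases x; cases y)
  fix a b assume [simp]: "x = ennreal a" "0 \<le> a" "y = ennreal b" "0 \<le> b"
  have "(a + b)\<^sup>2 \<le> 2 * a\<^sup>2 + 2 * b\<^sup>2" by (smt (verit) sum_squares_bound power2_sum)
  then show ?thesis
    by (simp add: ennreal_power ennreal_plus[symmetric] ennreal_mult'[symmetric] ennreal_numeral[symmetric]
        del: ennreal_plus ennreal_numeral)
qed (auto simp: power2_eq_square ennreal_mult_top ennreal_top_mult)

text \<open>The hypothesis \<open>le\<close> is |D_n| \<le> E_n[X] in tested form. The increment of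
  the running maximum at time n is nonnegative and known at time n, so it may serve as the test
  function. Summation yields E[m^2] \<le> 2 E[m X] for the final maximum m, and Cauchy-Schwarz
  followed by division by E[m^2] gives the factor 4 = 2^2.\<close>

lemma doob_L2:
  fixes D :: "nat \<Rightarrow> 'a \<Rightarrow> real" and X :: "'a \<Rightarrow> ennreal"
  assumes sub: "\<And>n. subalgebra M (F n)" and mono: "\<And>m n. m \<le> n \<Longrightarrow> sets (F m) \<subseteq> sets (F n)"
    and D[measurable]: "\<And>n. D n \<in> borel_measurable (F n)" and D2: "\<And>n. n \<le> N \<Longrightarrow> integrable M (\<lambda>w. (D n w)\<^sup>2)"
    and X[measurable]: "X \<in> borel_measurable M"
    and le: "\<And>n \<phi>. n \<le> N \<Longrightarrow> \<phi> \<in> borel_measurable (F n) \<Longrightarrow>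
       (\<integral>\<^sup>+w. \<phi> w * ennreal \<bar>D n w\<bar> \<partial>M) \<le> (\<integral>\<^sup>+w. \<phi> w * X w \<partial>M)"
  shows "(\<integral>\<^sup>+w. (SUP n\<in>{..N}. ennreal \<bar>D n w\<bar>)\<^sup>2 \<partial>M) \<le> 4 * (\<integral>\<^sup>+w. (X w)\<^sup>2 \<partial>M)"
proof -
  have spF: "space (F n) = space M" for n using sub[of n] by (simp add: subalgebra_def)
  have subm: "g \<in> borel_measurable (F m) \<Longrightarrow> m \<le> n \<Longrightarrow> g \<in> borel_measurable (F n)" for g :: "'a \<Rightarrow> real" and m n
    using mono[of m n] by (auto simp: measurable_def spF)
  define m where "m k w = Max ((\<lambda>n. \<bar>D n w\<bar>) ` {..k})" for k w
  have mS: "m (Suc k) w = max (m k w) \<bar>D (Suc k) w\<bar>" for k w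
    unfolding m_def by (simp add: atMost_Suc max.commute)
  have m0: "m 0 w = \<bar>D 0 w\<bar>" for w by (simp add: m_def)
  have mF: "m k \<in> borel_measurable (F k)" for k
  proof (induction k)
    case 0 then show ?case by (simp add: m0[abs_def])
  next
    case (Suc k)
    have "m k \<in> borel_measurable (F (Suc k))" using subm[OF Suc] by simp
    then show ?case unfolding mS[abs_def] by measurable
  qed
  define d where "d k w = m k w - (case k of 0 \<Rightarrow> 0 | Suc j \<Rightarrow> m j w)" for k w
  have dF[measurable]: "d k \<in> borel_measurable (F k)" for k
  proof (cases k)
    case 0 then show ?thesis using mF[of 0] by (simp add: d_def[abs_def])
  next
    case (Suc j)
    have "m j \<in> borel_measurable (F (Suc j))" using subm[OF mF] by simp
    then show ?thesis using mF[of "Suc j"] by (simp add: d_def[abs_def] Suc)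
  qed
  have m_nn: "0 \<le> m k w" for k w by (induction k) (auto simp: m0 mS)
  have d_nn: "0 \<le> d k w" for k w by (cases k) (auto simp: d_def m_nn mS)
  have msum: "m k w = (\<Sum>i\<le>k. d i w)" for k w by (induction k) (auto simp: d_def)
  \<comment> \<open>Where \<open>d k w\<close> is nonzero the maximum has just been renewed, so
    there \<open>m k w\<close> is the current value \<open>\<bar>D k w\<bar>\<close>.\<close>
  have dD: "d k w * m k w = d k w * \<bar>D k w\<bar>" for k w
  proof (cases k)
    case (Suc j)
    then show ?thesis by (cases "m j w \<le> \<bar>D (Suc j) w\<bar>") (simp_all add: d_def mS max_def)
  qed (simp add: m0)
  \<comment> \<open>Discrete form of the differential of m^2: for a \<le> b, b^2 - a^2 = (b - a)(b +
    a) \<le> 2 b (b - a).\<close>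
  have sq: "(m k w)\<^sup>2 \<le> 2 * (\<Sum>i\<le>k. d i w * \<bar>D i w\<bar>)" for k w
  proof (induction k)
    case 0 then show ?case by (simp add: d_def m0 power2_eq_square)
  next
    case (Suc k)
    have "(m (Suc k) w)\<^sup>2 - (m k w)\<^sup>2 = d (Suc k) w * (m (Suc k) w + m k w)"
      by (simp add: d_def algebra_simps power2_eq_square)
    also have "\<dots> \<le> d (Suc k) w * (2 * m (Suc k) w)"
      by (intro mult_left_mono d_nn) (simp add: mS)
    also have "\<dots> = 2 * (d (Suc k) w * \<bar>D (Suc k) w\<bar>)" using dD[of "Suc k" w] by simp
    finally show ?case using Suc by (simp add: algebra_simps)
  qed
  have DM[measurable]: "D n \<in> borel_measurable M" for n using D measurable_from_subalg[OF sub] by blast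
  have dM[measurable]: "d n \<in> borel_measurable M" for n using dF measurable_from_subalg[OF sub] by blast
  have mM[measurable]: "m n \<in> borel_measurable M" for n using mF measurable_from_subalg[OF sub] by blast
  have sup: "(SUP n\<in>{..N}. ennreal \<bar>D n w\<bar>) = ennreal (m N w)" for w
  proof -
    have "(SUP n\<in>{..N}. ennreal \<bar>D n w\<bar>) = Max ((\<lambda>n. ennreal \<bar>D n w\<bar>) ` {..N})"
      by (rule Max_Sup[symmetric]) auto
    also have "\<dots> = Max (ennreal ` (\<lambda>n. \<bar>D n w\<bar>) ` {..N})" by (simp add: image_image)
    also have "\<dots> = ennreal (m N w)" unfolding m_def
      by (rule mono_Max_commute[symmetric]) (auto intro: monoI ennreal_leI)
    finally show ?thesis .
  qed
  let ?A = "\<integral>\<^sup>+w. (ennreal (m N w))\<^sup>2 \<partial>M" and ?B = "\<integral>\<^sup>+w. (X w)\<^sup>2 \<partial>M"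
  have "?A \<le> (\<integral>\<^sup>+w. 2 * (\<Sum>i\<le>N. ennreal (d i w) * ennreal \<bar>D i w\<bar>) \<partial>M)"
  proof (intro nn_integral_mono)
    fix w
    have "(ennreal (m N w))\<^sup>2 = ennreal ((m N w)\<^sup>2)" by (simp add: ennreal_power m_nn)
    also have "\<dots> \<le> ennreal (2 * (\<Sum>i\<le>N. d i w * \<bar>D i w\<bar>))" by (intro ennreal_leI sq)
    also have "\<dots> = 2 * (\<Sum>i\<le>N. ennreal (d i w) * ennreal \<bar>D i w\<bar>)"
      by (simp add: ennreal_mult d_nn sum_nonneg flip: sum_ennreal)
    finally show "(ennreal (m N w))\<^sup>2 \<le> 2 * (\<Sum>i\<le>N. ennreal (d i w) * ennreal \<bar>D i w\<bar>)" .
  qed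
  also have "\<dots> = 2 * (\<Sum>i\<le>N. \<integral>\<^sup>+w. ennreal (d i w) * ennreal \<bar>D i w\<bar> \<partial>M)"
    by (simp add: nn_integral_cmult nn_integral_sum)
  also have "\<dots> \<le> 2 * (\<Sum>i\<le>N. \<integral>\<^sup>+w. ennreal (d i w) * X w \<partial>M)"
    by (intro mult_left_mono sum_mono le) auto
  also have "\<dots> = 2 * (\<integral>\<^sup>+w. ennreal (m N w) * X w \<partial>M)"
    by (simp add: nn_integral_sum[symmetric] sum_distrib_right[symmetric] msum d_nn)
  also have "\<dots> \<le> 2 * (esqrt ?A * esqrt ?B)"
    by (intro mult_left_mono nn_integral_mult_le_esqrt) auto
  finally have *: "?A \<le> 2 * (esqrt ?A * esqrt ?B)" .
  \<comment> \<open>Square integrability of finitely many D_n makes \<open>?A\<close> finite, which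
    permits cancelling it in \<open>?A * ?A \<le> ?A * (4 * ?B)\<close>.\<close>
  have "?A \<le> (\<integral>\<^sup>+w. ennreal (\<Sum>i\<le>N. (D i w)\<^sup>2) \<partial>M)"
  proof (intro nn_integral_mono)
    fix w
    have "m N w \<in> (\<lambda>n. \<bar>D n w\<bar>) ` {..N}" unfolding m_def by (rule Max_in) auto
    then obtain n where n: "n \<le> N" "m N w = \<bar>D n w\<bar>" by auto
    have "(m N w)\<^sup>2 = (D n w)\<^sup>2" by (simp add: n)
    also have "\<dots> \<le> (\<Sum>i\<le>N. (D i w)\<^sup>2)"
      by (rule member_le_sum) (auto simp: n)
    finally show "(ennreal (m N w))\<^sup>2 \<le> ennreal (\<Sum>i\<le>N. (D i w)\<^sup>2)"
      by (simp add: ennreal_power m_nn ennreal_leI)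
  qed
  also have "\<dots> < \<infinity>"
    using Bochner_Integration.integrable_sum[of "{..N}" M "\<lambda>i w. (D i w)\<^sup>2"] D2
    by (simp add: nn_integral_eq_integral sum_nonneg)
  finally have fin: "?A < \<infinity>" .
  have "?A \<le> 4 * ?B"
  proof (cases "?A = 0")
    case False
    have "?A * ?A \<le> (2 * (esqrt ?A * esqrt ?B))\<^sup>2" unfolding power2_eq_square[of "2 * _"]
      by (intro mult_mono *) auto
    also have "\<dots> = ?A * (4 * ?B)" by (simp add: power_mult_distrib esqrt_power2 ac_simps)
    finally show ?thesis using False fin
      by (subst (asm) ennreal_mult_le_mult_iff) (auto simp: less_top)
  qed simp
  then show ?thesis by (simp add: sup)
qed

text \<open>Conditional Jensen for the absolute value: \<open>eq\<close> characterizes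
  \<open>U\<close> as the conditional expectation of \<open>X\<close>, and a nonnegative
  \<open>F\<close>-measurable weight passes through \<open>nn_cond_exp\<close> whether or not the
  products are integrable. This is the source of the tested inequalities that \<open>doob_L2\<close>
  consumes.\<close>

lemma (in sigma_finite_subalgebra) nn_integral_abs_cond_exp_le:
  assumes X: "integrable M X" and U: "integrable M U" "U \<in> borel_measurable F"
    and eq: "\<And>B. B \<in> sets F \<Longrightarrow> (\<integral>w\<in>B. X w \<partial>M) = (\<integral>w\<in>B. U w \<partial>M)"
    and [measurable]: "\<phi> \<in> borel_measurable F"
  shows "(\<integral>\<^sup>+w. \<phi> w * ennreal \<bar>U w\<bar> \<partial>M) \<le> (\<integral>\<^sup>+w. \<phi> w * ennreal \<bar>X w\<bar> \<partial>M)"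
proof -
  have [measurable]: "X \<in> borel_measurable M" using X by simp
  have "AE w in M. real_cond_exp M F X w = U w"
    by (rule real_cond_exp_charact[OF eq X U])
  then have "(\<integral>\<^sup>+w. \<phi> w * ennreal \<bar>U w\<bar> \<partial>M) \<le> (\<integral>\<^sup>+w. \<phi> w * nn_cond_exp M F (\<lambda>x. ennreal \<bar>X x\<bar>) w \<partial>M)"
    using real_cond_exp_abs[of X] by (intro nn_integral_mono_AE) (auto elim!: eventually_elim2 intro!: mult_left_mono)
  also have "\<dots> = (\<integral>\<^sup>+w. \<phi> w * ennreal \<bar>X w\<bar> \<partial>M)"
    by (rule nn_cond_exp_intg) auto
  finally show ?thesis .
qed

text \<open>An uncountable supremum need not be measurable; a countable subfamily maximizing the
  integral of its supremum yields an essential supremum of the whole family.\<close>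
lemma ex_countable_essential_sup:
  fixes g :: "'i \<Rightarrow> 'a \<Rightarrow> ennreal"
  assumes meas[measurable]: "\<And>i. i \<in> I \<Longrightarrow> g i \<in> borel_measurable M"
    and fin: "(\<integral>\<^sup>+w. (SUP i\<in>I. g i w) \<partial>M) < \<infinity>"
  shows "\<exists>G\<in>borel_measurable M. (\<integral>\<^sup>+w. G w \<partial>M) < \<infinity> \<and> (\<forall>i\<in>I. AE w in M. g i w \<le> G w)"
proof -
  let ?S = "\<lambda>J w. SUP i\<in>J. g i w"
  define \<C> where "\<C> = {J. J \<subseteq> I \<and> countable J}"
  have m: "?S J \<in> borel_measurable M" if "J \<in> \<C>" for J
    using that by (intro borel_measurable_SUP) (auto simp: \<C>_def)
  have le: "nn_integral M (?S J) \<le> (\<integral>\<^sup>+w. (SUP i\<in>I. g i w) \<partial>M)" if "J \<in> \<C>" for J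
    using that by (intro nn_integral_mono SUP_subset_mono) (auto simp: \<C>_def)
  define s where "s = (SUP J\<in>\<C>. nn_integral M (?S J))"
  have ne: "\<C> \<noteq> {}" by (auto simp: \<C>_def)
  have s_fin: "s < \<infinity>"
    using SUP_least[of \<C>, OF le] fin unfolding s_def by (rule le_less_trans)
  obtain a where a: "range a \<subseteq> (\<lambda>J. nn_integral M (?S J)) ` \<C>" "a \<longlonglongrightarrow> s"
    using ennreal_Sup_countable_SUP[of "(\<lambda>J. nn_integral M (?S J)) ` \<C>"] ne unfolding s_def
    by (metis LIMSEQ_SUP image_is_empty)
  then have "\<forall>n. \<exists>J\<in>\<C>. a n = nn_integral M (?S J)" by blast
  then obtain J where J: "\<And>n. J n \<in> \<C>" "\<And>n. a n = nn_integral M (?S (J n))" by metis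
  define K where "K = (\<Union>n. J n)"
  have K: "K \<in> \<C>" using J(1) by (auto simp: K_def \<C>_def)
  have "a n \<le> nn_integral M (?S K)" for n
    unfolding J by (intro nn_integral_mono SUP_subset_mono) (auto simp: K_def)
  then have sK: "s \<le> nn_integral M (?S K)" using LIMSEQ_le_const2[OF a(2)] by blast
  have "AE w in M. g i w \<le> ?S K w" if i: "i \<in> I" for i
  proof -
    have K': "insert i K \<in> \<C>" using K i by (auto simp: \<C>_def)
    have s: "nn_integral M (?S (insert i K)) \<le> s" unfolding s_def by (rule SUP_upper[OF K'])
    have "(\<integral>\<^sup>+w. ?S (insert i K) w - ?S K w \<partial>M) = nn_integral M (?S (insert i K)) - nn_integral M (?S K)"
      using m[OF K'] m[OF K] le[OF K] fin
      by (intro nn_integral_diff AE_I2 SUP_subset_mono) (auto simp: less_top)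
    also have "\<dots> = 0"
      using order_trans[OF s sK] le[OF K'] fin by (intro diff_eq_0_ennreal) auto
    finally have "AE w in M. ?S (insert i K) w - ?S K w = 0"
      using m[OF K'] m[OF K] by (subst (asm) nn_integral_0_iff_AE) auto
    then show ?thesis by eventually_elim (auto dest: ennreal_minus_eq_0)
  qed
  then show ?thesis using m[OF K] le[OF K] fin by (intro bexI[of _ "?S K"]) auto
qed

section \<open>Brownian filtration\<close>

locale brownian_space = prob_space M for M :: "'a measure" +
  fixes d :: nat and W :: "nat \<Rightarrow> real \<Rightarrow> 'a \<Rightarrow> real"
  assumes bm: "brownian_motion M d W"
begin

abbreviation "\<F> \<equiv> bm_filtration M d W"

lemma W_measurable: "i < d \<Longrightarrow> 0 \<le> t \<Longrightarrow> W i t \<in> borel_measurable M"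
  using bm by (simp add: brownian_motion_def)

lemma W_0: "i < d \<Longrightarrow> w \<in> space M \<Longrightarrow> W i 0 w = 0"
  using bm by (simp add: brownian_motion_def)

lemma null_sets_of_eq: "null_sets_of M = null_sets M"
  by (auto simp: null_sets_of_def null_sets_def)

lemma bm_generator_sets:
  "{W i s -` B \<inter> space M | i s B. i < d \<and> 0 \<le> s \<and> s \<le> t \<and> B \<in> sets borel} \<union> null_sets_of M \<subseteq> sets M"
  using W_measurable by (auto simp: null_sets_of_def intro: measurable_sets)

lemma space_bm_filtration [simp]: "space (\<F> t) = space M"
  by (simp add: bm_filtration_def space_measure_of_conv)

lemma sets_bm_filtration: "sets (\<F> t) = sigma_sets (space M)
   ({W i s -` B \<inter> space M | i s B. i < d \<and> 0 \<le> s \<and> s \<le> t \<and> B \<in> sets borel} \<union> null_sets_of M)"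
  unfolding bm_filtration_def
  by (rule sets_measure_of) (use bm_generator_sets[of t] sets.sets_into_space in blast)

lemma subalgebra_bm_filtration: "subalgebra M (\<F> t)"
  unfolding subalgebra_def sets_bm_filtration
  using sets.sigma_sets_subset[OF bm_generator_sets] by simp

lemma bm_filtration_mono: "s \<le> t \<Longrightarrow> sets (\<F> s) \<subseteq> sets (\<F> t)"
  unfolding sets_bm_filtration by (rule sigma_sets_mono') (auto, force)

lemma measurable_bm_filtration_mono:
  "g \<in> borel_measurable (\<F> s) \<Longrightarrow> s \<le> t \<Longrightarrow> g \<in> borel_measurable (\<F> t)"
  using bm_filtration_mono[of s t] by (auto simp: measurable_def)

lemma measurable_bm_filtrationD: "g \<in> borel_measurable (\<F> s) \<Longrightarrow> g \<in> borel_measurable M"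
  by (rule measurable_from_subalg[OF subalgebra_bm_filtration])

lemma sets_bm_filtrationD: "A \<in> sets (\<F> s) \<Longrightarrow> A \<in> sets M"
  using subalgebra_bm_filtration[of s] by (auto simp: subalgebra_def)

lemma sigma_finite_subalgebra_bm_filtration: "sigma_finite_subalgebra M (\<F> t)"
  by (intro finite_measure_subalgebra_is_sigma_finite finite_measure_subalgebra.intro
      finite_measure_subalgebra_axioms.intro subalgebra_bm_filtration) unfold_locales

lemma sets_bm_filtration_inf: "sets (bm_filtration_inf M d W) \<subseteq> sets M"
proof -
  have *: "{W i s -` B \<inter> space M | i s B. i < d \<and> 0 \<le> s \<and> B \<in> sets borel} \<union> null_sets_of M \<subseteq> sets M"
    using W_measurable by (auto simp: null_sets_of_def intro: measurable_sets)
  have "sets (bm_filtration_inf M d W) = sigma_sets (space M)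
    ({W i s -` B \<inter> space M | i s B. i < d \<and> 0 \<le> s \<and> B \<in> sets borel} \<union> null_sets_of M)"
    unfolding bm_filtration_inf_def
    by (rule sets_measure_of) (use * sets.sets_into_space in blast)
  then show ?thesis using sets.sigma_sets_subset[OF *] by simp
qed

text \<open>A generator of \<open>\<F> s\<close> that is closed under intersection. Only finitely
  many times enter, because independence of increments is given for finite lists of times; the null
  sets account for the augmentation.\<close>

definition bm_cylinders :: "real \<Rightarrow> 'a set set" where
  "bm_cylinders s = {{w \<in> space M. \<forall>r\<in>T. \<forall>i<d. W i r w \<in> A r i} | T A.
     finite T \<and> T \<subseteq> {0..s} \<and> (\<forall>r i. A r i \<in> sets borel)} \<union> null_sets M"

lemma bm_cylinders_sets: "bm_cylinders s \<subseteq> sets M"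
proof -
  have *: "{w \<in> space M. \<forall>r\<in>T. \<forall>i<d. W i r w \<in> A r i} \<in> sets M"
    if "finite T" "T \<subseteq> {0..s}" "\<forall>r i. A r i \<in> sets borel" for T A
  proof -
    have [measurable]: "W i r \<in> borel_measurable M" if "i < d" "r \<in> T" for i r
      using W_measurable that \<open>T \<subseteq> _\<close> by auto
    have "{w \<in> space M. \<forall>r\<in>T. \<forall>i\<in>{..<d}. W i r w \<in> A r i} \<in> sets M"
    proof (intro sets.sets_Collect_finite_All)
      fix r i assume "r \<in> T" "i \<in> {..<d}"
      then have "W i r -` A r i \<inter> space M \<in> sets M" using that W_measurable[of i r] by (intro measurable_sets[of _ M borel]) auto
      then show "{w \<in> space M. W i r w \<in> A r i} \<in> sets M" by (simp add: vimage_def Int_def conj_commute)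
    qed (use that in auto)
    then show ?thesis by (simp add: Ball_def)
  qed
  show ?thesis unfolding bm_cylinders_def
  proof (rule Un_least)
    show "{{w \<in> space M. \<forall>r\<in>T. \<forall>i<d. W i r w \<in> A r i} |T A.
      finite T \<and> T \<subseteq> {0..s} \<and> (\<forall>r i. A r i \<in> sets borel)} \<subseteq> sets M"
      using * by blast
  qed auto
qed

lemma Int_stable_bm_cylinders: "Int_stable (bm_cylinders s)"
proof (rule Int_stableI)
  fix a b assume ab: "a \<in> bm_cylinders s" "b \<in> bm_cylinders s"
  show "a \<inter> b \<in> bm_cylinders s"
  proof (cases "a \<in> null_sets M \<or> b \<in> null_sets M")
    case True
    then have "a \<inter> b \<in> null_sets M"
      using ab bm_cylinders_sets[of s] by (auto intro: null_set_Int1 null_set_Int2)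
    then show ?thesis by (auto simp: bm_cylinders_def)
  next
    case False
    then obtain T A T' A' where
      a: "a = {w \<in> space M. \<forall>r\<in>T. \<forall>i<d. W i r w \<in> A r i}" "finite T" "T \<subseteq> {0..s}" "\<forall>r i. A r i \<in> sets borel" and
      b: "b = {w \<in> space M. \<forall>r\<in>T'. \<forall>i<d. W i r w \<in> A' r i}" "finite T'" "T' \<subseteq> {0..s}" "\<forall>r i. A' r i \<in> sets borel"
      using ab unfolding bm_cylinders_def by blast
    define A'' where "A'' r i = (if r \<in> T then A r i else UNIV) \<inter> (if r \<in> T' then A' r i else UNIV)" for r i
    have "a \<inter> b = {w \<in> space M. \<forall>r\<in>T \<union> T'. \<forall>i<d. W i r w \<in> A'' r i}"
      unfolding a(1) b(1) A''_def by auto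
    moreover have "\<forall>r i. A'' r i \<in> sets borel" using a b by (auto simp: A''_def)
    ultimately show ?thesis using a b unfolding bm_cylinders_def
      by (intro UnI1 CollectI exI[of _ "T \<union> T'"] exI[of _ A'']) auto
  qed
qed

lemma sets_bm_filtration_subset: "sets (\<F> s) \<subseteq> sigma_sets (space M) (bm_cylinders s)"
  unfolding sets_bm_filtration
proof (rule sigma_sets_mono, safe)
  fix i r and B :: "real set" assume *: "i < d" "0 \<le> r" "r \<le> s" "B \<in> sets borel"
  have "W i r -` B \<inter> space M = {w \<in> space M. \<forall>r'\<in>{r}. \<forall>j<d. W j r' w \<in> (if j = i then B else UNIV)}"
    using * by auto
  also have "\<dots> \<in> bm_cylinders s" unfolding bm_cylinders_def
    using * by (intro UnI1 CollectI exI[of _ "{r}"] exI[of _ "\<lambda>r j. if j = i then B else UNIV"]) auto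
  finally show "W i r -` B \<inter> space M \<in> sigma_sets (space M) (bm_cylinders s)" by auto
qed (auto simp: null_sets_of_eq bm_cylinders_def)

section \<open>Independence of Brownian increments from the past\<close>

lemma bm_increment_measurable:
  "0 \<le> s \<Longrightarrow> 0 \<le> t \<Longrightarrow> bm_increment d W s t \<in> measurable M (PiM {..<d} (\<lambda>_. borel))"
  unfolding bm_increment_def[abs_def] using W_measurable by (intro measurable_restrict) auto

text \<open>With 0 and s adjoined to the times of the cylinder, each \<open>W i r\<close> is a sum
  of increments over consecutive times up to s. So the cylinder is an event of the increments before
  s, and the increment from s to t is the next, independent one.\<close>

lemma prob_bm_cylinder_Int:
  assumes st: "0 \<le> s" "s < t" and a: "a \<in> bm_cylinders s" and C: "C \<in> sets (PiM {..<d} (\<lambda>_. borel))"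
  shows "prob (a \<inter> (bm_increment d W s t -` C \<inter> space M)) = prob a * prob (bm_increment d W s t -` C \<inter> space M)"
proof (cases "a \<in> null_sets M")
  case True
  have "bm_increment d W s t -` C \<inter> space M \<in> sets M"
    using bm_increment_measurable[of s t] st C by (auto intro: measurable_sets)
  then have "a \<inter> (bm_increment d W s t -` C \<inter> space M) \<in> null_sets M" using True by (auto intro: null_set_Int1 null_set_Int2)
  then show ?thesis using True by (simp add: null_sets_def measure_def)
next
  case False
  then obtain T A where
    a: "a = {w \<in> space M. \<forall>r\<in>T. \<forall>i<d. W i r w \<in> A r i}" "finite T" "T \<subseteq> {0..s}" "\<forall>r i. A r i \<in> sets borel"
    using a unfolding bm_cylinders_def by blast
  define L where "L = sorted_list_of_set (insert 0 (insert s T))"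
  define ts where "ts = L @ [t]"
  have L: "sorted_wrt (<) L" "set L = insert 0 (insert s T)" using a(2)
    unfolding L_def by (simp_all only: strict_sorted_list_of_set set_sorted_list_of_set finite_insert)
  then have L_ne: "L \<noteq> []" by auto
  define m where "m = length L - 1"
  have lenL: "length L = Suc m" using L_ne by (simp add: m_def)
  have srt: "sorted_wrt (<) ts" using L st a(3) by (auto simp: ts_def sorted_wrt_append)
  have ts0: "\<forall>t\<in>set ts. 0 \<le> t" using L st a(3) by (auto simp: ts_def)
  have Lle: "L ! j \<le> L ! k" if "j \<le> k" "k \<le> m" for j k
    using sorted_wrt_nth_less[OF L(1), of j k] that lenL by (cases "j = k") auto
  have L0: "L ! 0 = 0"
  proof -
    obtain k where "k \<le> m" "L ! k = 0" using L(2) lenL by (metis in_set_conv_nth insertI1 less_Suc_eq_le)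
    moreover have "0 \<le> L ! 0" using L(2) st a(3) lenL nth_mem[of 0 L] by auto
    ultimately show ?thesis using Lle[of 0 k] by auto
  qed
  have Lm: "L ! m = s"
  proof -
    obtain k where "k \<le> m" "L ! k = s" using L(2) lenL by (metis in_set_conv_nth insertI1 insertI2 less_Suc_eq_le)
    moreover have "L ! m \<le> s" using L(2) st a(3) lenL nth_mem[of m L] by auto
    ultimately show ?thesis using Lle[of k m] by auto
  qed
  let ?N = "PiM {..<d} (\<lambda>_. borel :: real measure)"
  define X where "X k = bm_increment d W (ts ! k) (ts ! Suc k)" for k
  have "{k. Suc k < length ts} = {..m}" using lenL by (auto simp: ts_def)
  then have ind: "indep_vars (\<lambda>_. ?N) X {..m}"
    using bm srt ts0 unfolding brownian_motion_def X_def by auto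
  have Xm: "X m = bm_increment d W s t" using lenL Lm by (simp add: X_def ts_def nth_append)
  have iv: "indep_var (PiM {..<m} (\<lambda>_. ?N)) (\<lambda>w. restrict (\<lambda>k. X k w) {..<m}) (PiM {m} (\<lambda>_. ?N)) (\<lambda>w. restrict (\<lambda>k. X k w) {m})"
    by (rule indep_var_restrict[OF ind]) auto
  have Wsum: "W i (L ! k) w = (\<Sum>j<k. X j w i)" if "k \<le> m" "i < d" "w \<in> space M" for k i w
    using that
  proof (induction k)
    case 0 then show ?case by (simp add: L0 W_0)
  next
    case (Suc k)
    then show ?case using lenL by (simp add: X_def bm_increment_def ts_def nth_append)
  qed
  \<comment> \<open>The cylinder as a condition on increments: \<open>W i (L ! k)\<close> is the sum
    of the first k of them, by \<open>Wsum\<close>.\<close>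
  define P where "P = {x \<in> space (PiM {..<m} (\<lambda>_. ?N)). \<forall>k\<in>{k\<in>{..m}. L ! k \<in> T}. \<forall>i\<in>{..<d}. (\<Sum>j<k. x j i) \<in> A (L ! k) i}"
  have "P \<in> sets (PiM {..<m} (\<lambda>_. ?N))" unfolding P_def
  proof (intro sets.sets_Collect_finite_All)
    fix k i assume ki: "k \<in> {k\<in>{..m}. L ! k \<in> T}" "i \<in> {..<d}"
    have "(\<lambda>x. \<Sum>j<k. x j i) \<in> borel_measurable (PiM {..<m} (\<lambda>_. ?N))"
    proof (intro borel_measurable_sum)
      fix j assume "j \<in> {..<k}"
      then have "(\<lambda>x. x j) \<in> measurable (PiM {..<m} (\<lambda>_. ?N)) ?N" using ki by (intro measurable_component_singleton) auto
      from measurable_compose[OF this measurable_component_singleton[of i]] ki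
      show "(\<lambda>x. x j i) \<in> borel_measurable (PiM {..<m} (\<lambda>_. ?N))" by simp
    qed
    from measurable_sets[OF this, of "A (L ! k) i"] a(4)
    show "{x \<in> space (PiM {..<m} (\<lambda>_. ?N)). (\<Sum>j<k. x j i) \<in> A (L ! k) i} \<in> sets (PiM {..<m} (\<lambda>_. ?N))"
      by (simp add: vimage_def Int_def conj_commute)
  qed auto
  moreover define Q where "Q = {x \<in> space (PiM {m} (\<lambda>_. ?N)). x m \<in> C}"
  have "Q \<in> sets (PiM {m} (\<lambda>_. ?N))"
  proof -
    have "(\<lambda>x. x m) -` C \<inter> space (PiM {m} (\<lambda>_. ?N)) \<in> sets (PiM {m} (\<lambda>_. ?N))"
      using C by (intro measurable_sets[OF measurable_component_singleton]) auto
    also have "(\<lambda>x. x m) -` C \<inter> space (PiM {m} (\<lambda>_. ?N)) = Q" unfolding Q_def by blast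
    finally show ?thesis .
  qed
  moreover have Xs: "X k w \<in> space ?N" if "k \<le> m" "w \<in> space M" for k w
    by (simp add: X_def bm_increment_def space_PiM)
  have eqP: "(\<lambda>w. restrict (\<lambda>k. X k w) {..<m}) -` P \<inter> space M = a"
  proof -
    have "(restrict (\<lambda>k. X k w) {..<m} \<in> P) = (\<forall>r\<in>T. \<forall>i<d. W i r w \<in> A r i)" if w: "w \<in> space M" for w
    proof -
      have "(restrict (\<lambda>k. X k w) {..<m} \<in> P) \<longleftrightarrow> (\<forall>k\<in>{k\<in>{..m}. L ! k \<in> T}. \<forall>i\<in>{..<d}. (\<Sum>j<k. X j w i) \<in> A (L ! k) i)"
        using Xs w by (auto simp: P_def space_PiM PiE_iff)
      also have "\<dots> \<longleftrightarrow> (\<forall>k\<in>{k\<in>{..m}. L ! k \<in> T}. \<forall>i\<in>{..<d}. W i (L ! k) w \<in> A (L ! k) i)"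
        using Wsum w by auto
      also have "\<dots> \<longleftrightarrow> (\<forall>r\<in>T. \<forall>i<d. W i r w \<in> A r i)"
      proof -
        have "\<exists>k\<le>m. L ! k = r" if "r \<in> T" for r
          using L(2) lenL that by (metis in_set_conv_nth insertI2 less_Suc_eq_le)
        then show ?thesis by fastforce
      qed
      finally show ?thesis .
    qed
    then show ?thesis unfolding a(1) by auto
  qed
  moreover have eqQ: "(\<lambda>w. restrict (\<lambda>k. X k w) {m}) -` Q \<inter> space M = bm_increment d W s t -` C \<inter> space M"
    using Xs by (auto simp: Q_def Xm[symmetric] space_PiM)
  moreover have "(\<lambda>w. (restrict (\<lambda>k. X k w) {..<m}, restrict (\<lambda>k. X k w) {m})) -` (P \<times> Q) \<inter> space M
      = a \<inter> (bm_increment d W s t -` C \<inter> space M)"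
    unfolding eqP[symmetric] eqQ[symmetric] by blast
  ultimately show ?thesis
    using indep_varD[OF iv, of P Q] by (simp only:)
qed

text \<open>Independence extends from intersection-stable generators to the generated
  sigma-algebras; the preimages under a single random vector are intersection-stable
  themselves.\<close>

lemma indep_bm_increment:
  assumes st: "0 \<le> s" "s < t"
  shows "indep_set (sets (\<F> s)) {bm_increment d W s t -` C \<inter> space M | C. C \<in> sets (PiM {..<d} (\<lambda>_. borel))}"
    (is "indep_set _ ?E")
proof -
  have E: "?E \<subseteq> sets M" using bm_increment_measurable[of s t] st by (auto intro: measurable_sets)
  have "indep_set (bm_cylinders s) ?E"
    unfolding indep_sets2_eq using bm_cylinders_sets E prob_bm_cylinder_Int[OF st] by blast
  moreover have "Int_stable ?E"
  proof (rule Int_stableI)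
    fix a b assume "a \<in> ?E" "b \<in> ?E"
    then obtain A B where "a = bm_increment d W s t -` A \<inter> space M" "A \<in> sets (PiM {..<d} (\<lambda>_. borel))"
      "b = bm_increment d W s t -` B \<inter> space M" "B \<in> sets (PiM {..<d} (\<lambda>_. borel))" by auto
    then show "a \<inter> b \<in> ?E" by (intro CollectI exI[of _ "A \<inter> B"]) auto
  qed
  ultimately have "indep_set (sigma_sets (space M) (bm_cylinders s)) (sigma_sets (space M) ?E)"
    using Int_stable_bm_cylinders by (intro indep_set_sigma_sets)
  then show ?thesis
    unfolding indep_sets2_eq using sets_bm_filtration_subset[of s] sets_bm_filtrationD E by blast
qed

lemma indep_var_bm_increment:
  assumes st: "0 \<le> s" "s < t" and i: "i < d" and z: "z \<in> borel_measurable (\<F> s)"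
  shows "indep_var borel z borel (\<lambda>w. W i t w - W i s w)"
  unfolding indep_var_eq
proof (intro conjI)
  show "z \<in> borel_measurable M" using z by (rule measurable_bm_filtrationD)
  show Wm: "(\<lambda>w. W i t w - W i s w) \<in> borel_measurable M" using W_measurable[OF i] st by (intro borel_measurable_diff) auto
  let ?E = "{bm_increment d W s t -` C \<inter> space M | C. C \<in> sets (PiM {..<d} (\<lambda>_. borel))}"
  let ?D = "{(\<lambda>w. W i t w - W i s w) -` A \<inter> space M | A. A \<in> sets borel}"
  have "sigma_sets (space M) {z -` A \<inter> space M | A. A \<in> sets borel} \<subseteq> sets (\<F> s)"
    using sets.sigma_sets_subset[of "{z -` A \<inter> space M | A. A \<in> sets borel}" "\<F> s"] measurable_sets[OF z] by auto
  moreover have "?D \<subseteq> ?E"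
  proof safe
    fix A :: "real set" assume A: "A \<in> sets borel"
    let ?C = "{x \<in> space (PiM {..<d} (\<lambda>_. borel)). x i \<in> A}"
    have "?C \<in> sets (PiM {..<d} (\<lambda>_. borel))"
      using measurable_sets[OF measurable_component_singleton[of i "{..<d}" "\<lambda>_. borel"] A] i
      by (simp add: vimage_def Int_def conj_commute)
    moreover have "(\<lambda>w. W i t w - W i s w) -` A \<inter> space M = bm_increment d W s t -` ?C \<inter> space M"
      using i by (auto simp: bm_increment_def space_PiM)
    ultimately show "\<exists>C. (\<lambda>w. W i t w - W i s w) -` A \<inter> space M = bm_increment d W s t -` C \<inter> space M
       \<and> C \<in> sets (PiM {..<d} (\<lambda>_. borel))" by blast
  qed
  moreover have "sigma_sets (space M) ?D = ?D"
    using sets_vimage_algebra[of "space M" "\<lambda>w. W i t w - W i s w" borel]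
      sets_vimage_algebra2[of "\<lambda>w. W i t w - W i s w" "space M" borel] by simp
  moreover note indep_bm_increment[OF st]
  ultimately show "indep_set (sigma_sets (space M) {z -` A \<inter> space M | A. A \<in> sets borel}) (sigma_sets (space M) ?D)"
    unfolding indep_sets2_eq by (metis (no_types, lifting) subset_eq)
qed

text \<open>Under the product density a moment of coordinate i factors into one-dimensional Gaussian
  integrals: each other coordinate contributes its total mass, coordinate i its centred moment. Only
  finiteness of the second moment is extracted, not its value.\<close>

lemma bm_increment_moments:
  assumes st: "0 \<le> s" "s < t" and i: "i < d"
  shows "integrable M (\<lambda>w. (W i t w - W i s w)\<^sup>2)" "(\<integral>w. W i t w - W i s w \<partial>M) = 0"
proof -
  interpret P: product_sigma_finite "\<lambda>_::nat. lborel :: real measure" by standard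
  let ?N = "PiM {..<d} (\<lambda>_. lborel :: real measure)" and ?g = "normal_density 0 (sqrt (t - s))"
  have dist: "distributed M ?N (bm_increment d W s t) (\<lambda>x. ennreal (\<Prod>i<d. ?g (x i)))"
    using bm st by (simp add: brownian_motion_def)
  have pos: "0 < sqrt (t - s)" using st by simp
  have mom: "integrable ?N (\<lambda>x. (\<Prod>j<d. ?g (x j)) * x i ^ k)"
    "(\<integral>x. (\<Prod>j<d. ?g (x j)) * x i ^ k \<partial>?N) = (\<Prod>j<d. \<integral>y. ?g y * (if j = i then y ^ k else 1) \<partial>lborel)" for k
  proof -
    \<comment> \<open>The power of coordinate i is pushed into the product, as 1 in all other
      factors, so that the integral of a product function applies.\<close>
    have *: "(\<lambda>x. (\<Prod>j<d. ?g (x j)) * x i ^ k) = (\<lambda>x. \<Prod>j<d. ?g (x j) * (if j = i then x j ^ k else 1))"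
      using i by (simp add: prod.distrib fun_eq_iff)
    have int: "integrable lborel (\<lambda>y. ?g y * (if j = i then y ^ k else 1))" for j
      using integrable_normal_moment[OF pos, of 0 k] integrable_normal_density[OF pos, of 0] by (cases "j = i") auto
    show "integrable ?N (\<lambda>x. (\<Prod>j<d. ?g (x j)) * x i ^ k)" unfolding *
      using P.product_integrable_prod[OF finite_lessThan int] by simp
    show "(\<integral>x. (\<Prod>j<d. ?g (x j)) * x i ^ k \<partial>?N) = (\<Prod>j<d. \<integral>y. ?g y * (if j = i then y ^ k else 1) \<partial>lborel)" unfolding *
      using P.product_integral_prod[OF finite_lessThan int] by simp
  qed
  have nn: "0 \<le> (\<Prod>j<d. ?g (x j))" for x by (intro prod_nonneg) auto
  have bi: "bm_increment d W s t w i = W i t w - W i s w" for w using i by (simp add: bm_increment_def)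
  show "integrable M (\<lambda>w. (W i t w - W i s w)\<^sup>2)"
    using distributed_integrable[OF dist, of "\<lambda>x. (x i)\<^sup>2"] mom(1)[of 2] nn i by (simp add: bi)
  have "(\<integral>w. W i t w - W i s w \<partial>M) = (\<integral>x. (\<Prod>j<d. ?g (x j)) * x i \<partial>?N)"
    using distributed_integral[OF dist, of "\<lambda>x. x i"] nn i by (simp add: bi)
  also have "\<dots> = 0"
    using mom(2)[of 1] integral_normal_moment_nz_1[OF pos, of 0] i
    by (auto intro!: prod_zero bexI[of _ i])
  finally show "(\<integral>w. W i t w - W i s w \<partial>M) = 0" .
qed

lemma adapted_mult_bm_increment:
  assumes st: "0 \<le> s" "s \<le> t" and i: "i < d" and z: "z \<in> borel_measurable (\<F> s)" "integrable M (\<lambda>w. (z w)\<^sup>2)"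
  shows "integrable M (\<lambda>w. (z w * (W i t w - W i s w))\<^sup>2)" "(\<integral>w. z w * (W i t w - W i s w) \<partial>M) = 0"
proof -
  have zM: "z \<in> borel_measurable M" using z by (auto intro: measurable_bm_filtrationD)
  have Wm: "(\<lambda>w. W i t w - W i s w) \<in> borel_measurable M" using W_measurable[OF i] st by (intro borel_measurable_diff) auto
  \<comment> \<open>Independence and the Gaussian law are given for s < t only; for s = t the
    increment is 0.\<close>
  consider "s = t" | "s < t" using st by linarith
  then have "integrable M (\<lambda>w. (z w * (W i t w - W i s w))\<^sup>2) \<and> (\<integral>w. z w * (W i t w - W i s w) \<partial>M) = 0"
  proof cases
    case 2
    note iv = indep_var_bm_increment[OF st(1) 2 i z(1)]
    note m = bm_increment_moments[OF st(1) 2 i]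
    have "integrable M (\<lambda>w. (z w)\<^sup>2 * (W i t w - W i s w)\<^sup>2)"
      using indep_var_integrable[OF indep_var_compose[OF iv, of "\<lambda>x. x\<^sup>2" borel "\<lambda>x. x\<^sup>2" borel]] z(2) m(1)
      by (simp add: comp_def)
    moreover have "integrable M z" "integrable M (\<lambda>w. W i t w - W i s w)"
      using square_integrable_imp_integrable[OF zM z(2)] square_integrable_imp_integrable[OF Wm m(1)] by auto
    ultimately show ?thesis
      using indep_var_lebesgue_integral[OF iv] m(2) by (simp add: power_mult_distrib)
  qed simp
  then show "integrable M (\<lambda>w. (z w * (W i t w - W i s w))\<^sup>2)" "(\<integral>w. z w * (W i t w - W i s w) \<partial>M) = 0" by auto
qed

end

section \<open>The Ito integral as a martingale\<close>

lemma power2_diff_le: "((x::real) - y)\<^sup>2 \<le> 2 * x\<^sup>2 + 2 * y\<^sup>2"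
  using sum_squares_bound[of x "- y"] by (simp add: power2_diff)

lemma (in prob_space) abs_integral_le_esqrt:
  assumes "f \<in> borel_measurable M"
  shows "ennreal \<bar>\<integral>w. f w \<partial>M\<bar> \<le> esqrt (\<integral>\<^sup>+w. ennreal ((f w)\<^sup>2) \<partial>M)"
proof (cases "integrable M f")
  case True
  have "ennreal \<bar>\<integral>w. f w \<partial>M\<bar> \<le> ennreal (\<integral>w. \<bar>f w\<bar> \<partial>M)"
    by (intro ennreal_leI integral_abs_bound)
  also have "\<dots> = (\<integral>\<^sup>+w. ennreal \<bar>f w\<bar> \<partial>M)"
    using True by (intro nn_integral_eq_integral[symmetric]) auto
  also have "\<dots> \<le> esqrt (\<integral>\<^sup>+w. (ennreal \<bar>f w\<bar>)\<^sup>2 \<partial>M)"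
    using assms by (intro nn_integral_le_esqrt) auto
  finally show ?thesis by (simp add: ennreal_power)
\<comment> \<open>A non-integrable function has integral 0 by convention, so the bound is
  trivial.\<close>
qed (simp add: not_integrable_integral_eq)

lemma square_integrable_add:
  fixes f g :: "'a \<Rightarrow> real"
  assumes [measurable]: "f \<in> borel_measurable M" "g \<in> borel_measurable M"
    and "integrable M (\<lambda>w. (f w)\<^sup>2)" "integrable M (\<lambda>w. (g w)\<^sup>2)"
  shows "integrable M (\<lambda>w. (f w + g w)\<^sup>2)"
proof (rule Bochner_Integration.integrable_bound)
  show "integrable M (\<lambda>w. 2 * (f w)\<^sup>2 + 2 * (g w)\<^sup>2)" using assms by auto
  show "AE w in M. norm ((f w + g w)\<^sup>2) \<le> norm (2 * (f w)\<^sup>2 + 2 * (g w)\<^sup>2)"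
    by (intro AE_I2) (smt (verit) real_norm_def sum_squares_bound power2_sum zero_le_power2)
qed simp

lemma square_integrable_diff:
  fixes f g :: "'a \<Rightarrow> real"
  assumes "f \<in> borel_measurable M" "g \<in> borel_measurable M"
    and "integrable M (\<lambda>w. (f w)\<^sup>2)" "integrable M (\<lambda>w. (g w)\<^sup>2)"
  shows "integrable M (\<lambda>w. (f w - g w)\<^sup>2)"
  using square_integrable_add[of f M "\<lambda>w. - g w"] assms by simp

lemma square_integrable_sum:
  fixes f :: "'i \<Rightarrow> 'a \<Rightarrow> real"
  assumes "\<And>i. i \<in> I \<Longrightarrow> f i \<in> borel_measurable M" "\<And>i. i \<in> I \<Longrightarrow> integrable M (\<lambda>w. (f i w)\<^sup>2)"
  shows "integrable M (\<lambda>w. (\<Sum>i\<in>I. f i w)\<^sup>2)"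
  using assms
proof (induction I rule: infinite_finite_induct)
  case (insert x I)
  have "integrable M (\<lambda>w. (f x w + (\<Sum>i\<in>I. f i w))\<^sup>2)"
    using insert by (intro square_integrable_add borel_measurable_sum) auto
  then show ?case using insert by simp
qed auto

context brownian_space
begin

text \<open>On a cell [a, b] the integrals up to s and up to t differ by the Brownian increment over
  the intersection of [a, b] with [s, t]. Its left end \<open>max s a\<close> is a time at which
  both an integrand fixed at a and an event of time s are known.\<close>

lemma W_increment_split:
  assumes "a \<le> b" "s \<le> t"
  shows "(W i (min t b) w - W i (min t a) w) - (W i (min s b) w - W i (min s a) w)
     = (if max s a \<le> min t b then W i (min t b) w - W i (max s a) w else 0)"
  using assms by (auto simp: min_def max_def)

text \<open>After the splitting, each summand is an integrand known at \<open>max s (ts ! k)\<close>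
  times a Brownian increment starting there. The indicator of \<open>B\<close> is absorbed into the
  integrand, so the mean vanishes by independence.\<close>

lemma simple_ito_increment:
  assumes z: "simple_integrand M \<F> d ts z" and st: "0 \<le> s" "s \<le> t"
  shows "integrable M (\<lambda>w. (simple_ito d W ts z t w - simple_ito d W ts z s w)\<^sup>2)" (is ?A)
    and "(\<lambda>w. simple_ito d W ts z t w - simple_ito d W ts z s w) \<in> borel_measurable M" (is ?B)
    and "B \<in> sets (\<F> s) \<Longrightarrow> (\<integral>w. indicator B w * (simple_ito d W ts z t w - simple_ito d W ts z s w) \<partial>M) = 0" (is "_ \<Longrightarrow> ?C B")
proof -
  define g where "g k i w = z k i w * (if max s (ts ! k) \<le> min t (ts ! Suc k) then W i (min t (ts ! Suc k)) w - W i (max s (ts ! k)) w else 0)" for k i w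
  have ts: "ts ! k \<le> ts ! Suc k" "0 \<le> ts ! k" if "Suc k < length ts" for k
  proof -
    have srt: "sorted_wrt (<) ts" "hd ts = 0" "ts \<noteq> []" using z by (auto simp: simple_integrand_def)
    show "ts ! k \<le> ts ! Suc k" using sorted_wrt_nth_less[OF srt(1), of k "Suc k"] that by auto
    have "ts ! 0 = 0" using srt by (simp add: hd_conv_nth)
    then show "0 \<le> ts ! k" using sorted_wrt_nth_less[OF srt(1), of 0 k] that by (cases "k = 0") auto
  qed
  have eq: "simple_ito d W ts z t w - simple_ito d W ts z s w = (\<Sum>k | Suc k < length ts. \<Sum>i<d. g k i w)" for w
    unfolding simple_ito_def sum_subtractf[symmetric] g_def
    by (intro sum.cong refl) (subst W_increment_split[symmetric], use ts st in \<open>auto simp: algebra_simps\<close>)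
  have zm: "z k i \<in> borel_measurable (\<F> (ts ! k))" "integrable M (\<lambda>w. (z k i w)\<^sup>2)" if "Suc k < length ts" "i < d" for k i
    using z that by (auto simp: simple_integrand_def)
  have g: "integrable M (\<lambda>w. (g k i w)\<^sup>2)" "g k i \<in> borel_measurable M"
    "B \<in> sets (\<F> s) \<Longrightarrow> (\<integral>w. indicator B w * g k i w \<partial>M) = 0" if ki: "Suc k < length ts" "i < d" for k i B
  proof -
    let ?u = "max s (ts ! k)" and ?v = "min t (ts ! Suc k)"
    note zm = zm[OF ki]
    have z_u: "z k i \<in> borel_measurable (\<F> ?u)" by (rule measurable_bm_filtration_mono[OF zm(1)]) simp
    have zM: "z k i \<in> borel_measurable M" using zm by (auto intro: measurable_bm_filtrationD)
    have u: "0 \<le> ?u" using st by simp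
    have vpos: "0 \<le> ?v" using st ts[OF ki(1)] by auto
    show "g k i \<in> borel_measurable M"
      unfolding g_def[abs_def] using W_measurable[OF ki(2) u] W_measurable[OF ki(2) vpos] zM by auto
    show "integrable M (\<lambda>w. (g k i w)\<^sup>2)"
      unfolding g_def[abs_def] using adapted_mult_bm_increment(1)[OF u _ ki(2) z_u zm(2), of ?v]
      by (cases "?u \<le> ?v") (simp_all only: if_True if_False, simp)
    show "(\<integral>w. indicator B w * g k i w \<partial>M) = 0" if B: "B \<in> sets (\<F> s)"
    proof -
      have Bu: "B \<in> sets (\<F> ?u)" using bm_filtration_mono[of s ?u] B by auto
      have BM: "B \<in> sets M" using B by (rule sets_bm_filtrationD)
      have zB: "(\<lambda>w. indicator B w * z k i w) \<in> borel_measurable (\<F> ?u)" using Bu z_u by measurable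
      have "integrable M (\<lambda>w. indicator B w * (z k i w)\<^sup>2)"
        using integrable_real_mult_indicator[OF BM zm(2)] by (simp add: mult.commute)
      also have "(\<lambda>w. indicator B w * (z k i w)\<^sup>2) = (\<lambda>w. (indicator B w * z k i w)\<^sup>2)"
        by (auto simp: fun_eq_iff indicator_def)
      finally have zB2: "integrable M (\<lambda>w. (indicator B w * z k i w)\<^sup>2)" .
      show ?thesis
        unfolding g_def using adapted_mult_bm_increment(2)[OF u _ ki(2) zB zB2, of ?v]
        by (cases "?u \<le> ?v") (simp_all only: if_True if_False mult.assoc, simp)
    qed
  qed
  show ?B unfolding eq using g(2) by (intro borel_measurable_sum) auto
  show ?A unfolding eq using g(1,2) by (intro square_integrable_sum borel_measurable_sum) auto
  show "?C B" if B: "B \<in> sets (\<F> s)"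
  proof -
    have BM: "B \<in> sets M" using B by (rule sets_bm_filtrationD)
    have int: "integrable M (\<lambda>w. indicator B w * g k i w)" if "Suc k < length ts" "i < d" for k i
      using integrable_real_mult_indicator[OF BM square_integrable_imp_integrable[OF g(2,1)[OF that]]]
      by (simp add: mult.commute)
    have "(\<integral>w. (\<Sum>k | Suc k < length ts. \<Sum>i<d. indicator B w * g k i w) \<partial>M)
        = (\<Sum>k | Suc k < length ts. \<integral>w. (\<Sum>i<d. indicator B w * g k i w) \<partial>M)"
      using int by (intro Bochner_Integration.integral_sum Bochner_Integration.integrable_sum) auto
    also have "\<dots> = (\<Sum>k | Suc k < length ts. \<Sum>i<d. \<integral>w. indicator B w * g k i w \<partial>M)"
      using int by (intro sum.cong refl Bochner_Integration.integral_sum) auto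
    also have "\<dots> = 0" using g(3)[OF _ _ B] by (intro sum.neutral ballI) auto
    finally show ?thesis by (simp only: eq sum_distrib_left)
  qed
qed

lemma simple_ito_0: "simple_integrand M \<F> d ts z \<Longrightarrow> simple_ito d W ts z 0 w = 0"
proof -
  assume z: "simple_integrand M \<F> d ts z"
  have "min 0 (ts ! k) = 0" if "k < length ts" for k
  proof -
    have srt: "sorted_wrt (<) ts" "hd ts = 0" "ts \<noteq> []" using z by (auto simp: simple_integrand_def)
    have "ts ! 0 = 0" using srt by (simp add: hd_conv_nth)
    then show ?thesis using sorted_wrt_nth_less[OF srt(1), of 0 k] that by (cases "k = 0") auto
  qed
  then show ?thesis by (simp add: simple_ito_def)
qed

text \<open>The mean-zero property passes to the limit: it holds exactly for each simple
  approximation, and the discrepancy on \<open>B\<close> is bounded by the L2 errors of the n-th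
  approximation at the two times s and t, which tend to 0.\<close>

lemma ito_integral_martingale:
  assumes I: "is_ito_integral M \<F> d W Z I" and t: "0 \<le> t"
  shows "I t \<in> borel_measurable (\<F> t)" (is ?A) and "integrable M (\<lambda>w. (I t w)\<^sup>2)" (is ?B)
    and "0 \<le> s \<Longrightarrow> s \<le> t \<Longrightarrow> B \<in> sets (\<F> s) \<Longrightarrow> (\<integral>w. indicator B w * (I t w - I s w) \<partial>M) = 0" (is "_ \<Longrightarrow> _ \<Longrightarrow> _ \<Longrightarrow> ?C s B")
proof -
  obtain tss zs where z: "\<And>n. simple_integrand M \<F> d (tss n) (zs n)"
    and lim: "\<And>t. 0 \<le> t \<Longrightarrow> (\<lambda>n. \<integral>\<^sup>+ w. ennreal ((simple_ito d W (tss n) (zs n) t w - I t w)\<^sup>2) \<partial>M) \<longlonglongrightarrow> 0"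
    using I unfolding is_ito_integral_def by blast
  define J where "J n t w = simple_ito d W (tss n) (zs n) t w" for n t w
  have J0: "J n 0 w = 0" for n w
    using z[of n] by (simp add: J_def simple_ito_0)
  have J: "J n t \<in> borel_measurable M" "integrable M (\<lambda>w. (J n t w)\<^sup>2)" if "0 \<le> t" for n t
    using simple_ito_increment(1,2)[OF z[of n] order_refl that] J0[of n] unfolding J_def[symmetric] by auto
  have Im: "I t \<in> borel_measurable (\<F> t)" if "0 \<le> t" for t using I that by (auto simp: is_ito_integral_def)
  then show ?A using t by auto
  have ImM[measurable]: "I t \<in> borel_measurable M" if "0 \<le> t" for t using Im[OF that] by (rule measurable_bm_filtrationD)
  \<comment> \<open>One approximation at finite L2 distance suffices: \<open>I t\<close> is the
    difference of the square integrable functions \<open>J n t\<close> and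
    \<open>J n t - I t\<close>.\<close>
  have I2: "integrable M (\<lambda>w. (I t w)\<^sup>2)" if t: "0 \<le> t" for t
  proof -
    have "\<forall>\<^sub>F n in sequentially. (\<integral>\<^sup>+ w. ennreal ((J n t w - I t w)\<^sup>2) \<partial>M) < 1"
      using order_tendstoD(2)[OF lim[OF t], of 1] by (simp add: J_def)
    then obtain n where n: "(\<integral>\<^sup>+ w. ennreal ((J n t w - I t w)\<^sup>2) \<partial>M) < 1"
      by (auto simp: eventually_sequentially)
    have [measurable]: "J n t \<in> borel_measurable M" "I t \<in> borel_measurable M" using J ImM t by auto
    have "integrable M (\<lambda>w. (J n t w - I t w)\<^sup>2)"
      using n by (intro integrableI_bounded) (auto intro: less_trans[OF _ ennreal_one_less_top])
    then have "integrable M (\<lambda>w. (J n t w - (J n t w - I t w))\<^sup>2)"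
      using J[OF t] by (intro square_integrable_diff[of "J n t" M "\<lambda>w. J n t w - I t w"]) auto
    then show ?thesis by simp
  qed
  show ?B by (rule I2[OF t])
  show "?C s B" if s: "0 \<le> s" "s \<le> t" and B: "B \<in> sets (\<F> s)"
  proof -
    have BM[measurable]: "B \<in> sets M" using B by (rule sets_bm_filtrationD)
    have [measurable]: "J n t \<in> borel_measurable M" "J n s \<in> borel_measurable M" "I t \<in> borel_measurable M" "I s \<in> borel_measurable M" for n
      using J ImM t s by auto
    have int: "integrable M (\<lambda>w. indicator B w * f w)" if "f \<in> borel_measurable M" "integrable M (\<lambda>w. (f w)\<^sup>2)" for f :: "'a \<Rightarrow> real"
      using integrable_real_mult_indicator[OF BM square_integrable_imp_integrable[OF that]] by (simp add: mult.commute)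
    let ?e = "\<lambda>n t. \<integral>\<^sup>+ w. ennreal ((J n t w - I t w)\<^sup>2) \<partial>M"
    have "ennreal \<bar>\<integral>w. indicator B w * (I t w - I s w) \<partial>M\<bar> \<le> esqrt (2 * ?e n t + 2 * ?e n s)" for n
    proof -
      have i: "integrable M (\<lambda>w. indicator B w * J n t w)" "integrable M (\<lambda>w. indicator B w * J n s w)"
        "integrable M (\<lambda>w. indicator B w * I t w)" "integrable M (\<lambda>w. indicator B w * I s w)"
        using J I2 t s by (auto intro!: int)
      have "(\<integral>w. indicator B w * (J n t w - J n s w) \<partial>M) = 0"
        using simple_ito_increment(3)[OF z s B] by (simp add: J_def)
      then have "\<bar>\<integral>w. indicator B w * (I t w - I s w) \<partial>M\<bar> = \<bar>\<integral>w. indicator B w * ((J n t w - I t w) - (J n s w - I s w)) \<partial>M\<bar>"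
        using i by (simp add: right_diff_distrib)
      also have "ennreal \<dots> \<le> esqrt (\<integral>\<^sup>+w. ennreal ((indicator B w * ((J n t w - I t w) - (J n s w - I s w)))\<^sup>2) \<partial>M)"
        by (intro abs_integral_le_esqrt) measurable
      also have "\<dots> \<le> esqrt (\<integral>\<^sup>+w. 2 * ennreal ((J n t w - I t w)\<^sup>2) + 2 * ennreal ((J n s w - I s w)\<^sup>2) \<partial>M)"
      proof (intro esqrt_mono nn_integral_mono)
        fix w
        have "(indicator B w * ((J n t w - I t w) - (J n s w - I s w)))\<^sup>2 \<le> ((J n t w - I t w) - (J n s w - I s w))\<^sup>2"
          by (auto simp: indicator_def)
        also have "\<dots> \<le> 2 * (J n t w - I t w)\<^sup>2 + 2 * (J n s w - I s w)\<^sup>2"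
          by (rule power2_diff_le)
        finally show "ennreal ((indicator B w * ((J n t w - I t w) - (J n s w - I s w)))\<^sup>2) \<le> 2 * ennreal ((J n t w - I t w)\<^sup>2) + 2 * ennreal ((J n s w - I s w)\<^sup>2)"
          by (simp add: ennreal_mult'[symmetric] ennreal_plus[symmetric] ennreal_numeral[symmetric] ennreal_leI del: ennreal_plus ennreal_numeral)
      qed
      also have "\<dots> = esqrt (2 * ?e n t + 2 * ?e n s)"
        by (simp add: nn_integral_add nn_integral_cmult)
      finally show ?thesis .
    qed
    then have "(ennreal \<bar>\<integral>w. indicator B w * (I t w - I s w) \<partial>M\<bar>)\<^sup>2 \<le> 2 * ?e n t + 2 * ?e n s" for n
      using power_mono[of "ennreal \<bar>\<integral>w. indicator B w * (I t w - I s w) \<partial>M\<bar>" "esqrt (2 * ?e n t + 2 * ?e n s)" 2]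
      unfolding esqrt_power2 by simp
    moreover have "(\<lambda>n. 2 * ?e n t + 2 * ?e n s) \<longlonglongrightarrow> 2 * 0 + 2 * 0"
      using lim t s unfolding J_def by (intro tendsto_add ennreal_tendsto_cmult) auto
    ultimately have "(ennreal \<bar>\<integral>w. indicator B w * (I t w - I s w) \<partial>M\<bar>)\<^sup>2 \<le> 2 * 0 + 2 * 0"
      by (intro LIMSEQ_le_const) auto
    then show ?thesis by (simp add: ennreal_power)
  qed
qed

text \<open>By monotonicity the condition \<open>q j < x\<close> holds on an initial segment of the
  indices, so the sum telescopes. \<open>J\<close> is the first index with
  \<open>x \<le> q J\<close>, or \<open>N\<close> if there is none below \<open>N\<close>.\<close>

lemma sum_stopped_telescope:
  fixes a q :: "nat \<Rightarrow> real"
  assumes q: "mono q"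
  shows "\<exists>J\<le>N. (\<Sum>j<N. if q j < x then a (Suc j) - a j else 0) = a J - a 0 \<and>
    (\<forall>j<J. q j < x) \<and> (J < N \<longrightarrow> x \<le> q J)"
proof (induction N)
  case (Suc N)
  then obtain J where J: "J \<le> N" "(\<Sum>j<N. if q j < x then a (Suc j) - a j else 0) = a J - a 0"
    "\<forall>j<J. q j < x" "J < N \<longrightarrow> x \<le> q J" by blast
  show ?case
  proof (cases "q N < x")
    case True
    have "J = N" using J True monoD[OF q, of J N] by (cases "J < N") auto
    then show ?thesis using J True by (intro exI[of _ "Suc N"]) (auto simp: less_Suc_eq)
  next
    case False
    then show ?thesis using J by (intro exI[of _ J]) (auto simp: less_Suc_eq le_Suc_eq)
  qed
qed simp

lemma stopping_time_less_sets:
  assumes "is_stopping_time M \<F> \<tau>" "0 \<le> r"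
  shows "{w \<in> space M. r < \<tau> w} \<in> sets (\<F> r)"
proof -
  have "space (\<F> r) - {w \<in> space M. \<tau> w \<le> r} \<in> sets (\<F> r)"
    using assms by (intro sets.compl_sets) (auto simp: is_stopping_time_def)
  also have "space (\<F> r) - {w \<in> space M. \<tau> w \<le> r} = {w \<in> space M. r < \<tau> w}" by auto
  finally show ?thesis .
qed

text \<open>Optional stopping. The integral is continuous in time only almost surely, so its value
  at the random time is an almost sure limit of measurable functions; accordingly a measurable
  version \<open>\<Delta>\<close> is asserted to exist. Square integrability of \<open>I t\<close>
  alone supplies the dominating function.\<close>

lemma ito_integral_stopped_increment:
  assumes I: "is_ito_integral M \<F> d W Z I" and tau: "is_stopping_time M \<F> \<tau>" and s: "0 \<le> s" "s \<le> t"
  shows "\<exists>\<Delta>. integrable M \<Delta> \<and> (AE w in M. \<Delta> w = I (min t (\<tau> w)) w - I (min s (\<tau> w)) w) \<and>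
    (\<forall>B\<in>sets (\<F> s). (\<integral>w. indicator B w * \<Delta> w \<partial>M) = 0)"
proof -
  have t: "0 \<le> t" using s by simp
  note Im = ito_integral_martingale[OF I]
  have cont: "AE w in M. continuous_on {0..} (\<lambda>t. I t w)" using I by (simp add: is_ito_integral_def)
  \<comment> \<open>\<open>X k\<close> below is the integral up to \<open>\<tau>\<close> rounded up to level-\<open>k\<close> dyadics; Doob's inequality dominates all levels at once\<close>
  define p where "p k j = s + real j * ((t - s) / 2 ^ k)" for k j :: nat
  have p_mono: "mono (p k)" for k using s unfolding p_def by (intro monoI add_left_mono mult_right_mono) auto
  have p_ge: "s \<le> p k j" "0 \<le> p k j" for k j using s by (auto simp: p_def)
  have p_le: "p k j \<le> t" if "j \<le> 2 ^ k" for k j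
  proof -
    have "real j * ((t - s) / 2 ^ k) \<le> 2 ^ k * ((t - s) / 2 ^ k)"
      using s that of_nat_mono[OF that, where 'a = real] by (intro mult_right_mono) auto
    then show ?thesis by (simp add: p_def)
  qed
  have p_end: "p k (2 ^ k) = t" "p k 0 = s" for k by (auto simp: p_def)
  have p_Suc: "p k j = p (Suc k) (2 * j)" for k j by (simp add: p_def)
  have IM[measurable]: "I (p k j) \<in> borel_measurable M" "I t \<in> borel_measurable M" for k j
    using Im(1)[OF p_ge(2)] Im(1)[OF t] by (auto intro: measurable_bm_filtrationD)
  have Ii: "integrable M (I r)" if "0 \<le> r" for r
    by (rule square_integrable_imp_integrable[OF measurable_bm_filtrationD[OF Im(1)[OF that]] Im(2)[OF that]])
  define S where "S k w = (SUP j\<in>{..2 ^ k}. ennreal \<bar>I (p k j) w\<bar>)" for k w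
  have S_meas[measurable]: "S k \<in> borel_measurable M" for k unfolding S_def[abs_def] by measurable
  have S_mono: "S k w \<le> S (Suc k) w" for k w unfolding S_def
  proof (rule SUP_mono)
    fix j assume "j \<in> {..(2::nat) ^ k}"
    then show "\<exists>j'\<in>{..2 ^ Suc k}. ennreal \<bar>I (p k j) w\<bar> \<le> ennreal \<bar>I (p (Suc k) j') w\<bar>"
      by (intro bexI[of _ "2 * j"]) (simp_all only: p_Suc[symmetric] order_refl, simp)
  qed
  have S2: "(\<integral>\<^sup>+w. (S k w)\<^sup>2 \<partial>M) \<le> 4 * (\<integral>\<^sup>+w. (ennreal \<bar>I t w\<bar>)\<^sup>2 \<partial>M)" for k
  proof -
    \<comment> \<open>Indices beyond \<open>2 ^ k\<close> are frozen at the time t, because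
      \<open>doob_L2\<close> is stated for infinite sequences.\<close>
    let ?D = "\<lambda>n. I (p k (min n (2 ^ k)))"
    have "(\<integral>\<^sup>+w. (SUP n\<in>{..2 ^ k}. ennreal \<bar>?D n w\<bar>)\<^sup>2 \<partial>M) \<le> 4 * (\<integral>\<^sup>+w. (ennreal \<bar>I t w\<bar>)\<^sup>2 \<partial>M)"
    proof (rule doob_L2[where F = "\<lambda>n. \<F> (p k (min n (2 ^ k)))"])
      fix n :: nat and \<phi> :: "'a \<Rightarrow> ennreal" let ?n = "min n (2 ^ k)"
      assume \<phi>: "\<phi> \<in> borel_measurable (\<F> (p k ?n))"
      interpret sigma_finite_subalgebra M "\<F> (p k ?n)" by (rule sigma_finite_subalgebra_bm_filtration)
      show "(\<integral>\<^sup>+w. \<phi> w * ennreal \<bar>?D n w\<bar> \<partial>M) \<le> (\<integral>\<^sup>+w. \<phi> w * ennreal \<bar>I t w\<bar> \<partial>M)"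
      proof (rule nn_integral_abs_cond_exp_le[OF Ii[OF t] Ii[OF p_ge(2)] Im(1)[OF p_ge(2)] _ \<phi>])
        fix B assume B: "B \<in> sets (\<F> (p k ?n))"
        then have BM: "B \<in> sets M" by (rule sets_bm_filtrationD)
        have "(\<integral>w. indicator B w * (I t w - I (p k ?n) w) \<partial>M) = 0"
          using B by (intro Im(3) t p_ge p_le) auto
        moreover have "integrable M (\<lambda>w. indicator B w * I t w)" "integrable M (\<lambda>w. indicator B w * I (p k ?n) w)"
          using integrable_real_mult_indicator[OF BM Ii[OF t]] integrable_real_mult_indicator[OF BM Ii[OF p_ge(2)]]
          by (simp_all add: mult.commute)
        ultimately show "(\<integral>w\<in>B. I t w \<partial>M) = (\<integral>w\<in>B. I (p k ?n) w \<partial>M)"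
          by (simp add: set_lebesgue_integral_def right_diff_distrib)
      qed
    next
      show "m \<le> n \<Longrightarrow> sets (\<F> (p k (min m (2 ^ k)))) \<subseteq> sets (\<F> (p k (min n (2 ^ k))))" for m n
        using p_mono by (intro bm_filtration_mono) (auto intro: monoD)
    qed (use Im p_ge subalgebra_bm_filtration in auto)
    then show ?thesis by (simp add: S_def cong: SUP_cong_simp)
  qed
  define G where "G w = (SUP k. (S k w)\<^sup>2)" for w
  have G_meas[measurable]: "G \<in> borel_measurable M" unfolding G_def[abs_def] by measurable
  have "(\<integral>\<^sup>+w. G w \<partial>M) = (SUP k. \<integral>\<^sup>+w. (S k w)\<^sup>2 \<partial>M)" unfolding G_def
    by (rule nn_integral_monotone_convergence_SUP) (auto intro!: incseq_SucI le_funI power_mono S_mono)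
  also have "\<dots> \<le> 4 * (\<integral>\<^sup>+w. (ennreal \<bar>I t w\<bar>)\<^sup>2 \<partial>M)" by (rule SUP_least) (rule S2)
  also have "\<dots> < \<infinity>" using Im(2)[OF t]
    by (simp add: ennreal_power nn_integral_eq_integral ennreal_mult_less_top)
  finally have G_fin: "(\<integral>\<^sup>+w. G w \<partial>M) < \<infinity>" .
  then have G_AE: "AE w in M. G w \<noteq> \<infinity>" by (intro nn_integral_PInf_AE) auto
  \<comment> \<open>A cell is counted if it starts before \<open>\<tau>\<close>. This event is known
    at the start of the cell, so each counted increment keeps conditional mean 0; it is the reason
    for rounding up and not down.\<close>
  define X where "X k w = (\<Sum>j<2 ^ k. if p k j < \<tau> w then I (p k (Suc j)) w - I (p k j) w else 0)" for k w
  note tau_gt = stopping_time_less_sets[OF tau]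
  have X_ind: "X k w = (\<Sum>j<2 ^ k. indicator {w \<in> space M. p k j < \<tau> w} w * (I (p k (Suc j)) w - I (p k j) w))" if "w \<in> space M" for k w
    unfolding X_def using that by (intro sum.cong) auto
  have gM: "{w \<in> space M. p k j < \<tau> w} \<in> sets M" for k j using tau_gt[OF p_ge(2)] by (rule sets_bm_filtrationD)
  have X_meas[measurable]: "X k \<in> borel_measurable M" for k
    by (subst measurable_cong[OF X_ind]) (use gM in measurable)
  have X0: "(\<integral>w. indicator B w * X k w \<partial>M) = 0" if B: "B \<in> sets (\<F> s)" for B k
  proof -
    let ?B = "\<lambda>j. B \<inter> {w \<in> space M. p k j < \<tau> w}"
    have B': "?B j \<in> sets (\<F> (p k j))" for j
      using B bm_filtration_mono[OF p_ge(1)] tau_gt[OF p_ge(2)] by blast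
    have "(\<integral>w. indicator B w * X k w \<partial>M) = (\<integral>w. (\<Sum>j<2 ^ k. indicator (?B j) w * (I (p k (Suc j)) w - I (p k j) w)) \<partial>M)"
      by (rule Bochner_Integration.integral_cong) (auto simp: X_ind sum_distrib_left indicator_def intro!: sum.cong)
    also have "\<dots> = (\<Sum>j<2 ^ k. \<integral>w. indicator (?B j) w * (I (p k (Suc j)) w - I (p k j) w) \<partial>M)"
    proof (rule Bochner_Integration.integral_sum)
      fix j
      show "integrable M (\<lambda>w. indicator (?B j) w * (I (p k (Suc j)) w - I (p k j) w))"
        using integrable_real_mult_indicator[OF sets_bm_filtrationD[OF B'] Bochner_Integration.integrable_diff[OF Ii Ii], OF p_ge(2) p_ge(2)]
        by (simp add: mult.commute)
    qed
    also have "\<dots> = 0"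
      using B' p_ge p_mono by (intro sum.neutral ballI Im(3)) (auto intro: monoD)
    finally show ?thesis .
  qed
  have tel: "\<exists>J\<le>2 ^ k. X k w = I (p k J) w - I s w \<and> (\<forall>j<J. p k j < \<tau> w) \<and> (J < 2 ^ k \<longrightarrow> \<tau> w \<le> p k J)" for k w
    using sum_stopped_telescope[OF p_mono, where x = "\<tau> w" and a = "\<lambda>j. I (p k j) w" and N = "2 ^ k"]
    by (simp add: X_def p_end)
  have X_bound: "norm (X k w) \<le> 1 + 4 * enn2real (G w)" if "G w \<noteq> \<infinity>" for k w
  proof -
    obtain J where J: "J \<le> 2 ^ k" "X k w = I (p k J) w - I s w" using tel by blast
    have le: "(I (p k j) w)\<^sup>2 \<le> enn2real (G w)" if "j \<le> 2 ^ k" for j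
    proof -
      have "ennreal ((I (p k j) w)\<^sup>2) = (ennreal \<bar>I (p k j) w\<bar>)\<^sup>2" by (simp add: ennreal_power)
      also have "\<dots> \<le> (S k w)\<^sup>2" unfolding S_def using that by (intro power_mono SUP_upper) auto
      also have "\<dots> \<le> G w" unfolding G_def by (rule SUP_upper) auto
      finally show ?thesis using \<open>G w \<noteq> \<infinity>\<close> by (cases "G w") auto
    qed
    \<comment> \<open>Through |x| \<le> 1 + x^2 the bound on squares, uniform in k, serves directly
      as an integrable majorant.\<close>
    have "\<bar>X k w\<bar> \<le> 1 + (X k w)\<^sup>2" using sum_squares_bound[of 1 "\<bar>X k w\<bar>"] by simp
    also have "(X k w)\<^sup>2 \<le> 2 * (I (p k J) w)\<^sup>2 + 2 * (I (p k 0) w)\<^sup>2"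
      unfolding J p_end by (rule power2_diff_le)
    also have "\<dots> \<le> 4 * enn2real (G w)" using le[OF J(1)] le[of 0] by simp
    finally show ?thesis by simp
  qed
  have X_lim: "(\<lambda>k. X k w) \<longlonglongrightarrow> I (min t (\<tau> w)) w - I (min s (\<tau> w)) w" if c: "continuous_on {0..} (\<lambda>t. I t w)" for w
  proof -
    define J where "J k = (SOME J. J \<le> 2 ^ k \<and> X k w = I (p k J) w - I s w \<and> (\<forall>j<J. p k j < \<tau> w) \<and> (J < 2 ^ k \<longrightarrow> \<tau> w \<le> p k J))" for k
    have J: "\<And>k. J k \<le> 2 ^ k" "\<And>k. X k w = I (p k (J k)) w - I s w" "\<And>k j. j < J k \<Longrightarrow> p k j < \<tau> w"
      "\<And>k. J k < 2 ^ k \<Longrightarrow> \<tau> w \<le> p k (J k)"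
      using someI_ex[OF tel[of _ w], folded J_def] by blast+
    show ?thesis
    proof (cases "\<tau> w \<le> s")
      case True
      have "J k = 0" for k using J(3)[of 0 k] True by (auto simp: p_end)
      then show ?thesis using True s J(2) by (simp add: p_end min_absorb2)
    next
      case False
      let ?m = "min t (\<tau> w)"
      have "\<bar>p k (J k) - ?m\<bar> \<le> (t - s) * (1 / 2) ^ k" for k
      proof -
        \<comment> \<open>Since s < \<tau>, at least one cell is counted. The last counted cell
          starts at or before \<open>?m\<close> and ends at or after it, so \<open>p k (J k)\<close>
          overshoots \<open>?m\<close> by at most one mesh width.\<close>
        have "J k \<noteq> 0" using J(4)[of k] False by (cases "J k = 0") (simp_all add: p_end)
        then obtain j where j: "J k = Suc j" by (cases "J k") auto
        have "p k j \<le> ?m" using J(3)[of j k] p_le[of j k] J(1)[of k] j by auto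
        moreover have "p k (J k) = p k j + (t - s) * (1 / 2) ^ k"
          by (simp add: p_def j field_simps power_one_over)
        moreover have "?m \<le> p k (J k)" using J(4)[of k] J(1)[of k] p_end(1)[of k] by (cases "J k < 2 ^ k") auto
        ultimately show ?thesis by auto
      qed
      moreover have "(\<lambda>k. (t - s) * (1 / 2) ^ k) \<longlonglongrightarrow> 0"
        by (intro tendsto_mult_right_zero LIMSEQ_power_zero) auto
      ultimately have "(\<lambda>k. p k (J k)) \<longlonglongrightarrow> ?m"
        by (subst LIM_zero_iff[symmetric]) (rule Lim_null_comparison, auto)
      then have "(\<lambda>k. I (p k (J k)) w) \<longlonglongrightarrow> I ?m w"
        using p_ge t False s by (intro continuous_on_tendsto_compose[OF c]) auto
      moreover have "min s (\<tau> w) = s" using False by simp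
      ultimately show ?thesis unfolding J(2) by (auto intro: tendsto_diff)
    qed
  qed
  \<comment> \<open>Measurable also where the sequence diverges: \<open>lim\<close> then returns one
    fixed default value.\<close>
  define \<Delta> where "\<Delta> w = lim (\<lambda>k. X k w)" for w
  have [measurable]: "\<Delta> \<in> borel_measurable M" unfolding \<Delta>_def[abs_def] by measurable
  have AE_lim: "AE w in M. (\<lambda>k. X k w) \<longlonglongrightarrow> \<Delta> w \<and> \<Delta> w = I (min t (\<tau> w)) w - I (min s (\<tau> w)) w"
    using cont
  proof eventually_elim
    case (elim w)
    show ?case using X_lim[OF elim] limI[OF X_lim[OF elim]] by (simp add: \<Delta>_def)
  qed
  have bi: "integrable M (\<lambda>w. 1 + 4 * enn2real (G w))"
  proof -
    have "(\<integral>\<^sup>+w. ennreal (enn2real (G w)) \<partial>M) = (\<integral>\<^sup>+w. G w \<partial>M)"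
      using G_AE by (intro nn_integral_cong_AE) (auto elim!: eventually_mono simp: less_top)
    then have "integrable M (\<lambda>w. enn2real (G w))"
      using G_fin by (intro integrableI_nonneg) auto
    then show ?thesis by simp
  qed
  have "integrable M \<Delta>"
    by (rule integrable_dominated_convergence[where s = X, OF _ _ bi])
      (use AE_lim X_bound G_AE in \<open>auto elim: eventually_mono\<close>)
  moreover have "(\<integral>w. indicator B w * \<Delta> w \<partial>M) = 0" if B: "B \<in> sets (\<F> s)" for B
  proof -
    have [measurable]: "B \<in> sets M" using B by (rule sets_bm_filtrationD)
    have "(\<lambda>k. \<integral>w. indicator B w * X k w \<partial>M) \<longlonglongrightarrow> (\<integral>w. indicator B w * \<Delta> w \<partial>M)"
    proof (rule integral_dominated_convergence[OF _ _ bi])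
      show "AE w in M. (\<lambda>k. indicator B w * X k w) \<longlonglongrightarrow> indicator B w * \<Delta> w"
        using AE_lim by eventually_elim (auto intro: tendsto_mult_left)
      show "AE w in M. norm (indicator B w * X k w) \<le> 1 + 4 * enn2real (G w)" for k
        using G_AE by eventually_elim (use X_bound[of _ k] in \<open>force simp: indicator_def\<close>)
    qed measurable
    then show ?thesis by (simp add: X0[OF B] LIMSEQ_const_iff)
  qed
  ultimately show ?thesis using AE_lim by (intro exI[of _ \<Delta>]) auto
qed

end

section \<open>Oscillation of Hoelder continuous processes\<close>

text \<open>When k grows by one, the dyadic truncation \<open>x k\<close> of t either stays or moves
  by one step of the next grid. So \<open>inc\<close> bounds the way from a towards t by a geometric
  series, and continuity reaches t itself.\<close>

lemma dyadic_chaining: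
  fixes g :: "real \<Rightarrow> real"
  assumes h: "0 < h" and c: "continuous_on {a..a + h} g" and r: "0 \<le> r" "r < 1" and B: "0 \<le> B"
    and inc: "\<And>k j. j < 2 ^ k \<Longrightarrow> \<bar>g (a + real (Suc j) * (h / 2 ^ k)) - g (a + real j * (h / 2 ^ k))\<bar> \<le> B * r ^ k"
    and t: "t \<in> {a..a + h}"
  shows "\<bar>g t - g a\<bar> \<le> B / (1 - r)"
proof -
  define u where "u = (t - a) / h"
  have u: "0 \<le> u" "u \<le> 1" "t = a + h * u" using t h by (auto simp: u_def field_simps)
  define n where "n k = nat \<lfloor>2 ^ k * u\<rfloor>" for k :: nat
  have rn: "real (n k) = of_int \<lfloor>2 ^ k * u\<rfloor>" for k using u by (simp add: n_def)
  have n_bd: "real (n k) \<le> 2 ^ k * u" "2 ^ k * u < real (n k) + 1" for k unfolding rn by linarith+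
  have n_le: "n k \<le> 2 ^ k" for k
  proof -
    have "real (n k) \<le> 2 ^ k * 1" using n_bd(1)[of k] u by (meson mult_left_mono order_trans zero_le_numeral zero_le_power)
    then show ?thesis by (metis mult.right_neutral of_nat_le_iff of_nat_numeral of_nat_power)
  qed
  define x where "x k = a + real (n k) * (h / 2 ^ k)" for k
  have step: "\<bar>g (x k) - g a\<bar> \<le> B * (\<Sum>i\<le>k. r ^ i)" for k
  proof (induction k)
    case 0
    \<comment> \<open>\<open>n 0\<close> is 1 exactly if t is the right end point; the single step
      from a to a + h is then charged to level 0.\<close>
    have "n 0 = 0 \<or> n 0 = 1" using n_le[of 0] by auto
    then show ?case using inc[of 0 0] B by (auto simp: x_def)
  next
    case (Suc k)
    have "real (n (Suc k)) < real (2 * n k + 2)" "real (2 * n k) < real (n (Suc k) + 1)"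
      using n_bd[of k] n_bd[of "Suc k"] by auto
    then have "n (Suc k) = 2 * n k \<or> n (Suc k) = Suc (2 * n k)" unfolding of_nat_less_iff by linarith
    moreover have pk: "x k = a + real (2 * n k) * (h / 2 ^ Suc k)" by (simp add: x_def)
    moreover have "0 \<le> B * r ^ Suc k" using B r by simp
    ultimately have "\<bar>g (x (Suc k)) - g (x k)\<bar> \<le> B * r ^ Suc k"
    proof (elim disjE)
      assume "n (Suc k) = Suc (2 * n k)"
      then show ?thesis using inc[of "2 * n k" "Suc k"] n_le[of "Suc k"] unfolding pk x_def[of "Suc k"] by simp
    qed (simp add: x_def)
    then show ?case using Suc by (simp add: distrib_left)
  qed
  have geo: "(\<Sum>i\<le>k. r ^ i) \<le> 1 / (1 - r)" for k
    using sum_le_suminf[of "\<lambda>i. r ^ i" "{..k}"] r suminf_geometric[of r] summable_geometric[of r] by auto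
  have bd: "\<bar>g (x k) - g a\<bar> \<le> B / (1 - r)" for k
    using step[of k] mult_left_mono[OF geo[of k] B] by simp
  have x_in: "x k \<in> {a..a + h}" for k
  proof -
    have "real (n k) * (h / 2 ^ k) \<le> 2 ^ k * (h / 2 ^ k)"
      using n_le[of k] h of_nat_mono[OF n_le[of k], where 'a = real] by (intro mult_right_mono) auto
    then show ?thesis using h by (simp add: x_def)
  qed
  have "x \<longlonglongrightarrow> t"
  proof -
    have "\<bar>x k - t\<bar> \<le> h * (1 / 2) ^ k" for k
    proof -
      have "x k - t = (h / 2 ^ k) * (real (n k) - 2 ^ k * u)"
        by (simp add: x_def u(3) field_simps)
      also have "\<bar>\<dots>\<bar> \<le> (h / 2 ^ k) * 1"
        unfolding abs_mult using n_bd[of k] h by (intro mult_mono) auto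
      finally show ?thesis by (simp add: power_one_over field_simps)
    qed
    moreover have "(\<lambda>k. h * (1 / 2) ^ k) \<longlonglongrightarrow> 0"
      by (intro tendsto_mult_right_zero LIMSEQ_power_zero) auto
    ultimately show ?thesis
      by (subst LIM_zero_iff[symmetric]) (rule Lim_null_comparison, auto)
  qed
  then have "(\<lambda>k. g (x k)) \<longlonglongrightarrow> g t"
    using x_in t by (intro continuous_on_tendsto_compose[OF c]) auto
  then have "(\<lambda>k. \<bar>g (x k) - g a\<bar>) \<longlonglongrightarrow> \<bar>g t - g a\<bar>" by (intro tendsto_intros)
  then show ?thesis by (rule LIMSEQ_le_const2) (use bd in auto)
qed

text \<open>The supremum ranges over infinitely many cells. A cell that starts after
  \<open>\<tau>\<close> has no oscillation, and the probability of starting before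
  \<open>\<tau>\<close> decays exponentially in the starting time. Summation over the cells thus
  costs a factor of order 1/h, which after taking a p-th root is h^(-1/p); a large p hides it in
  \<open>\<epsilon>\<close>.\<close>

lemma (in prob_space) expectation_sup_increments:
  fixes Y :: "real \<Rightarrow> 'a \<Rightarrow> real"
  assumes Y[measurable]: "\<And>t. 0 \<le> t \<Longrightarrow> Y t \<in> borel_measurable M"
    and cont: "AE w in M. continuous_on {0..} (\<lambda>t. Y t w)"
    and const: "AE w in M. \<forall>t\<ge>\<tau> w. Y t w = \<xi> w"
    and tau[measurable]: "\<tau> \<in> borel_measurable M"
    and m: "0 < m" "integrable M (\<lambda>w. exp (m * \<tau> w))"
    and \<alpha>: "0 < \<alpha>"
    and holder: "\<And>p. p \<ge> 2 \<Longrightarrow> \<exists>Cp>0. \<forall>s\<ge>0. \<forall>t\<ge>0. \<bar>s - t\<bar> \<le> 1 \<longrightarrow>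
         (\<integral>\<^sup>+ w. ennreal (\<bar>Y s w - Y t w\<bar> powr p) \<partial>M) \<le> ennreal (Cp * \<bar>s - t\<bar> powr (\<alpha> * p))"
    and \<epsilon>: "0 < \<epsilon>"
  shows "\<exists>C>0. \<forall>h\<in>{0<..1}. \<exists>S\<in>borel_measurable M. (\<forall>w. 0 \<le> S w) \<and>
     (AE w in M. \<forall>n::nat. \<forall>t\<in>{real n * h..real n * h + h}. \<bar>Y t w - Y (real n * h) w\<bar> \<le> S w) \<and>
     (\<integral>\<^sup>+w. ennreal (S w ^ 4) \<partial>M) \<le> ennreal (C * h powr (4 * (\<alpha> - \<epsilon>)))"
proof -
  \<comment> \<open>\<open>4 \<le> \<alpha> * p\<close> makes the sum over dyadic levels converge,
    \<open>1 / p \<le> \<epsilon>\<close> absorbs the sum over cells, and \<open>4 \<le> p\<close>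
    allows passing to the fourth moment.\<close>
  define p where "p = 4 / \<alpha> + 4 + 1 / \<epsilon>"
  have p: "4 \<le> p" "4 \<le> \<alpha> * p" "1 / p \<le> \<epsilon>"
  proof -
    show "4 \<le> p" "4 \<le> \<alpha> * p" using \<alpha> \<epsilon> by (auto simp: p_def field_simps)
    have "1 / \<epsilon> \<le> p" using \<alpha> by (simp add: p_def)
    then have "1 / p \<le> 1 / (1 / \<epsilon>)" using \<epsilon> \<open>4 \<le> p\<close> by (intro divide_left_mono) auto
    then show "1 / p \<le> \<epsilon>" by simp
  qed
  \<comment> \<open>The exponent is \<open>2 * p\<close> because Cauchy-Schwarz will separate an
    increment from the event that its cell starts before \<open>\<tau>\<close>.\<close>
  obtain Cp where Cp: "0 < Cp" and holder: "\<And>s t. 0 \<le> s \<Longrightarrow> 0 \<le> t \<Longrightarrow> \<bar>s - t\<bar> \<le> 1 \<Longrightarrow>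
         (\<integral>\<^sup>+ w. ennreal (\<bar>Y s w - Y t w\<bar> powr (2 * p)) \<partial>M) \<le> ennreal (Cp * \<bar>s - t\<bar> powr (\<alpha> * (2 * p)))"
    using holder[of "2 * p"] p by auto
  define K where "K = (\<integral>w. exp (m * \<tau> w) \<partial>M)"
  have K0: "0 \<le> K" unfolding K_def by simp
  have tail: "emeasure M {w \<in> space M. x \<le> \<tau> w} \<le> ennreal (K * exp (- m * x))" for x
  proof -
    have "emeasure M {w \<in> space M. x \<le> \<tau> w} = (\<integral>\<^sup>+w. indicator {w \<in> space M. x \<le> \<tau> w} w \<partial>M)" by simp
    also have "\<dots> \<le> (\<integral>\<^sup>+w. ennreal (exp (m * \<tau> w) * exp (- m * x)) \<partial>M)"
      using m by (intro nn_integral_mono) (auto simp: indicator_def exp_add[symmetric])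
    also have "\<dots> = ennreal (K * exp (- m * x))"
      using m by (subst nn_integral_eq_integral) (auto simp: K_def)
    finally show ?thesis .
  qed
  \<comment> \<open>Half of the Hoelder exponent is given away. The p-th moment of an increment at
    level k is of order 2^(-k \<alpha> p); after division by r^(k p) there remains 2^(-k \<alpha> p
    / 2) \<le> 4^(-k), enough against the 2^k increments of that level.\<close>
  define r where "r = (2::real) powr (- \<alpha> / 2)"
  have r: "0 < r" "r < 1" using \<alpha> by (auto simp: r_def powr_less_one)
  \<comment> \<open>The 2 is the sum of 2^(-k) over the levels. The last factor, divided by h,
    bounds the geometric series over the cells with ratio exp(-(m/2) h).\<close>
  define c where "c = 2 * sqrt K * sqrt Cp * ((1 + m / 2) / (m / 2))"
  have c0: "0 \<le> c" using K0 Cp m by (simp add: c_def)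
  show ?thesis
  proof (intro exI[of _ "(1 + c) / (1 - r) ^ 4"] conjI ballI)
    show "0 < (1 + c) / (1 - r) ^ 4" using c0 r by simp
    fix h :: real assume h: "h \<in> {0<..1}"
    define D where "D n k j w = \<bar>Y (real n * h + real (Suc j) * (h / 2 ^ k)) w - Y (real n * h + real j * (h / 2 ^ k)) w\<bar>" for n k j :: nat and w
    have D_meas[measurable]: "D n k j \<in> borel_measurable M" for n k j
      unfolding D_def[abs_def] using h by (intro borel_measurable_abs borel_measurable_diff Y add_nonneg_nonneg mult_nonneg_nonneg) auto
    define q where "q n k j w = indicator {w \<in> space M. real n * h \<le> \<tau> w} w * ennreal ((D n k j w / r ^ k) powr p)" for n k j :: nat and w
    have q_meas[measurable]: "q n k j \<in> borel_measurable M" for n k j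
      unfolding q_def[abs_def] by measurable
    \<comment> \<open>One random variable above the p-th power of every normalized increment in
      every cell. Its p-th root \<open>B\<close> serves as the chaining constant for all cells at
      once.\<close>
    define Q where "Q w = (\<Sum>n. \<Sum>k. \<Sum>j<2 ^ k. q n k j w)" for w
    have Q_meas[measurable]: "Q \<in> borel_measurable M" unfolding Q_def[abs_def] by measurable
    have q_int: "(\<integral>\<^sup>+w. q n k j w \<partial>M) \<le> ennreal (sqrt K * sqrt Cp * h powr (\<alpha> * p) * exp (- (m / 2) * h) ^ n * (1 / 4) ^ k)" for n k j
    proof -
      have "(\<integral>\<^sup>+w. q n k j w \<partial>M) \<le> esqrt (\<integral>\<^sup>+w. (indicator {w \<in> space M. real n * h \<le> \<tau> w} w)\<^sup>2 \<partial>M)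
          * esqrt (\<integral>\<^sup>+w. (ennreal ((D n k j w / r ^ k) powr p))\<^sup>2 \<partial>M)"
        unfolding q_def by (intro nn_integral_mult_le_esqrt) auto
      also have "(\<integral>\<^sup>+w. (indicator {w \<in> space M. real n * h \<le> \<tau> w} w :: ennreal)\<^sup>2 \<partial>M) = emeasure M {w \<in> space M. real n * h \<le> \<tau> w}"
      proof -
        have "(\<integral>\<^sup>+w. (indicator {w \<in> space M. real n * h \<le> \<tau> w} w :: ennreal)\<^sup>2 \<partial>M) = (\<integral>\<^sup>+w. indicator {w \<in> space M. real n * h \<le> \<tau> w} w \<partial>M)"
          by (intro nn_integral_cong) (simp split: split_indicator)
        also have "\<dots> = emeasure M {w \<in> space M. real n * h \<le> \<tau> w}" by (intro nn_integral_indicator) measurable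
        finally show ?thesis .
      qed
      also have "esqrt \<dots> \<le> ennreal (sqrt (K * exp (- m * (real n * h))))"
        using esqrt_mono[OF tail[of "real n * h"]] K0 by (simp add: esqrt_ennreal)
      also have "(\<integral>\<^sup>+w. (ennreal ((D n k j w / r ^ k) powr p))\<^sup>2 \<partial>M) = (\<integral>\<^sup>+w. ennreal (r powr (- (real k * (2 * p)))) * ennreal (D n k j w powr (2 * p)) \<partial>M)"
      proof (intro nn_integral_cong)
        fix w
        have D0: "0 \<le> D n k j w" by (simp add: D_def)
        have "((D n k j w / r ^ k) powr p)\<^sup>2 = (D n k j w / r ^ k) powr (2 * p)"
          by (simp add: powr_mult_base powr_add[symmetric] power2_eq_square)
        also have "\<dots> = D n k j w powr (2 * p) / (r ^ k) powr (2 * p)"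
          using D0 r by (simp add: powr_divide)
        also have "(r ^ k) powr (2 * p) = r powr (real k * (2 * p))"
          using r by (simp add: powr_realpow[symmetric] powr_powr)
        finally show "(ennreal ((D n k j w / r ^ k) powr p))\<^sup>2 = ennreal (r powr (- (real k * (2 * p)))) * ennreal (D n k j w powr (2 * p))"
          by (simp add: ennreal_power ennreal_mult'[symmetric] powr_minus field_simps)
      qed
      also have "\<dots> = ennreal (r powr (- (real k * (2 * p)))) * (\<integral>\<^sup>+w. ennreal (D n k j w powr (2 * p)) \<partial>M)"
        by (rule nn_integral_cmult) auto
      also have "(\<integral>\<^sup>+w. ennreal (D n k j w powr (2 * p)) \<partial>M) \<le> ennreal (Cp * (h / 2 ^ k) powr (\<alpha> * (2 * p)))"
      proof -
        have "h / 2 ^ k \<le> 1" using h by (auto simp: field_simps intro: order_trans[of _ 1])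
        moreover have "\<bar>(real n * h + real (Suc j) * (h / 2 ^ k)) - (real n * h + real j * (h / 2 ^ k))\<bar> = h / 2 ^ k"
          using h by (simp add: algebra_simps add_divide_distrib)
        ultimately show ?thesis
          using holder[of "real n * h + real (Suc j) * (h / 2 ^ k)" "real n * h + real j * (h / 2 ^ k)"] h
          by (simp add: D_def)
      qed
      also have "ennreal (r powr (- (real k * (2 * p)))) * ennreal (Cp * (h / 2 ^ k) powr (\<alpha> * (2 * p)))
         \<le> ennreal (Cp * (h powr (\<alpha> * p) * (1 / 4) ^ k)\<^sup>2)"
      proof -
        have "r powr (- (real k * (2 * p))) * (h / 2 ^ k) powr (\<alpha> * (2 * p))
           = 2 powr (\<alpha> * p * real k) * (h powr (2 * (\<alpha> * p)) / 2 powr (2 * (\<alpha> * p * real k)))"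
          using h by (simp add: r_def powr_powr powr_divide powr_realpow[symmetric] ac_simps)
        also have "\<dots> = (h powr (\<alpha> * p))\<^sup>2 * 2 powr (- (\<alpha> * p) * real k)"
          by (simp add: powr_minus field_simps power2_eq_square powr_add[symmetric])
        also have "\<dots> \<le> (h powr (\<alpha> * p))\<^sup>2 * 2 powr (- 4 * real k)"
          using p by (intro mult_left_mono powr_mono mult_right_mono) auto
        also have "2 powr (- 4 * real k) = ((1 / 4 :: real) ^ k)\<^sup>2"
        proof -
          have "2 powr (- 4 * real k) = (2 powr (-4)) powr real k" by (simp add: powr_powr)
          also have "\<dots> = (1 / 16) powr real k" by (simp add: powr_minus powr_numeral)
          also have "\<dots> = (1 / 16) ^ k" by (simp add: powr_realpow)
          also have "\<dots> = ((1 / 4) ^ k)\<^sup>2" by (simp add: power2_eq_square power_mult_distrib[symmetric])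
          finally show ?thesis .
        qed
        finally have "Cp * (r powr (- (real k * (2 * p))) * (h / 2 ^ k) powr (\<alpha> * (2 * p))) \<le> Cp * (h powr (\<alpha> * p) * (1 / 4) ^ k)\<^sup>2"
          using Cp by (intro mult_left_mono) (auto simp: power_mult_distrib)
        then show ?thesis by (subst ennreal_mult'[symmetric]) (auto intro!: ennreal_leI simp: ac_simps)
      qed
      also have "esqrt (ennreal (Cp * (h powr (\<alpha> * p) * (1 / 4) ^ k)\<^sup>2)) = ennreal (sqrt Cp * (h powr (\<alpha> * p) * (1 / 4) ^ k))"
        using Cp by (subst esqrt_ennreal) (auto simp: real_sqrt_mult)
      also have "ennreal (sqrt (K * exp (- m * (real n * h)))) * ennreal (sqrt Cp * (h powr (\<alpha> * p) * (1 / 4) ^ k))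
         = ennreal (sqrt K * sqrt Cp * h powr (\<alpha> * p) * exp (- (m / 2) * h) ^ n * (1 / 4) ^ k)"
      proof -
        have "exp (- m * (real n * h)) = (exp (- (m / 2) * h) ^ n)\<^sup>2"
          by (simp add: exp_of_nat_mult[symmetric] exp_double[symmetric] algebra_simps)
        then show ?thesis using K0 Cp
          by (simp add: ennreal_mult'[symmetric] real_sqrt_mult real_sqrt_abs ac_simps)
      qed
      finally show ?thesis by (iprover intro: mult_left_mono mult_right_mono esqrt_mono zero_le)
    qed
    have Q_int: "(\<integral>\<^sup>+w. Q w \<partial>M) \<le> ennreal (c * h powr (\<alpha> * p - 1))"
    proof -
      let ?A = "sqrt K * sqrt Cp * h powr (\<alpha> * p)" and ?e = "exp (- (m / 2) * h)"
      have A0: "0 \<le> ?A" using K0 Cp by simp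
      have e: "0 < ?e" "?e < 1" using m h by auto
      have "(\<integral>\<^sup>+w. Q w \<partial>M) = (\<Sum>n. \<Sum>k. \<Sum>j<2 ^ k. \<integral>\<^sup>+w. q n k j w \<partial>M)"
        unfolding Q_def by (simp add: nn_integral_suminf nn_integral_sum)
      also have "\<dots> \<le> (\<Sum>n. \<Sum>k. \<Sum>j<(2::nat) ^ k. ennreal (?A * ?e ^ n * (1 / 4) ^ k))"
        by (intro suminf_le sum_mono q_int allI) auto
      also have "\<dots> = (\<Sum>n. \<Sum>k. ennreal (?A * ?e ^ n * (1 / 2) ^ k))"
      proof (intro suminf_cong)
        fix n k
        have "(\<Sum>j<(2::nat) ^ k. ennreal (?A * ?e ^ n * (1 / 4) ^ k)) = ennreal (\<Sum>j<(2::nat) ^ k. ?A * ?e ^ n * (1 / 4) ^ k)"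
          using A0 by (intro sum_ennreal) (intro mult_nonneg_nonneg[OF mult_nonneg_nonneg[OF A0]], auto)
        also have "(\<Sum>j<(2::nat) ^ k. ?A * ?e ^ n * (1 / 4) ^ k) = ?A * ?e ^ n * (2 * (1 / 4)) ^ k"
          by (simp only: sum_constant card_lessThan power_mult_distrib of_nat_power of_nat_numeral ac_simps)
        finally show "(\<Sum>j<(2::nat) ^ k. ennreal (?A * ?e ^ n * (1 / 4) ^ k)) = ennreal (?A * ?e ^ n * (1 / 2) ^ k)" by simp
      qed
      also have "\<dots> = (\<Sum>n. ennreal (?A * ?e ^ n * 2))"
      proof (intro suminf_cong suminf_ennreal_eq)
        fix n k show "0 \<le> ?A * ?e ^ n * (1 / 2) ^ k" by (intro mult_nonneg_nonneg[OF mult_nonneg_nonneg[OF A0]]) auto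
        show "(\<lambda>k. ?A * ?e ^ n * (1 / 2) ^ k) sums (?A * ?e ^ n * 2)"
          using sums_mult[OF geometric_sums[of "1 / 2 :: real"], of "?A * ?e ^ n"] by simp
      qed
      also have "\<dots> = ennreal (?A * 2 * (1 / (1 - ?e)))"
      proof (intro suminf_ennreal_eq)
        fix n show "0 \<le> ?A * ?e ^ n * 2" by (intro mult_nonneg_nonneg[OF mult_nonneg_nonneg[OF A0]]) auto
        show "(\<lambda>n. ?A * ?e ^ n * 2) sums (?A * 2 * (1 / (1 - ?e)))"
          using sums_mult[OF geometric_sums[of ?e], of "?A * 2"] e by (simp add: ac_simps)
      qed
      also have "\<dots> \<le> ennreal (?A * 2 * (((1 + m / 2) / (m / 2)) * h powr (- 1)))"
      proof (intro ennreal_leI mult_left_mono)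
        let ?x = "m / 2 * h"
        have x: "0 < ?x" using m h by simp
        have "1 / (1 + ?x) \<ge> ?e"
          using exp_ge_add_one_self[of ?x] x by (simp add: exp_minus field_simps)
        then have "1 - ?e \<ge> ?x / (1 + ?x)" using x by (simp add: field_simps)
        then have "1 / (1 - ?e) \<le> 1 / (?x / (1 + ?x))" using x by (intro divide_left_mono) auto
        also have "\<dots> = (1 + ?x) / ?x" by simp
        also have "\<dots> \<le> (1 + m / 2) / ?x"
          using x mult_left_mono[of h 1 "m / 2"] m h by (intro divide_right_mono) auto
        also have "\<dots> = ((1 + m / 2) / (m / 2)) * h powr (- 1)" using h by (simp add: powr_minus field_simps)
        finally show "1 / (1 - ?e) \<le> ((1 + m / 2) / (m / 2)) * h powr (- 1)" .
      qed (use A0 in auto)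
      also have "?A * 2 * (((1 + m / 2) / (m / 2)) * h powr (- 1)) = c * h powr (\<alpha> * p - 1)"
        using powr_add[of h "\<alpha> * p" "- 1"] unfolding c_def by (simp only: ac_simps diff_conv_add_uminus)
      finally show ?thesis .
    qed
    have Q_AE: "AE w in M. Q w \<noteq> \<infinity>"
      using Q_int by (intro nn_integral_PInf_AE) (auto simp: top_unique)
    define B where "B w = enn2real (Q w) powr (1 / p)" for w
    have B0: "0 \<le> B w" for w by (simp add: B_def)
    have D_le: "D n k j w \<le> B w * r ^ k" if fin: "Q w \<noteq> \<infinity>" and w: "w \<in> space M" "real n * h \<le> \<tau> w" and j: "j < 2 ^ k" for n k j w
    proof -
      have D0: "0 \<le> D n k j w / r ^ k" using r by (simp add: D_def)
      have "ennreal ((D n k j w / r ^ k) powr p) = q n k j w" using w by (simp add: q_def)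
      also have "\<dots> \<le> (\<Sum>j<2 ^ k. q n k j w)" using j by (intro member_le_sum) auto
      also have "\<dots> \<le> (\<Sum>k. \<Sum>j<2 ^ k. q n k j w)" 
        using sum_le_suminf[of "\<lambda>k. \<Sum>j<2 ^ k. q n k j w" "{k}"] by simp
      also have "\<dots> \<le> Q w" unfolding Q_def
        using sum_le_suminf[of "\<lambda>n. \<Sum>k. \<Sum>j<2 ^ k. q n k j w" "{n}"] by simp
      finally have "(D n k j w / r ^ k) powr p \<le> enn2real (Q w)"
        using fin by (cases "Q w") auto
      then have "((D n k j w / r ^ k) powr p) powr (1 / p) \<le> B w"
        unfolding B_def using p by (intro powr_mono2) auto
      moreover have "(x powr p) powr (1 / p) = x" if "0 \<le> x" for x :: real
        using p that by (simp add: powr_powr)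
      ultimately have "D n k j w / r ^ k \<le> B w" using D0 by metis
      then show ?thesis using r by (simp add: field_simps)
    qed
    define S where "S w = B w / (1 - r)" for w
    have S_meas: "S \<in> borel_measurable M" unfolding S_def[abs_def] B_def by measurable
    moreover have S0: "\<forall>w. 0 \<le> S w" using B0 r by (simp add: S_def)
    moreover have "AE w in M. \<forall>n::nat. \<forall>t\<in>{real n * h..real n * h + h}. \<bar>Y t w - Y (real n * h) w\<bar> \<le> S w"
      using Q_AE cont const AE_space
    proof eventually_elim
      case (elim w)
      show ?case
      proof (intro allI ballI)
        fix n :: nat and t assume t: "t \<in> {real n * h..real n * h + h}"
        show "\<bar>Y t w - Y (real n * h) w\<bar> \<le> S w"
        proof (cases "real n * h \<le> \<tau> w")
          case True
          have "0 \<le> real n * h" using h by simp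
          then have "continuous_on {real n * h..real n * h + h} (\<lambda>t. Y t w)"
            by (intro continuous_on_subset[OF elim(2)]) (meson atLeastAtMost_iff atLeast_iff order_trans subsetI)
          then show ?thesis unfolding S_def
            using D_le[OF elim(1) elim(4) True] h r B0[of w] t
            by (intro dyadic_chaining[where g = "\<lambda>t. Y t w" and h = h]) (auto simp: D_def)
        next
          case False
          then show ?thesis using elim(3) t S0 by auto
        qed
      qed
    qed
    moreover have "(\<integral>\<^sup>+w. ennreal (S w ^ 4) \<partial>M) \<le> ennreal ((1 + c) / (1 - r) ^ 4 * h powr (4 * (\<alpha> - \<epsilon>)))"
    proof -
      define l where "l = h powr (\<alpha> - 1 / p)" \<comment> \<open>the level that balances \<open>x\<^sup>4 \<le> l\<^sup>4 + l\<^bsup>4-p\<^esup> x\<^sup>p\<close>\<close>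
      have l: "0 < l" using h by (simp add: l_def)
      have B4: "B w ^ 4 \<le> l ^ 4 + l powr (4 - p) * enn2real (Q w)" for w
      proof (cases "B w \<le> l")
        case True
        then have "B w ^ 4 \<le> l ^ 4" using B0 by (intro power_mono)
        then show ?thesis by (simp add: add_increasing2)
      next
        case False
        then have "B w > 0" using l by simp
        then have "B w ^ 4 = B w powr (4 - p) * B w powr p" 
          using powr_add[of "B w" "4 - p" p] by simp
        also have "B w powr p = enn2real (Q w)" using p by (simp add: B_def powr_powr)
        also have "B w powr (4 - p) \<le> l powr (4 - p)"
          using False l p by (intro powr_mono2') simp_all
        finally show ?thesis by (simp add: mult_right_mono add_increasing)
      qed
      have "(\<integral>\<^sup>+w. ennreal (B w ^ 4) \<partial>M) \<le> (\<integral>\<^sup>+w. ennreal (l ^ 4) + ennreal (l powr (4 - p)) * Q w \<partial>M)"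
      proof (rule nn_integral_mono_AE, use Q_AE in eventually_elim)
        case (elim w)
        have "ennreal (B w ^ 4) \<le> ennreal (l ^ 4 + l powr (4 - p) * enn2real (Q w))" by (intro ennreal_leI B4)
        also have "\<dots> = ennreal (l ^ 4) + ennreal (l powr (4 - p)) * Q w"
          using elim l by (simp add: ennreal_plus ennreal_mult less_top)
        finally show ?case .
      qed
      also have "\<dots> = ennreal (l ^ 4) + ennreal (l powr (4 - p)) * (\<integral>\<^sup>+w. Q w \<partial>M)"
        by (simp add: nn_integral_add nn_integral_cmult emeasure_space_1)
      also have "\<dots> \<le> ennreal (l ^ 4) + ennreal (l powr (4 - p)) * ennreal (c * h powr (\<alpha> * p - 1))"
        by (intro add_left_mono mult_left_mono Q_int) auto
      also have "\<dots> = ennreal (l ^ 4 + l powr (4 - p) * (c * h powr (\<alpha> * p - 1)))"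
        using c0 l by (simp add: ennreal_plus ennreal_mult)
      also have "l powr (4 - p) * (c * h powr (\<alpha> * p - 1)) = c * l ^ 4"
      proof -
        have "l powr (4 - p) = l ^ 4 * l powr (- p)"
          using l powr_add[of l 4 "- p"] by simp
        moreover have "l powr (- p) * h powr (\<alpha> * p - 1) = 1"
        proof -
          have "l powr (- p) = h powr ((\<alpha> - 1 / p) * - p)" by (simp only: l_def powr_powr)
          also have "(\<alpha> - 1 / p) * - p = - (\<alpha> * p - 1)" using p by (simp add: algebra_simps)
          finally show ?thesis using powr_add[of h "- (\<alpha> * p - 1)" "\<alpha> * p - 1"] h by simp
        qed
        ultimately show ?thesis by (simp add: ac_simps)
      qed
      also have "l ^ 4 + c * l ^ 4 = (1 + c) * l ^ 4" by (simp add: algebra_simps)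
      also have "l ^ 4 = h powr (4 * (\<alpha> - 1 / p))"
        using powr_powr[of h "\<alpha> - 1 / p" 4] l by (simp add: l_def mult.commute)
      also have "(1 + c) * h powr (4 * (\<alpha> - 1 / p)) \<le> (1 + c) * h powr (4 * (\<alpha> - \<epsilon>))"
        using h p c0 by (intro mult_left_mono powr_mono') auto
      finally have *: "(\<integral>\<^sup>+w. ennreal (B w ^ 4) \<partial>M) \<le> ennreal ((1 + c) * h powr (4 * (\<alpha> - \<epsilon>)))"
        by (iprover intro: ennreal_leI)
      have "(\<integral>\<^sup>+w. ennreal (S w ^ 4) \<partial>M) = (\<integral>\<^sup>+w. ennreal (1 / (1 - r) ^ 4) * ennreal (B w ^ 4) \<partial>M)"
        using r by (intro nn_integral_cong) (simp add: S_def power_divide ennreal_mult'[symmetric])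
      also have "\<dots> = ennreal (1 / (1 - r) ^ 4) * (\<integral>\<^sup>+w. ennreal (B w ^ 4) \<partial>M)"
        unfolding B_def by (rule nn_integral_cmult) measurable
      also have "\<dots> \<le> ennreal (1 / (1 - r) ^ 4) * ennreal ((1 + c) * h powr (4 * (\<alpha> - \<epsilon>)))"
        by (intro mult_left_mono *) auto
      also have "\<dots> = ennreal ((1 + c) / (1 - r) ^ 4 * h powr (4 * (\<alpha> - \<epsilon>)))"
        using r by (subst ennreal_mult'[symmetric]) auto
      finally show ?thesis .
    qed
    ultimately show "\<exists>S\<in>borel_measurable M. (\<forall>w. 0 \<le> S w) \<and>
     (AE w in M. \<forall>n::nat. \<forall>t\<in>{real n * h..real n * h + h}. \<bar>Y t w - Y (real n * h) w\<bar> \<le> S w) \<and>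
     (\<integral>\<^sup>+w. ennreal (S w ^ 4) \<partial>M) \<le> ennreal ((1 + c) / (1 - r) ^ 4 * h powr (4 * (\<alpha> - \<epsilon>)))"
      by blast
  qed
qed

section \<open>Discrete Gronwall recursion\<close>

lemma weighted_gronwall_doob:
  fixes D e b :: "nat \<Rightarrow> 'a \<Rightarrow> real"
  assumes sub: "\<And>n. subalgebra M (F n)" and mono: "\<And>m n. m \<le> n \<Longrightarrow> sets (F m) \<subseteq> sets (F n)"
    and D: "\<And>n. D n \<in> borel_measurable (F n)" and D2: "\<And>n. integrable M (\<lambda>w. (D n w)\<^sup>2)"
    and e: "\<And>n. e n \<in> borel_measurable M"
    and b: "\<And>n. b n \<in> borel_measurable (F n)" "\<And>n w. 0 < b n w" "\<And>n w. b n w \<le> 1"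
    and step: "\<And>n \<phi>. \<phi> \<in> borel_measurable (F n) \<Longrightarrow>
      (\<integral>\<^sup>+w. \<phi> w * ennreal (b n w * \<bar>D n w\<bar>) \<partial>M) \<le> (\<integral>\<^sup>+w. \<phi> w * (ennreal \<bar>D (Suc n) w\<bar> + ennreal \<bar>e n w\<bar>) \<partial>M)"
  shows "(\<integral>\<^sup>+w. (SUP n\<in>{..N}. ennreal \<bar>D n w\<bar>)\<^sup>2 \<partial>M)
    \<le> 4 * (\<integral>\<^sup>+w. (ennreal ((\<Prod>k<N. 1 / b k w) * \<bar>D N w\<bar>) + (\<Sum>n<N. ennreal ((\<Prod>k<Suc n. 1 / b k w) * \<bar>e n w\<bar>)))\<^sup>2 \<partial>M)"
proof -
  define p where "p n w = (\<Prod>k<n. 1 / b k w)" for n w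
  have p_Suc: "p (Suc n) w = p n w / b n w" for n w by (simp add: p_def)
  have p1: "1 \<le> p n w" for n w unfolding p_def
    using b(2,3) by (intro prod_ge_1) (simp add: le_divide_eq)
  have spF: "space (F n) = space M" for n using sub[of n] by (simp add: subalgebra_def)
  have subm: "g \<in> borel_measurable (F m) \<Longrightarrow> m \<le> n \<Longrightarrow> g \<in> borel_measurable (F n)"
    for g :: "'a \<Rightarrow> 'c::topological_space" and m n
    using mono[of m n] by (auto simp: measurable_def spF)
  have pF: "p (Suc n) \<in> borel_measurable (F n)" for n
    unfolding p_def[abs_def] using subm[OF b(1), of _ n]
    by (intro borel_measurable_prod borel_measurable_divide) auto
  have DM[measurable]: "D n \<in> borel_measurable M" for n using D measurable_from_subalg[OF sub] by blast
  have bM[measurable]: "b n \<in> borel_measurable M" for n using b(1) measurable_from_subalg[OF sub] by blast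
  have pM[measurable]: "p n \<in> borel_measurable M" for n unfolding p_def[abs_def] by measurable
  note e[measurable]
  define X where "X n m w = ennreal (p m w * \<bar>D m w\<bar>) + (\<Sum>i\<in>{n..<m}. ennreal (p (Suc i) w * \<bar>e i w\<bar>))" for n m w
  have X_meas[measurable]: "X n m \<in> borel_measurable M" for n m unfolding X_def[abs_def] by measurable
  have iter: "(\<integral>\<^sup>+w. \<phi> w * ennreal (p n w * \<bar>D n w\<bar>) \<partial>M) \<le> (\<integral>\<^sup>+w. \<phi> w * X n m w \<partial>M)"
    if "n \<le> m" "\<phi> \<in> borel_measurable (F n)" for n m \<phi>
    using that
  proof (induction arbitrary: \<phi> rule: inc_induct)
    case base
    then show ?case by (simp add: X_def)
  next
    case (step n)
    have [measurable]: "\<phi> \<in> borel_measurable M" using step.prems by (rule measurable_from_subalg[OF sub])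
    have p0: "0 \<le> p n w" for n w using p1[of n w] by simp
    have "(\<integral>\<^sup>+w. \<phi> w * ennreal (p n w * \<bar>D n w\<bar>) \<partial>M)
        = (\<integral>\<^sup>+w. (\<phi> w * ennreal (p (Suc n) w)) * ennreal (b n w * \<bar>D n w\<bar>) \<partial>M)"
    proof (intro nn_integral_cong)
      fix w
      have "p n w = p (Suc n) w * b n w" using b(2)[of n w] by (simp add: p_Suc)
      then show "\<phi> w * ennreal (p n w * \<bar>D n w\<bar>) = (\<phi> w * ennreal (p (Suc n) w)) * ennreal (b n w * \<bar>D n w\<bar>)"
        using p0[of "Suc n" w] by (simp add: ennreal_mult' mult.assoc)
    qed
    also have "\<dots> \<le> (\<integral>\<^sup>+w. (\<phi> w * ennreal (p (Suc n) w)) * (ennreal \<bar>D (Suc n) w\<bar> + ennreal \<bar>e n w\<bar>) \<partial>M)"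
      using step.prems pF[of n] by (intro assms(9)) auto
    also have "\<dots> = (\<integral>\<^sup>+w. \<phi> w * ennreal (p (Suc n) w * \<bar>D (Suc n) w\<bar>) + \<phi> w * ennreal (p (Suc n) w * \<bar>e n w\<bar>) \<partial>M)"
      using p0 by (intro nn_integral_cong) (simp add: ennreal_mult' distrib_left mult.assoc)
    also have "\<dots> = (\<integral>\<^sup>+w. \<phi> w * ennreal (p (Suc n) w * \<bar>D (Suc n) w\<bar>) \<partial>M) + (\<integral>\<^sup>+w. \<phi> w * ennreal (p (Suc n) w * \<bar>e n w\<bar>) \<partial>M)"
      by (rule nn_integral_add) measurable
    also have "\<dots> \<le> (\<integral>\<^sup>+w. \<phi> w * X (Suc n) m w \<partial>M) + (\<integral>\<^sup>+w. \<phi> w * ennreal (p (Suc n) w * \<bar>e n w\<bar>) \<partial>M)"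
      by (intro add_right_mono step.IH subm[OF step.prems]) simp
    also have "\<dots> = (\<integral>\<^sup>+w. \<phi> w * X (Suc n) m w + \<phi> w * ennreal (p (Suc n) w * \<bar>e n w\<bar>) \<partial>M)"
      by (rule nn_integral_add[symmetric]) measurable
    also have "\<dots> = (\<integral>\<^sup>+w. \<phi> w * X n m w \<partial>M)"
    proof (intro nn_integral_cong)
      fix w
      have "{n..<m} = insert n {Suc n..<m}" using step.hyps by auto
      then have "X n m w = X (Suc n) m w + ennreal (p (Suc n) w * \<bar>e n w\<bar>)"
        by (simp add: X_def ac_simps)
      then show "\<phi> w * X (Suc n) m w + \<phi> w * ennreal (p (Suc n) w * \<bar>e n w\<bar>) = \<phi> w * X n m w"
        by (simp add: distrib_left)
    qed
    finally show ?case .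
  qed
  have "(\<integral>\<^sup>+w. (SUP n\<in>{..N}. ennreal \<bar>D n w\<bar>)\<^sup>2 \<partial>M) \<le> 4 * (\<integral>\<^sup>+w. (X 0 N w)\<^sup>2 \<partial>M)"
  proof (rule doob_L2[OF sub mono D D2 X_meas])
    fix n :: nat and \<phi> :: "'a \<Rightarrow> ennreal" assume n: "n \<le> N" and \<phi>: "\<phi> \<in> borel_measurable (F n)"
    have "(\<integral>\<^sup>+w. \<phi> w * ennreal \<bar>D n w\<bar> \<partial>M) \<le> (\<integral>\<^sup>+w. \<phi> w * ennreal (p n w * \<bar>D n w\<bar>) \<partial>M)"
      using mult_right_mono[OF p1, of "\<bar>D n _\<bar>"] by (intro nn_integral_mono mult_left_mono ennreal_leI) auto
    also have "\<dots> \<le> (\<integral>\<^sup>+w. \<phi> w * X n N w \<partial>M)" by (rule iter[OF n \<phi>])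
    \<comment> \<open>Doob's inequality needs one majorant for all n, so the sum is extended down to
      index 0.\<close>
    also have "\<dots> \<le> (\<integral>\<^sup>+w. \<phi> w * X 0 N w \<partial>M)"
      unfolding X_def by (intro nn_integral_mono mult_left_mono add_left_mono sum_mono2) auto
    finally show "(\<integral>\<^sup>+w. \<phi> w * ennreal \<bar>D n w\<bar> \<partial>M) \<le> (\<integral>\<^sup>+w. \<phi> w * X 0 N w \<partial>M)" .
  qed
  then show ?thesis by (simp only: X_def p_def atLeast0LessThan)
qed

context brownian_space
begin

section \<open>Stopped sigma-algebras and one step of the scheme\<close>

lemma stopping_time_measurable:
  assumes "is_stopping_time M \<F> \<tau>"
  shows "\<tau> \<in> borel_measurable M"
proof (rule borel_measurableI_le)
  fix r :: real
  have "{w \<in> space M. \<tau> w \<le> r} \<in> sets M"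
  proof (cases "0 \<le> r")
    case True
    then show ?thesis using assms by (intro sets_bm_filtrationD[of _ r]) (simp add: is_stopping_time_def)
  next
    case False
    have "\<tau> w > r" if "w \<in> space M" for w
      using assms that False by (fastforce simp: is_stopping_time_def)
    then have "{w \<in> space M. \<tau> w \<le> r} = {}" by force
    then show ?thesis by (simp only: sets.empty_sets)
  qed
  then show "{w \<in> space M. \<tau> w \<le> r} \<in> sets M" .
qed

text \<open>\<open>stopped_sigma\<close> is given by generators, so their trace property is carried
  to all its events by induction. A complement is taken within the event that the stopping time has
  occurred by t.\<close>

lemma
  shows space_stopped_sigma: "space (stopped_sigma M \<F> (bm_filtration_inf M d W) \<tau>) = space M"
    and stopped_sigma_subset: "sets (stopped_sigma M \<F> (bm_filtration_inf M d W) \<tau>) \<subseteq> sets M"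
    and stopped_sigma_Int: "is_stopping_time M \<F> \<tau> \<Longrightarrow> A \<in> sets (stopped_sigma M \<F> (bm_filtration_inf M d W) \<tau>)
      \<Longrightarrow> 0 \<le> t \<Longrightarrow> A \<inter> {w \<in> space M. \<tau> w \<le> t} \<in> sets (\<F> t)"
proof -
  let ?G = "{A \<in> sets (bm_filtration_inf M d W). \<forall>t\<ge>0. A \<inter> {w\<in>space M. \<tau> w \<le> t} \<in> sets (\<F> t)}"
  have G: "?G \<subseteq> sets M" using sets_bm_filtration_inf by auto
  then have GP: "?G \<subseteq> Pow (space M)" using sets.sets_into_space by blast
  have sets_eq: "sets (stopped_sigma M \<F> (bm_filtration_inf M d W) \<tau>) = sigma_sets (space M) ?G"
    unfolding stopped_sigma_def by (rule sets_measure_of[OF GP])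
  show "space (stopped_sigma M \<F> (bm_filtration_inf M d W) \<tau>) = space M"
    unfolding stopped_sigma_def by (rule space_measure_of[OF GP])
  show "sets (stopped_sigma M \<F> (bm_filtration_inf M d W) \<tau>) \<subseteq> sets M"
    unfolding sets_eq by (rule sets.sigma_sets_subset[OF G])
  assume st: "is_stopping_time M \<F> \<tau>" and A: "A \<in> sets (stopped_sigma M \<F> (bm_filtration_inf M d W) \<tau>)" and t: "0 \<le> t"
  have L: "{w \<in> space M. \<tau> w \<le> t} \<in> sets (\<F> t)" using st t by (auto simp: is_stopping_time_def)
  from A show "A \<inter> {w \<in> space M. \<tau> w \<le> t} \<in> sets (\<F> t)"
    unfolding sets_eq
  proof induction
    case (Compl a)
    have "(space M - a) \<inter> {w \<in> space M. \<tau> w \<le> t} = {w \<in> space M. \<tau> w \<le> t} - a \<inter> {w \<in> space M. \<tau> w \<le> t}" by auto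
    then show ?case using L Compl by (simp add: sets.Diff)
  next
    case (Union a)
    have "(\<Union> (range a)) \<inter> {w \<in> space M. \<tau> w \<le> t} = (\<Union>i. a i \<inter> {w \<in> space M. \<tau> w \<le> t})" by auto
    moreover have "(\<Union>i. a i \<inter> {w \<in> space M. \<tau> w \<le> t}) \<in> sets (\<F> t)"
      using Union.IH by (intro sets.countable_UN) auto
    ultimately show ?case by (simp only:)
  qed (use t in auto)
qed

text \<open>Needed for the adaptedness of \<open>scheme_value\<close>, which switches to the
  terminal value at the stopping time: an event of the stopped sigma-algebra, cut with the event of
  having stopped by t, is known at t.\<close>

lemma stopped_sigma_measurable_if:
  assumes st: "is_stopping_time M \<F> \<tau>" and \<eta>: "\<eta> \<in> borel_measurable (stopped_sigma M \<F> (bm_filtration_inf M d W) \<tau>)"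
    and t: "0 \<le> t" and R: "R \<in> borel_measurable (\<F> t)"
  shows "(\<lambda>w. if \<tau> w \<le> t then \<eta> w else R w :: real) \<in> borel_measurable (\<F> t)"
proof (rule measurableI)
  fix B :: "real set" assume B: "B \<in> sets borel"
  let ?L = "{w \<in> space M. \<tau> w \<le> t}"
  have L: "?L \<in> sets (\<F> t)" using st t by (auto simp: is_stopping_time_def)
  have "(\<lambda>w. if \<tau> w \<le> t then \<eta> w else R w) -` B \<inter> space (\<F> t) =
     ((\<eta> -` B \<inter> space (stopped_sigma M \<F> (bm_filtration_inf M d W) \<tau>)) \<inter> ?L) \<union> ((R -` B \<inter> space (\<F> t)) - ?L)"
    by (auto simp: space_stopped_sigma split: if_splits)
  also have "\<dots> \<in> sets (\<F> t)"
    using measurable_sets[OF \<eta> B] measurable_sets[OF R B] L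
    by (intro sets.Un sets.Diff stopped_sigma_Int[OF st _ t])
  finally show "(\<lambda>w. if \<tau> w \<le> t then \<eta> w else R w) -` B \<inter> space (\<F> t) \<in> sets (\<F> t)" .
qed simp

text \<open>The conditional expectation of \<open>D (Suc n) + e\<close> at time n is
  \<open>D n\<close> minus the difference of the two driver terms: Y enters through the definition
  of \<open>e\<close>, \<open>\<Delta>\<close> has conditional mean 0, and the scheme enters through
  its own recursion. By the Lipschitz bound the modulus of the result is at least (1 - L_f h
  1[nh < \<tau>h]) |D_n|, and conditional Jensen concludes.\<close>

lemma scheme_error_one_step:
  assumes h: "0 < h" and Lf: "0 < Lf"
    and st: "is_stopping_time M \<F> \<tau>h" and grid: "\<forall>w\<in>space M. \<exists>n::nat. \<tau>h w = real n * h"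
    and \<xi>b: "\<xi>b \<in> borel_measurable (stopped_sigma M \<F> (bm_filtration_inf M d W) \<tau>h)"
    and \<xi>b2: "integrable M (\<lambda>w. (\<xi>b w)\<^sup>2)"
    and lip: "\<And>n w x y. \<bar>fh n w x - fh n w y\<bar> \<le> Lf * \<bar>x - y\<bar>"
    and fhm: "\<And>n A. A \<in> borel_measurable (\<F> (real n * h)) \<Longrightarrow> (\<lambda>w. fh n w (A w)) \<in> borel_measurable (\<F> (real n * h))"
    and fp: "scheme_fixed_point M \<F> Lf h \<tau>h \<xi>b fh R"
    and Y: "\<And>t. 0 \<le> t \<Longrightarrow> Y t \<in> borel_measurable (\<F> t)" "\<And>t. 0 \<le> t \<Longrightarrow> integrable M (\<lambda>w. (Y t w)\<^sup>2)"
    and \<Delta>: "integrable M \<Delta>" "\<And>B. B \<in> sets (\<F> (real n * h)) \<Longrightarrow> (\<integral>w. indicator B w * \<Delta> w \<partial>M) = 0"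
  defines "D \<equiv> \<lambda>n w. Y (real n * h) w - scheme_value h \<tau>h \<xi>b R n w"
    and "e \<equiv> \<lambda>w. Y (real n * h) w - Y (real (Suc n) * h) w + \<Delta> w
       - indicator {w \<in> space M. real n * h < \<tau>h w} w * (h * fh n w (Y (real n * h) w))"
  shows "D n \<in> borel_measurable (\<F> (real n * h))" (is ?A)
    and "integrable M (\<lambda>w. (D n w)\<^sup>2)" (is ?B)
    and "e \<in> borel_measurable M" (is ?C)
    and "\<phi> \<in> borel_measurable (\<F> (real n * h)) \<Longrightarrow>
      (\<integral>\<^sup>+w. \<phi> w * ennreal ((1 - Lf * h * indicator {w \<in> space M. real n * h < \<tau>h w} w) * \<bar>D n w\<bar>) \<partial>M)
      \<le> (\<integral>\<^sup>+w. \<phi> w * (ennreal \<bar>D (Suc n) w\<bar> + ennreal \<bar>e w\<bar>) \<partial>M)" (is "_ \<Longrightarrow> ?E \<phi>")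
proof -
  have nh: "0 \<le> real n * h" for n :: nat using h by simp
  have R: "R n \<in> borel_measurable (\<F> (real n * h))" "integrable M (\<lambda>w. (R n w)\<^sup>2)" for n
    using fp by (auto simp: scheme_fixed_point_def)
  have RAE: "AE w in M. R n w = indicator {w. real n * h < \<tau>h w} w * real_cond_exp M (\<F> (real n * h)) (R (Suc n)) w
        + indicator {w. real n * h < \<tau>h w} w * h * fh n w (R n w)
        + indicator {w. real n * h = \<tau>h w} w * \<xi>b w" for n
    using fp by (auto simp: scheme_fixed_point_def)
  let ?y = "scheme_value h \<tau>h \<xi>b R"
  have y_meas: "?y n \<in> borel_measurable (\<F> (real n * h))" for n
    using stopped_sigma_measurable_if[OF st \<xi>b nh R(1)] by (simp add: scheme_value_def[abs_def])
  have yM[measurable]: "?y n \<in> borel_measurable M" for n using y_meas by (rule measurable_bm_filtrationD)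
  have RM[measurable]: "R n \<in> borel_measurable M" for n using R(1) by (rule measurable_bm_filtrationD)
  have \<xi>bM[measurable]: "\<xi>b \<in> borel_measurable M"
    using \<xi>b stopped_sigma_subset by (auto simp: measurable_def space_stopped_sigma)
  have y2: "integrable M (\<lambda>w. (?y n w)\<^sup>2)" for n
  proof (rule Bochner_Integration.integrable_bound)
    show "integrable M (\<lambda>w. (\<xi>b w)\<^sup>2 + (R n w)\<^sup>2)" using \<xi>b2 R(2) by simp
    show "AE w in M. norm ((?y n w)\<^sup>2) \<le> norm ((\<xi>b w)\<^sup>2 + (R n w)\<^sup>2)"
      by (intro AE_I2) (auto simp: scheme_value_def)
  qed simp
  have YM[measurable]: "Y (real n * h) \<in> borel_measurable M" for n using Y(1)[OF nh] by (rule measurable_bm_filtrationD)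
  have D_meas: "D n \<in> borel_measurable (\<F> (real n * h))" for n
    unfolding D_def using Y(1)[OF nh] y_meas by (rule borel_measurable_diff)
  then show ?A .
  have D2: "integrable M (\<lambda>w. (D n w)\<^sup>2)" for n
    unfolding D_def using Y(2)[OF nh] y2 by (intro square_integrable_diff YM yM)
  then show ?B .
  have DM: "D n \<in> borel_measurable M" for n using D_meas by (rule measurable_bm_filtrationD)
  have Di: "integrable M (D n)" for n by (rule square_integrable_imp_integrable[OF DM D2])
  have yi: "integrable M (?y n)" for n by (rule square_integrable_imp_integrable[OF yM y2])
  have Ri: "integrable M (R n)" for n by (rule square_integrable_imp_integrable[OF RM R(2)])
  have Yi: "integrable M (Y (real n * h))" for n by (rule square_integrable_imp_integrable[OF YM Y(2)[OF nh]])
  let ?L = "{w \<in> space M. real n * h < \<tau>h w}"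
  have L: "?L \<in> sets (\<F> (real n * h))" by (rule stopping_time_less_sets[OF st nh])
  have LM[measurable]: "?L \<in> sets M" using L by (rule sets_bm_filtrationD)
  let ?fy = "\<lambda>w. indicator ?L w * (h * fh n w (?y n w))"
  let ?fY = "\<lambda>w. indicator ?L w * (h * fh n w (Y (real n * h) w))"
  have fy_meas: "?fy \<in> borel_measurable (\<F> (real n * h))"
    using L fhm[OF y_meas] by measurable
  have fY_meas: "?fY \<in> borel_measurable (\<F> (real n * h))"
    using L fhm[OF Y(1)[OF nh]] by measurable
  have fyM[measurable]: "?fy \<in> borel_measurable M" and fYM[measurable]: "?fY \<in> borel_measurable M"
    using fy_meas fY_meas by (auto intro: measurable_bm_filtrationD)
  interpret S: sigma_finite_subalgebra M "\<F> (real n * h)" by (rule sigma_finite_subalgebra_bm_filtration)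
  have cint: "integrable M (real_cond_exp M (\<F> (real n * h)) (R (Suc n)))"
    using S.real_cond_exp_int(1)[OF Ri] .
  \<comment> \<open>Integrability of the driver term comes from the fixed point equation, which
    expresses it by R and a conditional expectation. The Lipschitz bound then transfers it from the
    scheme to Y.\<close>
  have fy_AE: "AE w in M. ?fy w = indicator ?L w * (R n w - real_cond_exp M (\<F> (real n * h)) (R (Suc n)) w)"
    using RAE[of n] AE_space by eventually_elim (auto simp: indicator_def scheme_value_def)
  have fyi: "integrable M ?fy"
    by (subst integrable_cong_AE[OF fyM _ fy_AE])
      (use cint Ri LM in \<open>auto intro!: integrable_real_mult_indicator[of ?L, unfolded mult.commute[of _ "indicator ?L _"]]\<close>)
  have fdiff: "\<bar>?fY w - ?fy w\<bar> \<le> Lf * h * indicator ?L w * \<bar>D n w\<bar>" for w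
    using mult_left_mono[OF lip[of n w "Y (real n * h) w" "?y n w"], of h] h
    by (auto simp: indicator_def D_def right_diff_distrib[symmetric] abs_mult ac_simps)
  have fYi: "integrable M ?fY"
  proof -
    have "integrable M (\<lambda>w. ?fY w - ?fy w)"
    proof (rule Bochner_Integration.integrable_bound)
      show "integrable M (\<lambda>w. Lf * h * \<bar>D n w\<bar>)" using Di by simp
      show "AE w in M. norm (?fY w - ?fy w) \<le> norm (Lf * h * \<bar>D n w\<bar>)"
      proof (intro AE_I2)
        fix w
        have "\<bar>?fY w - ?fy w\<bar> \<le> Lf * h * indicator ?L w * \<bar>D n w\<bar>" by (rule fdiff)
        also have "\<dots> \<le> Lf * h * \<bar>D n w\<bar>" using Lf h by (auto simp: indicator_def)
        finally show "norm (?fY w - ?fy w) \<le> norm (Lf * h * \<bar>D n w\<bar>)" using Lf h by simp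
      qed
    qed measurable
    from Bochner_Integration.integrable_add[OF this fyi] show ?thesis by simp
  qed
  have ei: "integrable M e" unfolding e_def using Yi[of n] Yi[of "Suc n"] \<Delta>(1) fYi by simp
  then show ?C by simp
  define U where "U w = D n w - (?fY w - ?fy w)" for w
  have U_meas: "U \<in> borel_measurable (\<F> (real n * h))"
    unfolding U_def[abs_def] using D_meas fY_meas fy_meas by (intro borel_measurable_diff)
  have Ui: "integrable M U" unfolding U_def[abs_def] using Di fYi fyi by simp
  have eq: "(\<integral>w\<in>B. (D (Suc n) w + e w) \<partial>M) = (\<integral>w\<in>B. U w \<partial>M)" if B: "B \<in> sets (\<F> (real n * h))" for B
  proof -
    have BM: "B \<in> sets M" using B by (rule sets_bm_filtrationD)
    have ind: "integrable M (\<lambda>w. indicator A w * g w)" if "integrable M g" "A \<in> sets M" for g :: "'a \<Rightarrow> real" and A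
      using integrable_real_mult_indicator[OF that(2,1)] by (simp add: mult.commute)
    have y: "(\<integral>w. indicator B w * ?y (Suc n) w \<partial>M) = (\<integral>w. indicator B w * (?y n w - ?fy w) \<partial>M)"
    proof -
      have BL: "B \<inter> ?L \<in> sets (\<F> (real n * h))" using B L by (rule sets.Int)
      have BLM: "B \<inter> ?L \<in> sets M" "B - ?L \<in> sets M" using BM LM by auto
      have "(\<integral>w. indicator B w * ?y (Suc n) w \<partial>M) = (\<integral>w. indicator (B \<inter> ?L) w * R (Suc n) w + indicator (B - ?L) w * ?y n w \<partial>M)"
      proof (rule integral_cong_AE)
        show "AE w in M. indicator B w * ?y (Suc n) w = indicator (B \<inter> ?L) w * R (Suc n) w + indicator (B - ?L) w * ?y n w"
          using RAE[of "Suc n"] AE_space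
        proof eventually_elim
          case (elim w)
          obtain m where m: "\<tau>h w = real m * h" using grid elim(2) by blast
          show ?case
          proof (cases "real n * h < \<tau>h w")
            case True
            \<comment> \<open>Being grid-valued, \<open>\<tau>h\<close> cannot lie strictly between
              two grid times. If it equals the next one, the fixed point equation makes
              \<open>R (Suc n)\<close> the terminal value, so both branches of
              \<open>scheme_value\<close> agree there.\<close>
            then have "Suc n \<le> m" using h by (simp add: m)
            then have "real (Suc n) * h \<le> \<tau>h w" unfolding m using h by (intro mult_right_mono) auto
            then have "?y (Suc n) w = R (Suc n) w" using elim(1) by (auto simp: scheme_value_def)
            then show ?thesis using True elim(2) by (auto simp: indicator_def)
          next
            case False
            then have "\<tau>h w \<le> real n * h" "\<tau>h w \<le> real (Suc n) * h" using h by (auto simp: algebra_simps)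
            then show ?thesis using elim(2) by (auto simp: scheme_value_def indicator_def)
          qed
        qed
      qed (use BM BLM in measurable)
      also have "\<dots> = (\<integral>w. indicator (B \<inter> ?L) w * R (Suc n) w \<partial>M) + (\<integral>w. indicator (B - ?L) w * ?y n w \<partial>M)"
        by (intro Bochner_Integration.integral_add ind Ri yi BLM)
      also have "(\<integral>w. indicator (B \<inter> ?L) w * R (Suc n) w \<partial>M) = (\<integral>w. indicator (B \<inter> ?L) w * real_cond_exp M (\<F> (real n * h)) (R (Suc n)) w \<partial>M)"
        using S.real_cond_exp_intA[OF Ri BL] by (simp add: set_lebesgue_integral_def)
      also have "\<dots> + (\<integral>w. indicator (B - ?L) w * ?y n w \<partial>M)
         = (\<integral>w. indicator (B \<inter> ?L) w * real_cond_exp M (\<F> (real n * h)) (R (Suc n)) w + indicator (B - ?L) w * ?y n w \<partial>M)"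
        by (intro Bochner_Integration.integral_add[symmetric] ind cint yi BLM)
      also have "\<dots> = (\<integral>w. indicator B w * (?y n w - ?fy w) \<partial>M)"
      proof (rule integral_cong_AE)
        show "AE w in M. indicator (B \<inter> ?L) w * real_cond_exp M (\<F> (real n * h)) (R (Suc n)) w + indicator (B - ?L) w * ?y n w
            = indicator B w * (?y n w - ?fy w)"
          using fy_AE AE_space by eventually_elim (auto simp: indicator_def scheme_value_def)
      qed (use BM BLM cint in measurable)
      finally show ?thesis .
    qed
    have "(\<integral>w\<in>B. (D (Suc n) w + e w) \<partial>M) = (\<integral>w. indicator B w * Y (real n * h) w + indicator B w * \<Delta> w
       - indicator B w * ?fY w - indicator B w * ?y (Suc n) w \<partial>M)"
      unfolding set_lebesgue_integral_def D_def e_def by (intro Bochner_Integration.integral_cong) (auto simp: algebra_simps)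
    also have "\<dots> = (\<integral>w. indicator B w * Y (real n * h) w \<partial>M) + (\<integral>w. indicator B w * \<Delta> w \<partial>M)
       - (\<integral>w. indicator B w * ?fY w \<partial>M) - (\<integral>w. indicator B w * ?y (Suc n) w \<partial>M)"
      using ind[OF Yi BM] ind[OF \<Delta>(1) BM] ind[OF fYi BM] ind[OF yi BM] by simp
    also have "\<dots> = (\<integral>w. indicator B w * Y (real n * h) w \<partial>M)
       - (\<integral>w. indicator B w * ?fY w \<partial>M) - (\<integral>w. indicator B w * (?y n w - ?fy w) \<partial>M)"
      by (simp only: y \<Delta>(2)[OF B])
    also have "\<dots> = (\<integral>w. indicator B w * Y (real n * h) w - indicator B w * ?fY w - indicator B w * (?y n w - ?fy w) \<partial>M)"
      using ind[OF Yi BM] ind[OF fYi BM] ind[OF Bochner_Integration.integrable_diff[OF yi fyi] BM] by simp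
    also have "\<dots> = (\<integral>w\<in>B. U w \<partial>M)"
      unfolding set_lebesgue_integral_def D_def U_def by (intro Bochner_Integration.integral_cong) (auto simp: algebra_simps)
    finally show ?thesis .
  qed
  show "?E \<phi>" if \<phi>: "\<phi> \<in> borel_measurable (\<F> (real n * h))"
  proof -
    have "(\<integral>\<^sup>+w. \<phi> w * ennreal ((1 - Lf * h * indicator ?L w) * \<bar>D n w\<bar>) \<partial>M) \<le> (\<integral>\<^sup>+w. \<phi> w * ennreal \<bar>U w\<bar> \<partial>M)"
    proof (intro nn_integral_mono mult_left_mono ennreal_leI)
      fix w
      show "(1 - Lf * h * indicator ?L w) * \<bar>D n w\<bar> \<le> \<bar>U w\<bar>"
        using fdiff[of w] unfolding U_def by (simp add: left_diff_distrib)
    qed simp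
    also have "\<dots> \<le> (\<integral>\<^sup>+w. \<phi> w * ennreal \<bar>D (Suc n) w + e w\<bar> \<partial>M)"
      by (rule S.nn_integral_abs_cond_exp_le[OF Bochner_Integration.integrable_add[OF Di ei] Ui U_meas eq \<phi>])
    also have "\<dots> \<le> (\<integral>\<^sup>+w. \<phi> w * (ennreal \<bar>D (Suc n) w\<bar> + ennreal \<bar>e w\<bar>) \<partial>M)"
      by (intro nn_integral_mono mult_left_mono) (auto simp: ennreal_plus[symmetric] intro!: ennreal_leI simp del: ennreal_plus)
    finally show ?thesis .
  qed
qed

end

section \<open>From one step to the supremum over all grid times\<close>

lemma SUP_power2_le:
  fixes a :: "nat \<Rightarrow> ennreal"
  shows "(SUP n. a n)\<^sup>2 \<le> (SUP N. (SUP n\<in>{..N}. a n)\<^sup>2)"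
proof -
  have "(SUP n. a n) \<le> esqrt (SUP N. (SUP n\<in>{..N}. a n)\<^sup>2)"
  proof (rule SUP_least)
    fix n :: nat
    have "(a n)\<^sup>2 \<le> (SUP n\<in>{..n}. a n)\<^sup>2" by (intro power_mono SUP_upper) auto
    also have "\<dots> \<le> (SUP N. (SUP n\<in>{..N}. a n)\<^sup>2)" by (rule SUP_upper) simp
    finally show "a n \<le> esqrt (SUP N. (SUP n\<in>{..N}. a n)\<^sup>2)" by (rule le_esqrt)
  qed
  then show ?thesis using power_mono[of "SUP n. a n" _ 2] esqrt_power2 by (metis zero_le)
qed

text \<open>The Gronwall bound on {0..N} is used with N tending to infinity. Past both stopping
  times the error at N is the terminal error. Before \<open>\<tau>h\<close> the part coming from
  \<open>R N\<close> is controlled by the summable weighted norm. All other contributions live on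
  the event that N h lies before \<open>max (\<tau> w) (\<tau>h w)\<close>, whose indicator tends to
  0, and are dominated by the integrable \<open>H\<close>.\<close>

lemma (in brownian_space) scheme_error_bound:
  assumes h: "0 < h" and Lf: "0 < Lf" and Lfh: "12 * Lf * h \<le> 1"
    and st: "is_stopping_time M \<F> \<tau>h" and grid: "\<forall>w\<in>space M. \<exists>n::nat. \<tau>h w = real n * h"
    and \<xi>b: "\<xi>b \<in> borel_measurable (stopped_sigma M \<F> (bm_filtration_inf M d W) \<tau>h)"
    and \<xi>b2: "integrable M (\<lambda>w. (\<xi>b w)\<^sup>2)" and \<xi>b4: "integrable M (\<lambda>w. \<xi>b w ^ 4)"
    and lip: "\<And>n w x y. \<bar>fh n w x - fh n w y\<bar> \<le> Lf * \<bar>x - y\<bar>"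
    and fhm: "\<And>n A. A \<in> borel_measurable (\<F> (real n * h)) \<Longrightarrow> (\<lambda>w. fh n w (A w)) \<in> borel_measurable (\<F> (real n * h))"
    and fp: "scheme_fixed_point M \<F> Lf h \<tau>h \<xi>b fh R"
    and Y: "\<And>t. 0 \<le> t \<Longrightarrow> Y t \<in> borel_measurable (\<F> t)" "\<And>t. 0 \<le> t \<Longrightarrow> integrable M (\<lambda>w. (Y t w)\<^sup>2)"
    and \<Delta>: "\<And>n. integrable M (\<Delta> n)" "\<And>n B. B \<in> sets (\<F> (real n * h)) \<Longrightarrow> (\<integral>w. indicator B w * \<Delta> n w \<partial>M) = 0"
    and \<tau>[measurable]: "\<tau> \<in> borel_measurable M" and \<xi>[measurable]: "\<xi> \<in> borel_measurable M"
    and Y\<tau>: "AE w in M. \<forall>t\<ge>\<tau> w. Y t w = \<xi> w"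
    and S[measurable]: "S \<in> borel_measurable M" and S4: "integrable M (\<lambda>w. S w ^ 4)" and YS: "AE w in M. \<forall>t\<ge>0. \<bar>Y t w\<bar> \<le> S w"
    and exp6: "integrable M (\<lambda>w. exp (6 * Lf * \<tau>h w))"
  defines "e \<equiv> \<lambda>n w. Y (real n * h) w - Y (real (Suc n) * h) w + \<Delta> n w
       - indicator {w \<in> space M. real n * h < \<tau>h w} w * (h * fh n w (Y (real n * h) w))"
  shows "(\<integral>\<^sup>+w. (SUP n. ennreal \<bar>Y (real n * h) w - scheme_value h \<tau>h \<xi>b R n w\<bar>)\<^sup>2 \<partial>M)
    \<le> 8 * (\<integral>\<^sup>+w. ennreal (exp (3 * Lf * \<tau>h w) * (\<xi> w - \<xi>b w)\<^sup>2) \<partial>M)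
     + 8 * (\<integral>\<^sup>+w. ennreal (exp (3 * Lf * \<tau>h w)) * (\<Sum>n. ennreal \<bar>e n w\<bar>)\<^sup>2 \<partial>M)" (is "_ \<le> ?c")
    and "e n \<in> borel_measurable M"
proof -
  define D where "D n w = Y (real n * h) w - scheme_value h \<tau>h \<xi>b R n w" for n w
  note step = scheme_error_one_step[OF h Lf st grid \<xi>b \<xi>b2 lip fhm fp Y \<Delta>]
  have one: "D n \<in> borel_measurable (\<F> (real n * h))" "integrable M (\<lambda>w. (D n w)\<^sup>2)" "e n \<in> borel_measurable M"
    "\<phi> \<in> borel_measurable (\<F> (real n * h)) \<Longrightarrow>
      (\<integral>\<^sup>+w. \<phi> w * ennreal ((1 - Lf * h * indicator {w \<in> space M. real n * h < \<tau>h w} w) * \<bar>D n w\<bar>) \<partial>M)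
      \<le> (\<integral>\<^sup>+w. \<phi> w * (ennreal \<bar>D (Suc n) w\<bar> + ennreal \<bar>e n w\<bar>) \<partial>M)" for n \<phi>
    unfolding D_def[abs_def] e_def by - ((rule step(1); assumption), (rule step(2); assumption), (rule step(3); assumption), (rule step(4); assumption))
  show "e n \<in> borel_measurable M" by (rule one(3))
  have nh: "0 \<le> real n * h" for n :: nat using h by simp
  let ?I = "\<lambda>n. {w \<in> space M. real n * h < \<tau>h w}"
  define b where "b n w = 1 - Lf * h * indicator (?I n) w" for n :: nat and w
  have \<kappa>: "0 < Lf * h" "Lf * h \<le> 1 / 12" using h Lf Lfh by auto
  have b: "0 < b n w" "b n w \<le> 1" for n w using \<kappa> by (auto simp: b_def indicator_def)
  have [measurable]: "?I n \<in> sets M" for n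
    using stopping_time_less_sets[OF st nh] by (rule sets_bm_filtrationD)
  have [measurable]: "\<tau>h \<in> borel_measurable M" using st by (rule stopping_time_measurable)
  have [measurable]: "\<xi>b \<in> borel_measurable M"
    using \<xi>b stopped_sigma_subset by (auto simp: measurable_def space_stopped_sigma)
  have [measurable]: "R n \<in> borel_measurable M" for n
    using fp by (auto simp: scheme_fixed_point_def intro: measurable_bm_filtrationD)
  have bF: "b n \<in> borel_measurable (\<F> (real n * h))" for n
    unfolding b_def[abs_def] using stopping_time_less_sets[OF st nh[of n]] by measurable
  define p where "p n w = (\<Prod>k<n. 1 / b k w)" for n w
  have p0: "0 < p n w" for n w unfolding p_def using b by (intro prod_pos) auto
  \<comment> \<open>The weight grows only over cells that start before \<open>\<tau>h\<close>.
    Capping time at \<open>\<tau>h\<close> in the exponent lets one induction cover growing and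
    constant factors.\<close>
  have p_exp: "p n w \<le> exp (3 / 2 * Lf * min (real n * h) (\<tau>h w))" if w: "w \<in> space M" for n w
  proof (induction n)
    case 0
    have "0 \<le> \<tau>h w" using st w by (simp add: is_stopping_time_def)
    then show ?case by (simp add: p_def)
  next
    case (Suc n)
    obtain m where m: "\<tau>h w = real m * h" using grid w by blast
    have "1 / b n w \<le> exp (3 / 2 * Lf * (min (real (Suc n) * h) (\<tau>h w) - min (real n * h) (\<tau>h w)))"
    proof (cases "real n * h < \<tau>h w")
      case True
      then have "n < m" using h by (simp add: m)
      then have "real (Suc n) * h \<le> \<tau>h w" unfolding m using h by (intro mult_right_mono) auto
      then have "min (real (Suc n) * h) (\<tau>h w) - min (real n * h) (\<tau>h w) = h" using True h by (simp add: algebra_simps)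
      moreover have "1 / (1 - Lf * h) \<le> exp (3 / 2 * (Lf * h))"
      proof -
        \<comment> \<open>With x = L_f h the product equals 1 + x/2 - 3 x^2/2, which is at least 1
          for x \<le> 1/3. Here x \<le> 1/12.\<close>
        have "1 \<le> (1 + 3 / 2 * (Lf * h)) * (1 - Lf * h)"
          using mult_left_mono[OF \<kappa>(2), of "Lf * h"] \<kappa>(1) by (simp add: algebra_simps)
        then have "1 / (1 - Lf * h) \<le> 1 + 3 / 2 * (Lf * h)" using \<kappa> by (simp add: divide_le_eq)
        also have "\<dots> \<le> exp (3 / 2 * (Lf * h))" by (rule exp_ge_add_one_self)
        finally show ?thesis .
      qed
      ultimately show ?thesis using True w by (simp add: b_def mult.assoc)
    next
      case False
      then show ?thesis using h by (simp add: b_def algebra_simps min_absorb2)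
    qed
    then have "p n w * (1 / b n w) \<le> exp (3 / 2 * Lf * min (real n * h) (\<tau>h w)) * exp (3 / 2 * Lf * (min (real (Suc n) * h) (\<tau>h w) - min (real n * h) (\<tau>h w)))"
      using Suc b by (intro mult_mono) (auto simp: less_imp_le)
    then show ?case by (simp add: p_def exp_add[symmetric] algebra_simps)
  qed
  \<comment> \<open>The weight of the fixed point norm. It dominates every Gronwall factor, since 1
    - 3 L_f h \<le> 1 - L_f h \<le> 1.\<close>
  let ?q = "inverse (1 - 3 * Lf * h)"
  have p_q: "p n w \<le> ?q ^ n" for n w
  proof -
    have "p n w \<le> (\<Prod>k<n. ?q)" unfolding p_def
    proof (rule prod_mono)
      fix k
      have "1 / b k w \<le> 1 / (1 - 3 * Lf * h)"
        using \<kappa> b(1)[of k w] by (intro divide_left_mono) (auto simp: b_def indicator_def)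
      then show "0 \<le> 1 / b k w \<and> 1 / b k w \<le> ?q" using b(1)[of k w] by (simp add: inverse_eq_divide)
    qed
    then show ?thesis by simp
  qed
  define E where "E w = (\<Sum>n. ennreal \<bar>e n w\<bar>)" for w
  have e_meas[measurable]: "e n \<in> borel_measurable M" for n by (rule one(3))
  have E_meas[measurable]: "E \<in> borel_measurable M" unfolding E_def[abs_def] by measurable
  define wt where "wt w = exp (3 * Lf * \<tau>h w)" for w
  have wt_meas[measurable]: "wt \<in> borel_measurable M" unfolding wt_def[abs_def] by measurable
  have p_wt: "(p n w)\<^sup>2 \<le> wt w" if "w \<in> space M" for n w
  proof -
    have "(p n w)\<^sup>2 \<le> (exp (3 / 2 * Lf * min (real n * h) (\<tau>h w)))\<^sup>2"
      using p_exp[OF that] p0[of n w] by (intro power_mono) auto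
    also have "\<dots> = exp (3 * Lf * min (real n * h) (\<tau>h w))" by (simp add: exp_double[symmetric])
    also have "\<dots> \<le> wt w" using Lf by (simp add: wt_def)
    finally show ?thesis .
  qed
  \<comment> \<open>Integrable by 2ab \<le> a^2 + b^2: this is where the exponential moment of rate
    6 L_f and the fourth moments of \<open>S\<close> and \<open>\<xi>b\<close> enter.\<close>
  define H where "H w = 2 * wt w * ((S w)\<^sup>2 + (\<xi>b w)\<^sup>2)" for w
  have H0: "0 \<le> H w" for w by (simp add: H_def wt_def)
  have H_meas[measurable]: "H \<in> borel_measurable M" unfolding H_def[abs_def] by measurable
  have H_int: "integrable M H"
  proof (rule Bochner_Integration.integrable_bound)
    show "integrable M (\<lambda>w. 2 * exp (6 * Lf * \<tau>h w) + S w ^ 4 + \<xi>b w ^ 4)" using exp6 S4 \<xi>b4 by simp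
    show "AE w in M. norm (H w) \<le> norm (2 * exp (6 * Lf * \<tau>h w) + S w ^ 4 + \<xi>b w ^ 4)"
    proof (intro AE_I2)
      fix w
      have "(wt w)\<^sup>2 = exp (6 * Lf * \<tau>h w)" by (simp add: wt_def exp_double[symmetric])
      then have "H w \<le> 2 * exp (6 * Lf * \<tau>h w) + S w ^ 4 + \<xi>b w ^ 4"
        using sum_squares_bound[of "wt w" "(S w)\<^sup>2"] sum_squares_bound[of "wt w" "(\<xi>b w)\<^sup>2"]
        by (simp add: H_def algebra_simps power_mult[symmetric])
      then show "norm (H w) \<le> norm (2 * exp (6 * Lf * \<tau>h w) + S w ^ 4 + \<xi>b w ^ 4)" using H0[of w] by simp
    qed
  qed measurable
  define Z where "Z n w = indicator {w. real n * h \<le> \<tau>h w} w * R n w" for n w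
  have Z_meas[measurable]: "Z n \<in> borel_measurable M" for n unfolding Z_def[abs_def] by measurable
  have Z_int: "integrable M (\<lambda>w. (Z n w)\<^sup>2)" for n
    by (rule Bochner_Integration.integrable_bound[of M "\<lambda>w. (R n w)\<^sup>2"])
      (use fp in \<open>auto simp: scheme_fixed_point_def Z_def indicator_def\<close>)
  define r where "r n w = ennreal (indicator {w. real n * h < max (\<tau> w) (\<tau>h w)} w * H w) + ennreal (2 * (?q ^ n * Z n w)\<^sup>2)" for n w
  have r_meas[measurable]: "r n \<in> borel_measurable M" for n unfolding r_def[abs_def] by measurable
  have r_lim: "(\<lambda>n. \<integral>\<^sup>+w. r n w \<partial>M) \<longlonglongrightarrow> 0"
  proof -
    have 1: "(\<lambda>n. \<integral>\<^sup>+w. ennreal (indicator {w. real n * h < max (\<tau> w) (\<tau>h w)} w * H w) \<partial>M) \<longlonglongrightarrow> (\<integral>\<^sup>+w. 0 \<partial>M)"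
    proof (rule nn_integral_dominated_convergence[where w = "\<lambda>w. ennreal (H w)"])
      show "(\<integral>\<^sup>+w. ennreal (H w) \<partial>M) < \<infinity>" using H_int H0 by (simp add: nn_integral_eq_integral)
      show "AE w in M. (\<lambda>n. ennreal (indicator {w. real n * h < max (\<tau> w) (\<tau>h w)} w * H w)) \<longlonglongrightarrow> 0"
      proof (intro AE_I2 tendsto_eventually)
        fix w
        obtain N :: nat where N: "max (\<tau> w) (\<tau>h w) \<le> real N * h"
          using reals_Archimedean3[OF h] by (meson less_imp_le)
        have "max (\<tau> w) (\<tau>h w) \<le> real n * h" if "N \<le> n" for n
        proof -
          have "real N * h \<le> real n * h" using that h by (intro mult_right_mono) auto
          with N show ?thesis by linarith
        qed
        then show "\<forall>\<^sub>F n in sequentially. ennreal (indicator {w. real n * h < max (\<tau> w) (\<tau>h w)} w * H w) = 0"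
          by (intro eventually_sequentiallyI[of N]) (force simp: indicator_def)
      qed
    qed (auto intro!: AE_I2 ennreal_leI simp: indicator_def H0)
    \<comment> \<open>The terms of the summable series tend to 0; twice their squares are the
      integrals of the second part of \<open>r\<close>.\<close>
    have "(\<lambda>n. ?q ^ n * sqrt (\<integral>w. (Z n w)\<^sup>2 \<partial>M)) \<longlonglongrightarrow> 0"
      using fp unfolding scheme_fixed_point_def Z_def by (blast intro: summable_LIMSEQ_zero)
    from tendsto_mult[OF tendsto_const[of 2] tendsto_power[OF this, of 2]]
    have "(\<lambda>n. ennreal (2 * (?q ^ n * sqrt (\<integral>w. (Z n w)\<^sup>2 \<partial>M))\<^sup>2)) \<longlonglongrightarrow> ennreal 0"
      by (intro tendsto_ennrealI) simp
    moreover have "(\<integral>\<^sup>+w. ennreal (2 * (?q ^ n * Z n w)\<^sup>2) \<partial>M) = ennreal (2 * (?q ^ n * sqrt (\<integral>w. (Z n w)\<^sup>2 \<partial>M))\<^sup>2)" for n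
      using Z_int[of n] by (subst nn_integral_eq_integral) (simp_all add: power_mult_distrib)
    ultimately have "(\<lambda>n. \<integral>\<^sup>+w. ennreal (2 * (?q ^ n * Z n w)\<^sup>2) \<partial>M) \<longlonglongrightarrow> 0" by simp
    from tendsto_add[OF 1 this] show ?thesis by (simp add: r_def nn_integral_add)
  qed
  have DN: "AE w in M. ennreal ((p N w * \<bar>D N w\<bar>)\<^sup>2) \<le> ennreal (wt w * (\<xi> w - \<xi>b w)\<^sup>2) + r N w" for N
    using Y\<tau> YS AE_space
  proof eventually_elim
    case (elim w)
    have YN: "(Y (real N * h) w)\<^sup>2 \<le> (S w)\<^sup>2" using elim(2) nh[of N] by (metis abs_ge_zero power2_abs power_mono)
    have wt0: "0 \<le> wt w" by (simp add: wt_def)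
    have pD: "(p N w * \<bar>D N w\<bar>)\<^sup>2 = (p N w)\<^sup>2 * (D N w)\<^sup>2" by (simp add: power_mult_distrib)
    have "(p N w * \<bar>D N w\<bar>)\<^sup>2 \<le> wt w * (\<xi> w - \<xi>b w)\<^sup>2
        + (indicator {w. real N * h < max (\<tau> w) (\<tau>h w)} w * H w + 2 * (?q ^ N * Z N w)\<^sup>2)"
    proof (cases "real N * h < \<tau>h w")
      case True
      have "(D N w)\<^sup>2 \<le> 2 * (Y (real N * h) w)\<^sup>2 + 2 * (R N w)\<^sup>2"
        using True power2_diff_le by (simp add: D_def scheme_value_def)
      also have "\<dots> \<le> 2 * (S w)\<^sup>2 + 2 * (R N w)\<^sup>2" using YN by simp
      finally have "(p N w)\<^sup>2 * (D N w)\<^sup>2 \<le> (p N w)\<^sup>2 * (2 * (S w)\<^sup>2) + (p N w)\<^sup>2 * (2 * (R N w)\<^sup>2)"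
        unfolding distrib_left[symmetric] by (rule mult_left_mono) simp
      also have "\<dots> \<le> wt w * (2 * (S w)\<^sup>2) + (?q ^ N)\<^sup>2 * (2 * (R N w)\<^sup>2)"
        using p_wt[OF elim(3)] p_q p0[of N w] by (intro add_mono mult_right_mono power_mono) auto
      also have "wt w * (2 * (S w)\<^sup>2) \<le> H w" using wt0 by (simp add: H_def distrib_left)
      finally show ?thesis using True wt0 unfolding pD
        by (simp add: Z_def power_mult_distrib add_increasing)
    next
      case False
      then have *: "(p N w)\<^sup>2 * (D N w)\<^sup>2 \<le> wt w * (Y (real N * h) w - \<xi>b w)\<^sup>2"
        using p_wt[OF elim(3)] by (intro mult_mono) (auto simp: D_def scheme_value_def wt0)
      show ?thesis
      proof (cases "real N * h < \<tau> w")
        case True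
        have "wt w * (Y (real N * h) w - \<xi>b w)\<^sup>2 \<le> wt w * (2 * (Y (real N * h) w)\<^sup>2 + 2 * (\<xi>b w)\<^sup>2)"
          by (intro mult_left_mono power2_diff_le wt0)
        also have "\<dots> \<le> H w" unfolding H_def using YN wt0 by (simp add: mult_left_mono ac_simps)
        finally show ?thesis using True * unfolding pD by (simp add: add_increasing wt0 add_increasing2)
      next
        case False': False
        then have "Y (real N * h) w = \<xi> w" using elim(1) by simp
        then show ?thesis using * False False' unfolding pD by (simp add: add_increasing2)
      qed
    qed
    then show ?case
      using H0 wt0 by (simp add: r_def ennreal_plus[symmetric] ennreal_leI del: ennreal_plus)
  qed
  let ?m = "\<lambda>N w. SUP n\<in>{..N}. ennreal \<bar>D n w\<bar>"
  have DM[measurable]: "D n \<in> borel_measurable M" for n using one(1) by (rule measurable_bm_filtrationD)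
  have bM[measurable]: "b n \<in> borel_measurable M" for n using bF by (rule measurable_bm_filtrationD)
  have pM[measurable]: "p n \<in> borel_measurable M" for n unfolding p_def[abs_def] by measurable
  have mN: "(\<integral>\<^sup>+w. (?m N w)\<^sup>2 \<partial>M) \<le> ?c + 8 * (\<integral>\<^sup>+w. r N w \<partial>M)" for N
  proof -
    have "(\<integral>\<^sup>+w. (?m N w)\<^sup>2 \<partial>M) \<le> 4 * (\<integral>\<^sup>+w. (ennreal (p N w * \<bar>D N w\<bar>) + (\<Sum>n<N. ennreal (p (Suc n) w * \<bar>e n w\<bar>)))\<^sup>2 \<partial>M)"
      unfolding p_def
    proof (rule weighted_gronwall_doob[OF subalgebra_bm_filtration _ one(1,2) e_meas bF b])
      show "m \<le> n \<Longrightarrow> sets (\<F> (real m * h)) \<subseteq> sets (\<F> (real n * h))" for m n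
        using h by (intro bm_filtration_mono mult_right_mono) auto
    qed (unfold b_def, rule one(4))
    also have "\<dots> \<le> 4 * (\<integral>\<^sup>+w. 2 * (ennreal (wt w * (\<xi> w - \<xi>b w)\<^sup>2) + r N w) + 2 * (ennreal (wt w) * (E w)\<^sup>2) \<partial>M)"
    proof (intro mult_left_mono nn_integral_mono_AE)
      show "AE w in M. (ennreal (p N w * \<bar>D N w\<bar>) + (\<Sum>n<N. ennreal (p (Suc n) w * \<bar>e n w\<bar>)))\<^sup>2
         \<le> 2 * (ennreal (wt w * (\<xi> w - \<xi>b w)\<^sup>2) + r N w) + 2 * (ennreal (wt w) * (E w)\<^sup>2)"
        using DN[of N] AE_space
      proof eventually_elim
        case (elim w)
        have "(\<Sum>n<N. ennreal (p (Suc n) w * \<bar>e n w\<bar>)) \<le> (\<Sum>n<N. ennreal (sqrt (wt w)) * ennreal \<bar>e n w\<bar>)"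
        proof (rule sum_mono)
          fix n
          have "p (Suc n) w \<le> sqrt (wt w)" using p_wt[OF elim(2)] by (rule real_le_rsqrt)
          then show "ennreal (p (Suc n) w * \<bar>e n w\<bar>) \<le> ennreal (sqrt (wt w)) * ennreal \<bar>e n w\<bar>"
            by (simp add: ennreal_mult''[symmetric] ennreal_leI mult_right_mono)
        qed
        also have "\<dots> = ennreal (sqrt (wt w)) * (\<Sum>n<N. ennreal \<bar>e n w\<bar>)" by (rule sum_distrib_left[symmetric])
        also have "\<dots> \<le> ennreal (sqrt (wt w)) * E w" unfolding E_def by (intro mult_left_mono sum_le_suminf) auto
        finally have "(\<Sum>n<N. ennreal (p (Suc n) w * \<bar>e n w\<bar>))\<^sup>2 \<le> (ennreal (sqrt (wt w)) * E w)\<^sup>2" by (rule power_mono) simp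
        also have "\<dots> = ennreal (wt w) * (E w)\<^sup>2"
          by (simp add: power_mult_distrib ennreal_power wt_def)
        finally have s: "(\<Sum>n<N. ennreal (p (Suc n) w * \<bar>e n w\<bar>))\<^sup>2 \<le> ennreal (wt w) * (E w)\<^sup>2" .
        have "(ennreal (p N w * \<bar>D N w\<bar>))\<^sup>2 \<le> ennreal (wt w * (\<xi> w - \<xi>b w)\<^sup>2) + r N w"
          using elim(1) p0[of N w] by (simp add: ennreal_power)
        then show ?case using s by (intro order_trans[OF ennreal_add_power2_le] add_mono mult_left_mono) auto
      qed
    qed simp
    also have "\<dots> = 8 * (\<integral>\<^sup>+w. ennreal (wt w * (\<xi> w - \<xi>b w)\<^sup>2) \<partial>M) + 8 * (\<integral>\<^sup>+w. r N w \<partial>M) + 8 * (\<integral>\<^sup>+w. ennreal (wt w) * (E w)\<^sup>2 \<partial>M)"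
      by (simp add: nn_integral_add nn_integral_cmult distrib_left mult.assoc[of "4::ennreal" 2, symmetric])
    finally show ?thesis by (simp add: wt_def E_def ac_simps)
  qed
  have m_bd: "(\<integral>\<^sup>+w. (?m K w)\<^sup>2 \<partial>M) \<le> ?c" for K
  proof -
    \<comment> \<open>K stays fixed while N grows: the maximum up to K is at most the one up to N,
      whose excess over \<open>?c\<close> vanishes in the limit.\<close>
    have "(\<lambda>N. ?c + 8 * (\<integral>\<^sup>+w. r N w \<partial>M)) \<longlonglongrightarrow> ?c + 8 * 0"
      by (intro tendsto_add tendsto_const ennreal_tendsto_cmult r_lim) simp
    moreover have "(\<integral>\<^sup>+w. (?m K w)\<^sup>2 \<partial>M) \<le> ?c + 8 * (\<integral>\<^sup>+w. r N w \<partial>M)" if "K \<le> N" for N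
    proof -
      have "(\<integral>\<^sup>+w. (?m K w)\<^sup>2 \<partial>M) \<le> (\<integral>\<^sup>+w. (?m N w)\<^sup>2 \<partial>M)"
        using that by (intro nn_integral_mono power_mono SUP_subset_mono) auto
      also note mN
      finally show ?thesis .
    qed
    ultimately have "(\<integral>\<^sup>+w. (?m K w)\<^sup>2 \<partial>M) \<le> ?c + 8 * 0" by (intro LIMSEQ_le_const) auto
    then show ?thesis by simp
  qed
  have "(\<integral>\<^sup>+w. (SUP n. ennreal \<bar>D n w\<bar>)\<^sup>2 \<partial>M) \<le> (\<integral>\<^sup>+w. (SUP N. (?m N w)\<^sup>2) \<partial>M)"
    by (intro nn_integral_mono SUP_power2_le)
  also have "\<dots> = (SUP N. \<integral>\<^sup>+w. (?m N w)\<^sup>2 \<partial>M)"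
    by (rule nn_integral_monotone_convergence_SUP)
      (auto intro!: incseq_SucI le_funI power_mono SUP_subset_mono)
  also have "\<dots> \<le> ?c" by (rule SUP_least) (rule m_bd)
  finally show "(\<integral>\<^sup>+w. (SUP n. ennreal \<bar>Y (real n * h) w - scheme_value h \<tau>h \<xi>b R n w\<bar>)\<^sup>2 \<partial>M) \<le> ?c"
    by (simp only: D_def)
qed

section \<open>Local errors\<close>

text \<open>The inequality y \<le> exp y for y = \<rho> x / k, raised to the power k.\<close>

lemma power_le_exp:
  fixes x \<rho> :: real
  assumes "0 \<le> x" "0 < \<rho>" "0 < k"
  shows "x ^ k \<le> (real k / \<rho>) ^ k * exp (\<rho> * x)"
proof -
  let ?s = "\<rho> / real k"
  have "?s * x \<le> exp (?s * x)" using exp_ge_add_one_self[of "?s * x"] by linarith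
  then have "(?s * x) ^ k \<le> exp (?s * x) ^ k" using assms by (intro power_mono) auto
  also have "\<dots> = exp (\<rho> * x)" using assms by (simp add: exp_of_nat_mult[symmetric])
  finally have "(real k / \<rho>) ^ k * (?s * x) ^ k \<le> (real k / \<rho>) ^ k * exp (\<rho> * x)"
    using assms by (intro mult_left_mono) auto
  also have "(real k / \<rho>) ^ k * (?s * x) ^ k = x ^ k"
    using assms by (simp add: power_mult_distrib[symmetric])
  finally show ?thesis .
qed

text \<open>\<open>l T n\<close> is the length of the part of the n-th cell inside [0, T]. For T
  \<le> Th all differences have the same sign, so the absolute values disappear and both sums
  telescope.\<close>

lemma interval_length_diff_sum_le:
  fixes T Th h :: real
  assumes "0 < h" "0 \<le> T" "0 \<le> Th"
  defines "l \<equiv> \<lambda>T n. min (real (Suc n) * h) T - min (real n * h) T"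
  shows "(\<Sum>n<N. \<bar>l T n - l Th n\<bar>) \<le> \<bar>T - Th\<bar>"
  using assms(2,3)
proof (induction T Th rule: linorder_wlog)
  case (le T Th)
  have mono: "l T n \<le> l Th n" for n
  proof -
    have "real n * h \<le> real (Suc n) * h" using assms(1) by (intro mult_right_mono) auto
    then show ?thesis using le unfolding l_def by linarith
  qed
  have "(\<Sum>n<N. \<bar>l T n - l Th n\<bar>) = (\<Sum>n<N. l Th n - l T n)"
    using mono by (intro sum.cong refl) (simp add: abs_of_nonpos)
  also have "\<dots> = (\<Sum>n<N. l Th n) - (\<Sum>n<N. l T n)" by (rule sum_subtractf)
  also have "(\<Sum>n<N. l t n) = min (real N * h) t" if "0 \<le> t" for t
    unfolding l_def using sum_lessThan_telescope[of "\<lambda>n. min (real n * h) t" N] that by simp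
  then have "(\<Sum>n<N. l Th n) - (\<Sum>n<N. l T n) = min (real N * h) Th - min (real N * h) T"
    using le by simp
  also have "\<dots> \<le> \<bar>T - Th\<bar>" using le by linarith
  finally show ?case .
next
  case (sym T Th)
  then show ?case by (simp add: abs_minus_commute)
qed

lemma local_error_sum_le:
  fixes y f :: "real \<Rightarrow> real" and g :: "nat \<Rightarrow> real \<Rightarrow> real"
  assumes h: "0 < h" and T: "0 \<le> T" and Th: "Th = real m * h" and Lf: "0 \<le> Lf"
    and y: "continuous_on {0..} y" and f: "set_integrable lborel {0..T} f"
    and lip: "\<And>n a b. \<bar>g n a - g n b\<bar> \<le> Lf * \<bar>a - b\<bar>"
    and osc: "\<And>n t. t \<in> {real n * h..real n * h + h} \<Longrightarrow> \<bar>y t - y (real n * h)\<bar> \<le> B"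
    and V: "\<And>n. real n * h \<le> max T Th \<Longrightarrow> \<bar>g n (y (real n * h))\<bar> \<le> V"
    and e: "\<And>n. e n = (LINT s:{min (real n * h) T..min (real (Suc n) * h) T}|lborel. f s)
        - (if real n * h < Th then h * g n (y (real n * h)) else 0)"
  shows "(\<Sum>n. ennreal \<bar>e n\<bar>) \<le> ennreal (V * \<bar>T - Th\<bar> + Lf * T * B)
     + esqrt (ennreal T * (\<integral>\<^sup>+s\<in>{0..T}. ennreal ((f s - g (nat \<lfloor>s / h\<rfloor>) (y s))\<^sup>2) \<partial>lborel))"
proof -
  have V0: "0 \<le> V" using V[of 0] T by (simp add: le_max_iff_disj)
  have B0: "0 \<le> B" using osc[of 0 0] h by simp
  have Th0: "0 \<le> Th" using h by (simp add: Th)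
  have nh: "real n * h \<le> real (Suc n) * h" "0 \<le> real n * h" for n using h by (auto intro: mult_right_mono)
  define F where "F s = \<bar>f s - g (nat \<lfloor>s / h\<rfloor>) (y s)\<bar>" for s
  have g_cont: "continuous_on UNIV (g n)" for n
    using Lf by (intro lipschitz_on_continuous_on[of Lf] lipschitz_onI) (auto simp: dist_real_def lip)
  have gy: "(\<lambda>s. indicator {0..} s *\<^sub>R g n (y s)) \<in> borel_measurable borel" for n
    by (intro borel_measurable_continuous_on_indicator continuous_on_compose2[OF g_cont y]) auto
  \<comment> \<open>Each \<open>g n\<close> composed with the continuous path is measurable, and the
    countably many indices are pasted together along the measurable map that selects the
    cell.\<close>
  have gf: "(\<lambda>s. indicator {0..} s *\<^sub>R g (nat \<lfloor>s / h\<rfloor>) (y s)) \<in> borel_measurable borel"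
    by (rule measurable_compose_countable[OF gy]) measurable
  have fm: "(\<lambda>s. indicator {0..T} s *\<^sub>R f s) \<in> borel_measurable borel"
    using f by (auto simp: set_integrable_def)
  have F_meas: "(\<lambda>s. indicator {0..T} s * F s) \<in> borel_measurable borel"
  proof -
    have "(\<lambda>s. \<bar>indicator {0..T} s *\<^sub>R f s - indicator {0..T} s * (indicator {0..} s *\<^sub>R g (nat \<lfloor>s / h\<rfloor>) (y s))\<bar>) \<in> borel_measurable borel"
      using gf fm by measurable
    also have "(\<lambda>s. \<bar>indicator {0..T} s *\<^sub>R f s - indicator {0..T} s * (indicator {0..} s *\<^sub>R g (nat \<lfloor>s / h\<rfloor>) (y s))\<bar>)
       = (\<lambda>s. indicator {0..T} s * F s)" by (auto simp: F_def indicator_def fun_eq_iff)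
    finally show ?thesis .
  qed
  have F_meas': "(\<lambda>s. ennreal (F s) * indicator {0..T} s) \<in> borel_measurable lborel"
  proof -
    have "(\<lambda>s. ennreal (indicator {0..T} s * F s)) \<in> borel_measurable borel" using F_meas by measurable
    also have "(\<lambda>s. ennreal (indicator {0..T} s * F s)) = (\<lambda>s. ennreal (F s) * indicator {0..T} s)"
      by (auto simp: indicator_def fun_eq_iff)
    finally show ?thesis by simp
  qed
  define a where "a n = min (real n * h) T" for n
  have a: "a n \<le> a (Suc n)" "0 \<le> a n" "a n \<le> T" for n using nh[of n] T by (auto simp: a_def)
  define l where "l t n = min (real (Suc n) * h) t - min (real n * h) t" for t n
  have l_T: "l T n = a (Suc n) - a n" for n by (simp add: l_def a_def)
  have l_Th: "l Th n = (if real n * h < Th then h else 0)" for n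
  proof (cases "real n * h < Th")
    case True
    then have "Suc n \<le> m" using h by (simp add: Th)
    then have "real (Suc n) * h \<le> Th" unfolding Th using h by (intro mult_right_mono) auto
    then show ?thesis using True by (simp add: l_def algebra_simps)
  next
    case False
    then show ?thesis using nh[of n] by (simp add: l_def)
  qed
  let ?c = "\<lambda>n. g n (y (real n * h))"
  have part1: "ennreal \<bar>(LINT s:{a n..a (Suc n)}|lborel. f s) - l T n * ?c n\<bar>
      \<le> (\<integral>\<^sup>+s. indicator {a n..<a (Suc n)} s * (ennreal (F s) * indicator {0..T} s + ennreal (Lf * B)) \<partial>lborel)" for n
  proof -
    have fi: "set_integrable lborel {a n..a (Suc n)} f"
      using a[of n] a[of "Suc n"] by (intro set_integrable_subset[OF f]) auto
    have ci: "set_integrable lborel {a n..a (Suc n)} (\<lambda>_. ?c n)"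
      by (intro borel_integrable_atLeastAtMost') auto
    have "(LINT s:{a n..a (Suc n)}|lborel. ?c n) = l T n * ?c n"
      using a(1)[of n] by (simp add: set_lebesgue_integral_def l_T)
    then have "(LINT s:{a n..a (Suc n)}|lborel. f s) - l T n * ?c n = (LINT s:{a n..a (Suc n)}|lborel. f s - ?c n)"
      using set_integral_diff(2)[OF fi ci] by simp
    also have "ennreal \<bar>\<dots>\<bar> \<le> (\<integral>\<^sup>+s. ennreal (norm (indicator {a n..a (Suc n)} s *\<^sub>R (f s - ?c n))) \<partial>lborel)"
      using integral_norm_bound_ennreal[OF set_integral_diff(1)[OF fi ci, unfolded set_integrable_def]]
      by (simp add: set_lebesgue_integral_def)
    also have "\<dots> \<le> (\<integral>\<^sup>+s. indicator {a n..<a (Suc n)} s * (ennreal (F s) * indicator {0..T} s + ennreal (Lf * B)) \<partial>lborel)"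
    \<comment> \<open>Half-open cells are disjoint, which the summation over n will need; the
      omitted right end point is a null set.\<close>
    proof (rule nn_integral_mono_AE, use AE_lborel_singleton[of "a (Suc n)"] in eventually_elim)
      case (elim s)
      show ?case
      proof (cases "s \<in> {a n..<a (Suc n)}")
        case True
        have s: "real n * h \<le> s" "s < real (Suc n) * h" "0 \<le> s" "s \<le> T"
          using True a[of n] a[of "Suc n"] nh[of n] by (auto simp: a_def min_def split: if_splits)
        have "real n \<le> s / h" "s / h < real n + 1" using s h by (auto simp: field_simps)
        then have "nat \<lfloor>s / h\<rfloor> = n" by (simp add: floor_eq_iff nat_eq_iff)
        then have Fs: "F s = \<bar>f s - g n (y s)\<bar>" by (simp add: F_def)
        have "\<bar>g n (y s) - ?c n\<bar> \<le> Lf * B"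
          using lip[of n "y s" "y (real n * h)"] mult_left_mono[OF osc[of s n] Lf] s by (simp add: algebra_simps)
        then have "\<bar>f s - ?c n\<bar> \<le> F s + Lf * B" unfolding Fs by linarith
        then have "ennreal \<bar>f s - ?c n\<bar> \<le> ennreal (F s) + ennreal (Lf * B)"
          using Lf B0 by (simp add: ennreal_plus[symmetric] F_def ennreal_leI del: ennreal_plus)
        then show ?thesis using True s by simp
      next
        case False
        then show ?thesis using elim by (auto simp: indicator_def)
      qed
    qed
    finally show ?thesis .
  qed
  have part2: "ennreal \<bar>e n\<bar> \<le> (\<integral>\<^sup>+s. indicator {a n..<a (Suc n)} s * (ennreal (F s) * indicator {0..T} s + ennreal (Lf * B)) \<partial>lborel)
      + ennreal V * ennreal \<bar>l T n - l Th n\<bar>" for n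
  proof -
    \<comment> \<open>In cells starting at or after both T and Th the two lengths are 0, so
      \<open>V\<close> is invoked only where it is known to be a bound.\<close>
    have "\<bar>(l T n - l Th n) * ?c n\<bar> \<le> V * \<bar>l T n - l Th n\<bar>"
    proof (cases "real n * h < max T Th")
      case True
      then show ?thesis using mult_right_mono[OF V[of n], of "\<bar>l T n - l Th n\<bar>"] by (simp add: abs_mult ac_simps)
    next
      case False
      then have "l T n = 0" "l Th n = 0" using nh[of n] by (auto simp: l_def)
      then show ?thesis by simp
    qed
    moreover have "e n = ((LINT s:{a n..a (Suc n)}|lborel. f s) - l T n * ?c n) + (l T n - l Th n) * ?c n"
      unfolding e a_def l_Th by (simp add: left_diff_distrib)
    ultimately have "\<bar>e n\<bar> \<le> \<bar>(LINT s:{a n..a (Suc n)}|lborel. f s) - l T n * ?c n\<bar> + V * \<bar>l T n - l Th n\<bar>" by linarith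
    then have "ennreal \<bar>e n\<bar> \<le> ennreal \<bar>(LINT s:{a n..a (Suc n)}|lborel. f s) - l T n * ?c n\<bar> + ennreal V * ennreal \<bar>l T n - l Th n\<bar>"
      using V0 by (simp add: ennreal_plus[symmetric] ennreal_mult[symmetric] ennreal_leI del: ennreal_plus)
    then show ?thesis by (rule order_trans) (intro add_right_mono part1)
  qed
  have "(\<Sum>n. ennreal \<bar>e n\<bar>) \<le> (\<Sum>n. (\<integral>\<^sup>+s. indicator {a n..<a (Suc n)} s * (ennreal (F s) * indicator {0..T} s + ennreal (Lf * B)) \<partial>lborel)
      + ennreal V * ennreal \<bar>l T n - l Th n\<bar>)"
    by (intro suminf_le part2) auto
  also have "\<dots> = (\<Sum>n. \<integral>\<^sup>+s. indicator {a n..<a (Suc n)} s * (ennreal (F s) * indicator {0..T} s + ennreal (Lf * B)) \<partial>lborel)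
      + (\<Sum>n. ennreal V * ennreal \<bar>l T n - l Th n\<bar>)"
    by (rule suminf_add[symmetric]) auto
  also have "\<dots> \<le> (ennreal (Lf * T * B) + esqrt (ennreal T * (\<integral>\<^sup>+s\<in>{0..T}. ennreal ((F s)\<^sup>2) \<partial>lborel))) + ennreal (V * \<bar>T - Th\<bar>)"
  proof (rule add_mono)
    have "(\<Sum>n. ennreal V * ennreal \<bar>l T n - l Th n\<bar>) = ennreal V * (\<Sum>n. ennreal \<bar>l T n - l Th n\<bar>)" by simp
    also have "\<dots> \<le> ennreal V * ennreal \<bar>T - Th\<bar>"
    proof (intro mult_left_mono suminf_le_const)
      show "(\<Sum>n<N. ennreal \<bar>l T n - l Th n\<bar>) \<le> ennreal \<bar>T - Th\<bar>" for N
        using interval_length_diff_sum_le[OF h T Th0, of N] by (simp add: l_def ennreal_leI)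
    qed auto
    finally show "(\<Sum>n. ennreal V * ennreal \<bar>l T n - l Th n\<bar>) \<le> ennreal (V * \<bar>T - Th\<bar>)"
      using V0 by (simp add: ennreal_mult)
    have disj: "disjoint_family (\<lambda>n. {a n..<a (Suc n)})"
      unfolding disjoint_family_on_def
    proof (intro ballI impI)
      fix i j :: nat assume ij: "i \<noteq> j"
      have am: "mono a" using a(1) by (intro incseq_SucI)
      show "{a i..<a (Suc i)} \<inter> {a j..<a (Suc j)} = {}"
      proof (cases "i < j")
        case True
        then have "a (Suc i) \<le> a j" using monoD[OF am, of "Suc i" j] by simp
        then show ?thesis by auto
      next
        case False
        then have "a (Suc j) \<le> a i" using monoD[OF am, of "Suc j" i] ij by simp
        then show ?thesis by auto
      qed
    qed
    have "(\<Sum>n. \<integral>\<^sup>+s. indicator {a n..<a (Suc n)} s * (ennreal (F s) * indicator {0..T} s + ennreal (Lf * B)) \<partial>lborel)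
       = (\<integral>\<^sup>+s. (\<Sum>n. indicator {a n..<a (Suc n)} s * (ennreal (F s) * indicator {0..T} s + ennreal (Lf * B))) \<partial>lborel)"
      by (intro nn_integral_suminf[symmetric] borel_measurable_times_ennreal borel_measurable_add
          F_meas' borel_measurable_indicator borel_measurable_const) simp_all
    also have "\<dots> \<le> (\<integral>\<^sup>+s. ennreal (F s) * indicator {0..T} s + ennreal (Lf * B) * indicator {0..T} s \<partial>lborel)"
    proof (intro nn_integral_mono)
      fix s
      have "(\<Sum>n. indicator {a n..<a (Suc n)} s * (ennreal (F s) * indicator {0..T} s + ennreal (Lf * B)))
         = indicator (\<Union>n. {a n..<a (Suc n)}) s * (ennreal (F s) * indicator {0..T} s + ennreal (Lf * B))"
        by (simp add: suminf_indicator[OF disj])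
      also have "\<dots> \<le> indicator {0..T} s * (ennreal (F s) * indicator {0..T} s + ennreal (Lf * B))"
        using a by (intro mult_right_mono indicator_leI) (auto intro: order_trans less_imp_le)
      also have "\<dots> = ennreal (F s) * indicator {0..T} s + ennreal (Lf * B) * indicator {0..T} s"
        by (auto simp: indicator_def)
      finally show "(\<Sum>n. indicator {a n..<a (Suc n)} s * (ennreal (F s) * indicator {0..T} s + ennreal (Lf * B)))
        \<le> ennreal (F s) * indicator {0..T} s + ennreal (Lf * B) * indicator {0..T} s" .
    qed
    also have "\<dots> = (\<integral>\<^sup>+s. ennreal (F s) * indicator {0..T} s \<partial>lborel) + ennreal (Lf * B) * ennreal T"
      using F_meas' T by (simp add: nn_integral_add nn_integral_cmult_indicator)
    also have "(\<integral>\<^sup>+s. ennreal (F s) * indicator {0..T} s \<partial>lborel) = (\<integral>\<^sup>+s. indicator {0..T} s * (ennreal (F s) * indicator {0..T} s) \<partial>lborel)"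
      by (intro nn_integral_cong) (auto simp: indicator_def)
    also have "\<dots> \<le> esqrt (\<integral>\<^sup>+s. (indicator {0..T} s)\<^sup>2 \<partial>lborel) * esqrt (\<integral>\<^sup>+s. (ennreal (F s) * indicator {0..T} s)\<^sup>2 \<partial>lborel)"
      using F_meas' by (intro nn_integral_mult_le_esqrt) auto
    also have "(\<integral>\<^sup>+s. (indicator {0..T} s :: ennreal)\<^sup>2 \<partial>lborel) = (\<integral>\<^sup>+s. indicator {0..T} s \<partial>lborel)"
      by (intro nn_integral_cong) (simp split: split_indicator)
    also have "\<dots> = ennreal T" using T by simp
    also have "(\<integral>\<^sup>+s. (ennreal (F s) * indicator {0..T} s)\<^sup>2 \<partial>lborel) = (\<integral>\<^sup>+s\<in>{0..T}. ennreal ((F s)\<^sup>2) \<partial>lborel)"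
      by (intro nn_integral_cong) (auto simp: F_def ennreal_power split: split_indicator)
    also have "ennreal (Lf * B) * ennreal T = ennreal (Lf * T * B)"
      using Lf B0 T by (simp add: ennreal_mult'[symmetric] ac_simps)
    finally show "(\<Sum>n. \<integral>\<^sup>+s. indicator {a n..<a (Suc n)} s * (ennreal (F s) * indicator {0..T} s + ennreal (Lf * B)) \<partial>lborel)
       \<le> ennreal (Lf * T * B) + esqrt (ennreal T * (\<integral>\<^sup>+s\<in>{0..T}. ennreal ((F s)\<^sup>2) \<partial>lborel))"
      by (simp add: esqrt_mult ac_simps add_right_mono)
  qed
  also have "\<dots> = ennreal (V * \<bar>T - Th\<bar> + Lf * T * B) + esqrt (ennreal T * (\<integral>\<^sup>+s\<in>{0..T}. ennreal ((F s)\<^sup>2) \<partial>lborel))"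
    using V0 Lf T B0 by (simp add: ennreal_plus ac_simps)
  finally show ?thesis by (simp add: F_def)
qed

text \<open>Each product under the weight exp(3 L_f \<tau>h) is split by Cauchy-Schwarz so that one
  factor takes the weight, then of rate 6 L_f. In the terms with \<open>V\<close> and
  \<open>G\<close> this is the factor wanted in the theorem, and the other admits a bound uniform in
  the step size. In the oscillation term the weight is paired with \<tau>^2, so that
  \<open>S\<close> enters through its fourth moment alone. The factors 4, 4 and 2 come from (x +
  y)^2 \<le> 2 x^2 + 2 y^2 used twice.\<close>

lemma (in prob_space) local_error_moment_le:
  fixes E G :: "'a \<Rightarrow> ennreal" and \<tau> \<tau>h V S :: "'a \<Rightarrow> real"
  assumes [measurable]: "E \<in> borel_measurable M" "\<tau> \<in> borel_measurable M" "\<tau>h \<in> borel_measurable M"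
      "V \<in> borel_measurable M" "S \<in> borel_measurable M"
    and Lf: "0 < Lf" and \<tau>: "\<And>w. w \<in> space M \<Longrightarrow> 0 \<le> \<tau> w"
    and le: "AE w in M. E w \<le> ennreal (V w * \<bar>\<tau> w - \<tau>h w\<bar> + Lf * \<tau> w * S w) + esqrt (ennreal (\<tau> w) * G w)"
  shows "(\<integral>\<^sup>+w. ennreal (exp (3 * Lf * \<tau>h w)) * (E w)\<^sup>2 \<partial>M)
    \<le> 4 * (esqrt (\<integral>\<^sup>+w. ennreal (exp (6 * Lf * max (\<tau> w) (\<tau>h w)) * (V w)\<^sup>2 * \<bar>\<tau> w - \<tau>h w\<bar>\<^sup>2) \<partial>M)
           * esqrt (\<integral>\<^sup>+w. ennreal ((V w)\<^sup>2 * (\<tau> w - \<tau>h w)\<^sup>2) \<partial>M))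
     + 4 * ennreal (Lf\<^sup>2) * (esqrt (\<integral>\<^sup>+w. ennreal (exp (6 * Lf * \<tau>h w) * \<tau> w ^ 4) \<partial>M) * esqrt (\<integral>\<^sup>+w. ennreal (S w ^ 4) \<partial>M))
     + 2 * (esqrt (\<integral>\<^sup>+w. ennreal (exp (6 * Lf * max (\<tau> w) (\<tau>h w))) * (G w)\<^sup>2 \<partial>M) * esqrt (\<integral>\<^sup>+w. ennreal ((\<tau> w)\<^sup>2) \<partial>M))"
proof -
  let ?d = "\<lambda>w. \<bar>\<tau> w - \<tau>h w\<bar>" and ?x = "\<lambda>w. exp (3 * Lf * \<tau>h w)"
  have x2: "(?x w)\<^sup>2 = exp (6 * Lf * \<tau>h w)" for w by (simp add: exp_double[symmetric])
  have x2_le: "exp (6 * Lf * \<tau>h w) \<le> exp (6 * Lf * max (\<tau> w) (\<tau>h w))" for w using Lf by simp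
  define b where "b w = V w * ?d w + Lf * \<tau> w * S w" for w
  define a where "a w = E w - ennreal (b w)" for w
  \<comment> \<open>\<open>G\<close> need not be measurable; \<open>c = a\<^sup>2 / \<tau>\<close> is a measurable minorant of it (with \<open>0 / 0 = 0\<close> if \<open>\<tau> = 0\<close>)\<close>
  have b_meas[measurable]: "b \<in> borel_measurable M" unfolding b_def[abs_def] by measurable
  have a_meas[measurable]: "a \<in> borel_measurable M" unfolding a_def[abs_def] by measurable
  have E_le: "E w \<le> ennreal (b w) + a w" for w
    unfolding a_def by (auto simp: add_diff_self_ennreal not_le)
  define c where "c w = (a w)\<^sup>2 / ennreal (\<tau> w)" for w
  have c_meas[measurable]: "c \<in> borel_measurable M" unfolding c_def[abs_def] by measurable
  have c: "AE w in M. c w \<le> G w \<and> (a w)\<^sup>2 = c w * ennreal (\<tau> w)"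
    using le AE_space
  proof eventually_elim
    case (elim w)
    have "a w \<le> esqrt (ennreal (\<tau> w) * G w)"
      unfolding a_def using elim(1) by (intro ennreal_minus_le_iff[THEN iffD2] disjI2) (auto simp: b_def)
    then have "(a w)\<^sup>2 \<le> (esqrt (ennreal (\<tau> w) * G w))\<^sup>2" by (rule power_mono) simp
    then have a2: "(a w)\<^sup>2 \<le> G w * ennreal (\<tau> w)" by (simp add: esqrt_power2 mult.commute)
    show ?case
    proof (cases "\<tau> w = 0")
      case True
      then show ?thesis using a2 by (simp add: c_def)
    next
      case False
      then have t: "0 < \<tau> w" using \<tau>[OF elim(2)] by simp
      have "c w \<le> G w * ennreal (\<tau> w) / ennreal (\<tau> w)" unfolding c_def by (rule divide_right_mono_ennreal[OF a2])
      also have "\<dots> = G w" using t by (intro ennreal_mult_divide_eq) auto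
      finally show ?thesis using t by (auto simp: c_def ennreal_divide_times intro!: ennreal_mult_divide_eq[symmetric, THEN trans])
    qed
  qed
  have "(\<integral>\<^sup>+w. ennreal (?x w) * (E w)\<^sup>2 \<partial>M)
     \<le> (\<integral>\<^sup>+w. (4 * (ennreal (?x w * (\<bar>V w\<bar> * ?d w)) * ennreal (\<bar>V w\<bar> * ?d w))
         + 4 * ennreal (Lf\<^sup>2) * (ennreal (?x w * (\<tau> w)\<^sup>2) * ennreal ((S w)\<^sup>2)))
         + 2 * ((ennreal (?x w) * c w) * ennreal (\<tau> w)) \<partial>M)"
  proof (rule nn_integral_mono_AE, use c in eventually_elim)
    case (elim w)
    have "(E w)\<^sup>2 \<le> (ennreal (b w) + a w)\<^sup>2" by (intro power_mono E_le) simp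
    also have "\<dots> \<le> 2 * (ennreal (b w))\<^sup>2 + 2 * (a w)\<^sup>2" by (rule ennreal_add_power2_le)
    also have "(a w)\<^sup>2 = c w * ennreal (\<tau> w)" using elim by simp
    also have "(ennreal (b w))\<^sup>2 \<le> ennreal (2 * (V w * ?d w)\<^sup>2 + 2 * (Lf * \<tau> w * S w)\<^sup>2)"
    proof -
      have "(ennreal (b w))\<^sup>2 \<le> ennreal ((b w)\<^sup>2)"
        by (cases "0 \<le> b w") (auto simp: ennreal_power ennreal_neg)
      also have "\<dots> \<le> ennreal (2 * (V w * ?d w)\<^sup>2 + 2 * (Lf * \<tau> w * S w)\<^sup>2)"
        unfolding b_def using power2_diff_le[of "V w * ?d w" "- (Lf * \<tau> w * S w)"] by (intro ennreal_leI) simp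
      finally show ?thesis .
    qed
    finally have "(E w)\<^sup>2 \<le> 2 * ennreal (2 * (V w * ?d w)\<^sup>2 + 2 * (Lf * \<tau> w * S w)\<^sup>2) + 2 * (c w * ennreal (\<tau> w))"
      by (iprover intro: add_right_mono mult_left_mono zero_le)
    then have "ennreal (?x w) * (E w)\<^sup>2 \<le> ennreal (?x w) *
       (2 * ennreal (2 * (V w * ?d w)\<^sup>2 + 2 * (Lf * \<tau> w * S w)\<^sup>2) + 2 * (c w * ennreal (\<tau> w)))"
      by (rule mult_left_mono) simp
    also have "\<dots> = ennreal (?x w) * (2 * ennreal (2 * (V w * ?d w)\<^sup>2 + 2 * (Lf * \<tau> w * S w)\<^sup>2)) + 2 * ((ennreal (?x w) * c w) * ennreal (\<tau> w))"
      by (simp add: distrib_left ac_simps)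
    also have "ennreal (?x w) * (2 * ennreal (2 * (V w * ?d w)\<^sup>2 + 2 * (Lf * \<tau> w * S w)\<^sup>2))
       = 4 * (ennreal (?x w * (\<bar>V w\<bar> * ?d w)) * ennreal (\<bar>V w\<bar> * ?d w))
         + 4 * ennreal (Lf\<^sup>2) * (ennreal (?x w * (\<tau> w)\<^sup>2) * ennreal ((S w)\<^sup>2))"
    proof -
      have "ennreal (?x w) * (2 * ennreal (2 * (V w * ?d w)\<^sup>2 + 2 * (Lf * \<tau> w * S w)\<^sup>2))
         = ennreal (?x w * (2 * (2 * (V w * ?d w)\<^sup>2 + 2 * (Lf * \<tau> w * S w)\<^sup>2)))"
      proof -
        have "2 * ennreal z = ennreal (2 * z)" for z :: real by (simp add: ennreal_mult')
        moreover have "ennreal (?x w) * ennreal z = ennreal (?x w * z)" for z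
          by (rule ennreal_mult'[symmetric]) simp
        ultimately show ?thesis by (simp only:)
      qed
      also have "?x w * (2 * (2 * (V w * ?d w)\<^sup>2 + 2 * (Lf * \<tau> w * S w)\<^sup>2))
         = 4 * ((?x w * (\<bar>V w\<bar> * ?d w)) * (\<bar>V w\<bar> * ?d w)) + 4 * (Lf\<^sup>2) * ((?x w * (\<tau> w)\<^sup>2) * ((S w)\<^sup>2))"
        by (simp add: power2_eq_square algebra_simps abs_mult[symmetric])
      also have "ennreal \<dots> = 4 * (ennreal (?x w * (\<bar>V w\<bar> * ?d w)) * ennreal (\<bar>V w\<bar> * ?d w))
         + 4 * ennreal (Lf\<^sup>2) * (ennreal (?x w * (\<tau> w)\<^sup>2) * ennreal ((S w)\<^sup>2))"
      proof -
        have "ennreal (4 * z) = 4 * ennreal z" for z :: real by (simp add: ennreal_mult')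
        moreover have "ennreal (x * z) = ennreal x * ennreal z" if "0 \<le> x" for x z
          using that by (rule ennreal_mult')
        ultimately show ?thesis by (subst ennreal_plus) (simp_all add: mult.assoc)
      qed
      finally show ?thesis .
    qed
    finally show ?case .
  qed
  also have "\<dots> = 4 * (\<integral>\<^sup>+w. ennreal (?x w * (\<bar>V w\<bar> * ?d w)) * ennreal (\<bar>V w\<bar> * ?d w) \<partial>M)
       + 4 * ennreal (Lf\<^sup>2) * (\<integral>\<^sup>+w. ennreal (?x w * (\<tau> w)\<^sup>2) * ennreal ((S w)\<^sup>2) \<partial>M)
       + 2 * (\<integral>\<^sup>+w. (ennreal (?x w) * c w) * ennreal (\<tau> w) \<partial>M)"
    by (simp add: nn_integral_add nn_integral_cmult)
  also have "\<dots> \<le> 4 * (esqrt (\<integral>\<^sup>+w. (ennreal (?x w * (\<bar>V w\<bar> * ?d w)))\<^sup>2 \<partial>M) * esqrt (\<integral>\<^sup>+w. (ennreal (\<bar>V w\<bar> * ?d w))\<^sup>2 \<partial>M))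
       + 4 * ennreal (Lf\<^sup>2) * (esqrt (\<integral>\<^sup>+w. (ennreal (?x w * (\<tau> w)\<^sup>2))\<^sup>2 \<partial>M) * esqrt (\<integral>\<^sup>+w. (ennreal ((S w)\<^sup>2))\<^sup>2 \<partial>M))
       + 2 * (esqrt (\<integral>\<^sup>+w. (ennreal (?x w) * c w)\<^sup>2 \<partial>M) * esqrt (\<integral>\<^sup>+w. (ennreal (\<tau> w))\<^sup>2 \<partial>M))"
    by (intro add_mono mult_left_mono nn_integral_mult_le_esqrt) auto
  also have "\<dots> \<le> 4 * (esqrt (\<integral>\<^sup>+w. ennreal (exp (6 * Lf * max (\<tau> w) (\<tau>h w)) * (V w)\<^sup>2 * \<bar>\<tau> w - \<tau>h w\<bar>\<^sup>2) \<partial>M)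
           * esqrt (\<integral>\<^sup>+w. ennreal ((V w)\<^sup>2 * (\<tau> w - \<tau>h w)\<^sup>2) \<partial>M))
     + 4 * ennreal (Lf\<^sup>2) * (esqrt (\<integral>\<^sup>+w. ennreal (exp (6 * Lf * \<tau>h w) * \<tau> w ^ 4) \<partial>M) * esqrt (\<integral>\<^sup>+w. ennreal (S w ^ 4) \<partial>M))
     + 2 * (esqrt (\<integral>\<^sup>+w. ennreal (exp (6 * Lf * max (\<tau> w) (\<tau>h w))) * (G w)\<^sup>2 \<partial>M) * esqrt (\<integral>\<^sup>+w. ennreal ((\<tau> w)\<^sup>2) \<partial>M))"
  proof (intro add_mono mult_left_mono mult_mono esqrt_mono nn_integral_mono_AE)
    show "AE w in M. (ennreal (?x w * (\<bar>V w\<bar> * ?d w)))\<^sup>2 \<le> ennreal (exp (6 * Lf * max (\<tau> w) (\<tau>h w)) * (V w)\<^sup>2 * \<bar>\<tau> w - \<tau>h w\<bar>\<^sup>2)"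
    proof (intro AE_I2)
      fix w
      have "(ennreal (?x w * (\<bar>V w\<bar> * ?d w)))\<^sup>2 = ennreal (exp (6 * Lf * \<tau>h w) * ((V w)\<^sup>2 * \<bar>\<tau> w - \<tau>h w\<bar>\<^sup>2))"
        by (simp add: ennreal_power power_mult_distrib x2)
      also have "\<dots> \<le> ennreal (exp (6 * Lf * max (\<tau> w) (\<tau>h w)) * ((V w)\<^sup>2 * \<bar>\<tau> w - \<tau>h w\<bar>\<^sup>2))"
        by (intro ennreal_leI mult_right_mono x2_le) auto
      finally show "(ennreal (?x w * (\<bar>V w\<bar> * ?d w)))\<^sup>2 \<le> ennreal (exp (6 * Lf * max (\<tau> w) (\<tau>h w)) * (V w)\<^sup>2 * \<bar>\<tau> w - \<tau>h w\<bar>\<^sup>2)"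
        by (simp only: mult.assoc)
    qed
    show "AE w in M. (ennreal (?x w) * c w)\<^sup>2 \<le> ennreal (exp (6 * Lf * max (\<tau> w) (\<tau>h w))) * (G w)\<^sup>2"
      using c
    proof eventually_elim
      case (elim w)
      have "(ennreal (?x w) * c w)\<^sup>2 = ennreal (exp (6 * Lf * \<tau>h w)) * (c w)\<^sup>2"
        by (simp add: power_mult_distrib ennreal_power x2)
      also have "\<dots> \<le> ennreal (exp (6 * Lf * max (\<tau> w) (\<tau>h w))) * (G w)\<^sup>2"
        using elim by (intro mult_mono power_mono ennreal_leI x2_le) auto
      finally show ?case .
    qed
    show "AE w in M. (ennreal (\<bar>V w\<bar> * ?d w))\<^sup>2 \<le> ennreal ((V w)\<^sup>2 * (\<tau> w - \<tau>h w)\<^sup>2)"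
      by (intro AE_I2) (simp add: ennreal_power power_mult_distrib)
    show "AE w in M. (ennreal (?x w * (\<tau> w)\<^sup>2))\<^sup>2 \<le> ennreal (exp (6 * Lf * \<tau>h w) * \<tau> w ^ 4)"
      by (intro AE_I2) (simp add: ennreal_power power_mult_distrib x2 power_mult[symmetric])
    show "AE w in M. (ennreal ((S w)\<^sup>2))\<^sup>2 \<le> ennreal (S w ^ 4)"
      by (intro AE_I2) (simp add: ennreal_power power_mult[symmetric])
    show "AE w in M. (ennreal (\<tau> w))\<^sup>2 \<le> ennreal ((\<tau> w)\<^sup>2)"
      using AE_space by eventually_elim (simp add: ennreal_power \<tau>)
  qed auto
  finally show ?thesis .
qed

text \<open>Path continuity of Y is read off the equation: its right-hand side depends on t through
  an indefinite integral and the continuous \<open>I\<close>, both taken at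
  \<open>min t (\<tau> w)\<close>. The increment formula is the difference of the equation at two
  times, so it uses only integrability of the driver along the path.\<close>

lemma (in brownian_space) bsde_solution_paths:
  assumes sol: "bsde_solution M d W \<tau> \<xi> f p Y Z" and \<tau>: "\<And>w. w \<in> space M \<Longrightarrow> 0 \<le> \<tau> w"
  shows "\<exists>I. is_ito_integral M \<F> d W Z I \<and> (AE w in M.
     continuous_on {0..} (\<lambda>t. Y t w) \<and> (\<forall>t\<ge>\<tau> w. Y t w = \<xi> w) \<and>
     set_integrable lborel {0..\<tau> w} (\<lambda>s. f s w (Y s w)) \<and>
     (\<forall>s t. 0 \<le> s \<longrightarrow> s \<le> t \<longrightarrow> (LINT r:{min s (\<tau> w)..min t (\<tau> w)}|lborel. f r w (Y r w))
        = Y s w - Y t w + (I (min t (\<tau> w)) w - I (min s (\<tau> w)) w)))"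
proof -
  obtain I where I: "is_ito_integral M \<F> d W Z I" and AE1: "AE w in M. set_integrable lborel {0..\<tau> w} (\<lambda>s. f s w (Y s w)) \<and>
           (\<forall>t\<ge>0. Y t w = \<xi> w + (LINT s:{min t (\<tau> w)..\<tau> w}|lborel. f s w (Y s w))
              - (I (\<tau> w) w - I (min t (\<tau> w)) w))"
    using sol unfolding bsde_solution_def Let_def by blast
  have AE2: "AE w in M. continuous_on {0..} (\<lambda>t. I t w)" using I by (simp add: is_ito_integral_def)
  have "AE w in M. continuous_on {0..} (\<lambda>t. Y t w) \<and> (\<forall>t\<ge>\<tau> w. Y t w = \<xi> w) \<and>
     set_integrable lborel {0..\<tau> w} (\<lambda>s. f s w (Y s w)) \<and>
     (\<forall>s t. 0 \<le> s \<longrightarrow> s \<le> t \<longrightarrow> (LINT r:{min s (\<tau> w)..min t (\<tau> w)}|lborel. f r w (Y r w))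
        = Y s w - Y t w + (I (min t (\<tau> w)) w - I (min s (\<tau> w)) w))"
    using AE1 AE2 AE_space
  proof eventually_elim
    case (elim w)
    let ?f = "\<lambda>s. f s w (Y s w)" and ?T = "\<tau> w"
    have T: "0 \<le> ?T" by (rule \<tau>[OF elim(3)])
    have Yt: "Y t w = \<xi> w + (LINT s:{min t ?T..?T}|lborel. ?f s) - (I ?T w - I (min t ?T) w)" if "0 \<le> t" for t
      using elim(1) that by blast
    have si: "set_integrable lborel {a..b} ?f" if "0 \<le> a" "b \<le> ?T" for a b
      using that by (intro set_integrable_subset[OF conjunct1[OF elim(1)]]) auto
    \<comment> \<open>The Lebesgue integral is identified with the gauge integral, for which
      continuity in the end point and additivity over adjacent intervals are applied below.\<close>
    have eqi: "(LINT s:{a..b}|lborel. ?f s) = integral {a..b} ?f" "?f integrable_on {a..b}" if "0 \<le> a" "b \<le> ?T" for a b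
      using set_borel_integral_eq_integral[OF si[OF that]] by auto
    have Yt': "Y t w = \<xi> w + integral {min t ?T..?T} ?f - (I ?T w - I (min t ?T) w)" if "0 \<le> t" for t
      using Yt[OF that] eqi(1)[of "min t ?T" ?T] that T by simp
    have mt: "(\<lambda>t. min t ?T) \<in> {0..} \<rightarrow> {0..?T}" using T by auto
    have "continuous_on {0..} (\<lambda>t. \<xi> w + integral {min t ?T..?T} ?f - (I ?T w - I (min t ?T) w))"
    proof (intro continuous_intros)
      show "continuous_on {0..} (\<lambda>t. integral {min t ?T..?T} ?f)"
        by (rule continuous_on_compose2[OF indefinite_integral_continuous_1'[OF eqi(2)[of 0 ?T]], where f = "\<lambda>t. min t ?T"])
          (use mt in \<open>auto intro!: continuous_intros\<close>)
      show "continuous_on {0..} (\<lambda>t. I (min t ?T) w)"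
        by (rule continuous_on_compose2[OF elim(2), where f = "\<lambda>t. min t ?T"])
          (use T in \<open>auto intro!: continuous_intros\<close>)
    qed
    then have cont: "continuous_on {0..} (\<lambda>t. Y t w)"
      by (rule continuous_on_cong[THEN iffD1, rotated -1]) (auto simp: Yt')
    have const: "\<forall>t\<ge>?T. Y t w = \<xi> w"
      using Yt' T by (auto simp: min_absorb2)
    have "(LINT r:{min s ?T..min t ?T}|lborel. ?f r) = Y s w - Y t w + (I (min t ?T) w - I (min s ?T) w)"
      if st: "0 \<le> s" "s \<le> t" for s t
    proof -
      have "integral {min s ?T..min t ?T} ?f + integral {min t ?T..?T} ?f = integral {min s ?T..?T} ?f"
        using st T by (intro Henstock_Kurzweil_Integration.integral_combine eqi(2)) auto
      then show ?thesis
        using Yt'[of s] Yt'[of t] eqi(1)[of "min s ?T" "min t ?T"] st T by simp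
    qed
    then show ?case using cont const elim(1) by blast
  qed
  then show ?thesis using I by blast
qed

section \<open>Uniform bounds and the main estimate\<close>

lemma (in finite_measure) integrable_power_le:
  fixes X :: "'a \<Rightarrow> real"
  assumes [measurable]: "X \<in> borel_measurable M" and "(\<integral>\<^sup>+w. ennreal (\<bar>X w\<bar> ^ m) \<partial>M) < \<infinity>" "k \<le> m"
  shows "integrable M (\<lambda>w. X w ^ k)"
proof (rule Bochner_Integration.integrable_bound)
  have "integrable M (\<lambda>w. \<bar>X w\<bar> ^ m)" using assms by (intro integrableI_nonneg) auto
  then show "integrable M (\<lambda>w. 1 + \<bar>X w\<bar> ^ m)" by simp
  show "AE w in M. norm (X w ^ k) \<le> norm (1 + \<bar>X w\<bar> ^ m)"
  proof (intro AE_I2)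
    fix w
    have "\<bar>X w\<bar> ^ k \<le> 1 + \<bar>X w\<bar> ^ m"
    proof (cases "\<bar>X w\<bar> \<le> 1")
      case True
      then have "\<bar>X w\<bar> ^ k \<le> 1" by (intro power_le_one) auto
      then show ?thesis by (simp add: add_increasing2)
    next
      case False
      then have "\<bar>X w\<bar> ^ k \<le> \<bar>X w\<bar> ^ m" using assms by (intro power_increasing) auto
      then show ?thesis by simp
    qed
    then show "norm (X w ^ k) \<le> norm (1 + \<bar>X w\<bar> ^ m)" by (simp add: power_abs)
  qed
qed simp

text \<open>The supremum over rational times is countable, hence measurable, and continuity of the
  paths extends its bound to all times.\<close>

lemma (in prob_space) ex_sup_process:
  fixes Y :: "real \<Rightarrow> 'a \<Rightarrow> real"
  assumes Y[measurable]: "\<And>t. 0 \<le> t \<Longrightarrow> Y t \<in> borel_measurable M"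
    and cont: "AE w in M. continuous_on {0..} (\<lambda>t. Y t w)"
    and fin: "(\<integral>\<^sup>+w. (SUP t\<in>{0..}. ennreal (\<bar>Y t w\<bar> ^ m)) \<partial>M) < \<infinity>" and k: "0 < m" "k \<le> m"
  shows "\<exists>S\<in>borel_measurable M. (\<forall>w. 0 \<le> S w) \<and> integrable M (\<lambda>w. S w ^ k) \<and>
    (AE w in M. \<forall>t\<ge>0. \<bar>Y t w\<bar> \<le> S w)"
proof -
  define G where "G w = (SUP t\<in>\<rat> \<inter> {0..}. ennreal (\<bar>Y t w\<bar> ^ m))" for w
  have [measurable]: "G \<in> borel_measurable M" unfolding G_def[abs_def]
    by (intro borel_measurable_SUP) (auto simp: countable_rat intro: countable_subset[OF _ countable_rat])
  have "(\<integral>\<^sup>+w. G w \<partial>M) \<le> (\<integral>\<^sup>+w. (SUP t\<in>{0..}. ennreal (\<bar>Y t w\<bar> ^ m)) \<partial>M)"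
    unfolding G_def by (intro nn_integral_mono SUP_subset_mono) auto
  then have G_fin: "(\<integral>\<^sup>+w. G w \<partial>M) < \<infinity>" using fin by (rule le_less_trans)
  then have G_AE: "AE w in M. G w \<noteq> \<infinity>" by (intro nn_integral_PInf_AE) auto
  define S where "S w = root m (enn2real (G w))" for w
  have [measurable]: "S \<in> borel_measurable M" unfolding S_def[abs_def] by measurable
  have S0: "0 \<le> S w" for w using k by (simp add: S_def)
  have "(\<integral>\<^sup>+w. ennreal (\<bar>S w\<bar> ^ m) \<partial>M) \<le> (\<integral>\<^sup>+w. G w \<partial>M)"
  proof (rule nn_integral_mono_AE, use G_AE in eventually_elim)
    case (elim w)
    then show ?case using S0[of w] k by (simp add: S_def less_top)
  qed
  then have "integrable M (\<lambda>w. S w ^ k)"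
    using G_fin k by (intro integrable_power_le[where m = m]) auto
  moreover have "AE w in M. \<forall>t\<ge>0. \<bar>Y t w\<bar> \<le> S w"
    using G_AE cont
  proof eventually_elim
    case (elim w)
    have rat: "\<bar>Y t w\<bar> \<le> S w" if "t \<in> \<rat>" "0 \<le> t" for t
    proof -
      have "ennreal (\<bar>Y t w\<bar> ^ m) \<le> G w" unfolding G_def using that by (intro SUP_upper) auto
      then have "\<bar>Y t w\<bar> ^ m \<le> enn2real (G w)" using elim(1) by (cases "G w") auto
      then have "root m (\<bar>Y t w\<bar> ^ m) \<le> S w" unfolding S_def using k by (intro real_root_le_mono)
      then show ?thesis using k by (simp add: real_root_power_cancel)
    qed
    show ?case
    proof (intro allI impI)
      fix t :: real assume t: "0 \<le> t"
      \<comment> \<open>Rational approximation from the right, so that \<open>q n\<close> stays in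
        the domain {0..} even for t = 0.\<close>
      define q where "q n = of_int \<lceil>t * real (Suc n)\<rceil> / real (Suc n)" for n
      have q: "q n \<in> \<rat>" "0 \<le> q n" "t \<le> q n" "q n \<le> t + 1 / real (Suc n)" for n
      proof -
        show "q n \<in> \<rat>" by (simp add: q_def)
        have "of_int \<lceil>t * real (Suc n)\<rceil> \<ge> t * real (Suc n)" "of_int \<lceil>t * real (Suc n)\<rceil> \<le> t * real (Suc n) + 1"
          by linarith+
        then have "t * real (Suc n) / real (Suc n) \<le> q n" "q n \<le> (t * real (Suc n) + 1) / real (Suc n)"
          unfolding q_def by (intro divide_right_mono; simp)+
        then show "t \<le> q n" "q n \<le> t + 1 / real (Suc n)" by (simp_all add: add_divide_distrib)
        then show "0 \<le> q n" using t by simp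
      qed
      have lim: "(\<lambda>n. t + 1 / real (Suc n)) \<longlonglongrightarrow> t + 0"
        by (intro tendsto_add tendsto_const LIMSEQ_Suc lim_1_over_n)
      have "q \<longlonglongrightarrow> t"
      proof (rule tendsto_sandwich[where f = "\<lambda>_. t" and h = "\<lambda>n. t + 1 / real (Suc n)"])
        show "(\<lambda>n. t + 1 / real (Suc n)) \<longlonglongrightarrow> t" using lim by simp
        show "\<forall>\<^sub>F n in sequentially. t \<le> q n" by (rule always_eventually) (simp add: q(3))
        show "\<forall>\<^sub>F n in sequentially. q n \<le> t + 1 / real (Suc n)" by (rule always_eventually) (use q(4) in blast)
      qed (rule tendsto_const)
      then have "(\<lambda>n. Y (q n) w) \<longlonglongrightarrow> Y t w"
        using q t by (intro continuous_on_tendsto_compose[OF elim(2)]) auto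
      then have "(\<lambda>n. \<bar>Y (q n) w\<bar>) \<longlonglongrightarrow> \<bar>Y t w\<bar>" by (rule tendsto_rabs)
      then show "\<bar>Y t w\<bar> \<le> S w" by (rule LIMSEQ_le_const2) (use rat q in auto)
    qed
  qed
  ultimately show ?thesis using S0 by (intro bexI[of _ S]) auto
qed

text \<open>\<open>V\<close> has to be independent of h, while the supremum over h is uncountable;
  it is therefore built from an essential supremum. This is why the bound holds almost surely for
  each h separately.\<close>

lemma (in prob_space) ex_uniform_grid_bound:
  fixes g :: "real \<Rightarrow> nat \<Rightarrow> 'a \<Rightarrow> real" and \<sigma> :: "real \<Rightarrow> 'a \<Rightarrow> real"
  assumes g[measurable]: "\<And>h n. h \<in> H \<Longrightarrow> g h n \<in> borel_measurable M"
    and \<sigma>[measurable]: "\<And>h. h \<in> H \<Longrightarrow> \<sigma> h \<in> borel_measurable M"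
    and p: "4 \<le> p"
    and fin: "(\<integral>\<^sup>+w. (SUP h\<in>H. SUP n\<in>{n. real n * h \<le> \<sigma> h w}. ennreal (\<bar>g h n w\<bar> powr p)) \<partial>M) < \<infinity>"
  shows "\<exists>V\<in>borel_measurable M. (\<forall>w. 0 \<le> V w) \<and> integrable M (\<lambda>w. V w ^ 4) \<and>
    (\<forall>h\<in>H. AE w in M. \<forall>n. real n * h \<le> \<sigma> h w \<longrightarrow> \<bar>g h n w\<bar> \<le> V w)"
proof -
  \<comment> \<open>The random index set is encoded by an indicator, which leaves a countable
    supremum and hence measurability for each h.\<close>
  let ?s = "\<lambda>h w. SUP n. indicator {w. real n * h \<le> \<sigma> h w} w * ennreal (\<bar>g h n w\<bar> powr p)"
  have "?s h w \<le> (SUP n\<in>{n. real n * h \<le> \<sigma> h w}. ennreal (\<bar>g h n w\<bar> powr p))" for h w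
    by (rule SUP_least) (auto simp: indicator_def intro: SUP_upper)
  then have "(\<integral>\<^sup>+w. (SUP h\<in>H. ?s h w) \<partial>M) \<le> (\<integral>\<^sup>+w. (SUP h\<in>H. SUP n\<in>{n. real n * h \<le> \<sigma> h w}. ennreal (\<bar>g h n w\<bar> powr p)) \<partial>M)"
    by (intro nn_integral_mono SUP_mono') auto
  then have "(\<integral>\<^sup>+w. (SUP h\<in>H. ?s h w) \<partial>M) < \<infinity>" using fin by (rule le_less_trans)
  then obtain G where [measurable]: "G \<in> borel_measurable M" and G_fin: "(\<integral>\<^sup>+w. G w \<partial>M) < \<infinity>"
    and G: "\<And>h. h \<in> H \<Longrightarrow> AE w in M. ?s h w \<le> G w"
    using ex_countable_essential_sup[of H ?s M] by auto
  have G_AE: "AE w in M. G w \<noteq> \<infinity>" using G_fin by (intro nn_integral_PInf_AE) auto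
  define V where "V w = enn2real (G w) powr (1 / p)" for w
  have [measurable]: "V \<in> borel_measurable M" unfolding V_def[abs_def] by measurable
  have "integrable M (\<lambda>w. V w ^ 4)"
  proof (rule integrableI_bounded)
    have "(\<integral>\<^sup>+w. ennreal (norm (V w ^ 4)) \<partial>M) \<le> (\<integral>\<^sup>+w. 1 + G w \<partial>M)"
    proof (rule nn_integral_mono_AE, use G_AE in eventually_elim)
      case (elim w)
      let ?x = "enn2real (G w)"
      \<comment> \<open>Because 4 / p \<le> 1, this power of \<open>?x\<close> is dominated by 1 +
        \<open>?x\<close>.\<close>
      have "V w ^ 4 = ?x powr (4 / p)"
        using p powr_powr[of ?x "1 / p" 4] by (cases "?x = 0") (simp_all add: V_def)
      also have "\<dots> \<le> 1 + ?x"
      proof (cases "?x \<le> 1")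
        case True
        then have "?x powr (4 / p) \<le> 1" using p by (intro powr_le1) auto
        then show ?thesis by (simp add: add_increasing2)
      next
        case False
        then have "?x powr (4 / p) \<le> ?x powr 1" using p by (intro powr_mono) auto
        then show ?thesis by simp
      qed
      finally have "ennreal (V w ^ 4) \<le> ennreal (1 + ?x)" by (rule ennreal_leI)
      also have "\<dots> = 1 + G w" using elim by (simp add: less_top)
      finally show ?case by (simp add: V_def)
    qed
    also have "\<dots> < \<infinity>" using G_fin by (simp add: nn_integral_add emeasure_space_1)
    finally show "(\<integral>\<^sup>+w. ennreal (norm (V w ^ 4)) \<partial>M) < \<infinity>" .
  qed measurable
  moreover have "AE w in M. \<forall>n. real n * h \<le> \<sigma> h w \<longrightarrow> \<bar>g h n w\<bar> \<le> V w" if h: "h \<in> H" for h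
    using G[OF h] G_AE
  proof eventually_elim
    case (elim w)
    show ?case
    proof (intro allI impI)
      fix n assume n: "real n * h \<le> \<sigma> h w"
      have "ennreal (\<bar>g h n w\<bar> powr p) = indicator {w. real n * h \<le> \<sigma> h w} w * ennreal (\<bar>g h n w\<bar> powr p)" using n by simp
      also have "\<dots> \<le> ?s h w" by (rule SUP_upper) simp
      also have "\<dots> \<le> G w" by (rule elim(1))
      finally have "\<bar>g h n w\<bar> powr p \<le> enn2real (G w)" using elim(2) by (cases "G w") auto
      then have "(\<bar>g h n w\<bar> powr p) powr (1 / p) \<le> V w" unfolding V_def using p by (intro powr_mono2) auto
      then show "\<bar>g h n w\<bar> \<le> V w" using p by (simp add: powr_powr)
    qed
  qed
  ultimately show ?thesis by (intro bexI[of _ V]) (auto simp: V_def)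
qed

lemma mult_powers_le: "(x::real)\<^sup>2 * y\<^sup>2 \<le> x ^ 4 + y ^ 4"
proof -
  have "2 * (x\<^sup>2 * y\<^sup>2) \<le> x ^ 4 + y ^ 4"
    using sum_squares_bound[of "x\<^sup>2" "y\<^sup>2"] by (simp add: power_mult[symmetric] mult.assoc)
  moreover have "0 \<le> x\<^sup>2 * y\<^sup>2" by simp
  ultimately show ?thesis by linarith
qed

lemma add_power4_le: "((x::real) + y) ^ 4 \<le> 8 * x ^ 4 + 8 * y ^ 4"
proof -
  have sq: "((a::real) + b)\<^sup>2 \<le> 2 * a\<^sup>2 + 2 * b\<^sup>2" for a b using power2_diff_le[of a "- b"] by simp
  have "((x + y)\<^sup>2)\<^sup>2 \<le> (2 * x\<^sup>2 + 2 * y\<^sup>2)\<^sup>2" by (intro power_mono sq) simp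
  also have "\<dots> \<le> 2 * (2 * x\<^sup>2)\<^sup>2 + 2 * (2 * y\<^sup>2)\<^sup>2" by (rule sq)
  finally show ?thesis by (simp add: power_mult_distrib power_mult[symmetric])
qed

section \<open>Choice of the constants and assembly of the estimate\<close>

theorem mainTheorem6:
  fixes M :: "'a measure" and d :: nat
    and W :: "nat \<Rightarrow> real \<Rightarrow> 'a \<Rightarrow> real"
    and \<tau> :: "'a \<Rightarrow> real" and \<xi> :: "'a \<Rightarrow> real"
    and f :: "real \<Rightarrow> 'a \<Rightarrow> real \<Rightarrow> real" and Lf :: real
    and h0 :: real and \<alpha> :: real
    and \<tau>h :: "real \<Rightarrow> 'a \<Rightarrow> real" and \<xi>b :: "real \<Rightarrow> 'a \<Rightarrow> real"
    and fh :: "real \<Rightarrow> nat \<Rightarrow> 'a \<Rightarrow> real \<Rightarrow> real"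
    and Y :: "real \<Rightarrow> 'a \<Rightarrow> real" and Z :: "nat \<Rightarrow> real \<Rightarrow> 'a \<Rightarrow> real"
  defines "F \<equiv> bm_filtration M d W"
  assumes prob: "prob_space M" and d_pos: "1 \<le> d"
    and bm: "brownian_motion M d W"
    and tau_st: "is_stopping_time M F \<tau>"
    and tau_exp: "\<exists>m>0. integrable M (\<lambda>w. exp (m * \<tau> w))"
    and xi_meas: "\<xi> \<in> borel_measurable (stopped_sigma M F (bm_filtration_inf M d W) \<tau>)"
    and xi_L8: "integrable M (\<lambda>w. \<bar>\<xi> w\<bar> ^ 8)"
    and Lf_pos: "Lf > 0"
    and f_lip: "\<forall>s w x y. \<bar>f s w x - f s w y\<bar> \<le> Lf * \<bar>x - y\<bar>"
    and sol: "bsde_solution M d W \<tau> \<xi> f 8 Y Z"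
    \<comment> \<open>(h)\<close>
    and h0: "0 < h0" "h0 < min Lf (1 / (12 * Lf))"
    \<comment> \<open>the discretization data\<close>
    and tauh_st: "\<forall>h\<in>{0<..h0}. is_stopping_time M F (\<tau>h h)"
    and tauh_grid: "\<forall>h\<in>{0<..h0}. \<forall>w\<in>space M. \<exists>n::nat. \<tau>h h w = real n * h"
    \<comment> \<open>(R-q) with q = 8\<close>
    and Rq: "\<exists>\<rho>>4 * 8 * Lf. integrable M (\<lambda>w. exp (\<rho> * \<tau> w)) \<and>
               (\<integral>\<^sup>+ w. (SUP h\<in>{0<..h0}. ennreal (exp (\<rho> * \<tau>h h w))) \<partial>M) < \<infinity>"
    \<comment> \<open>(pi-F) with some p > 16\<close>
    and piF_lip: "\<forall>h\<in>{0<..h0}. \<forall>n w x y. \<bar>fh h n w x - fh h n w y\<bar> \<le> Lf * \<bar>x - y\<bar>"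
    and piF_meas: "\<forall>h\<in>{0<..h0}. \<forall>n A. A \<in> borel_measurable (F (real n * h)) \<longrightarrow>
                     (\<lambda>w. fh h n w (A w)) \<in> borel_measurable (F (real n * h))"
    and piF_int: "\<exists>p>16. (\<integral>\<^sup>+ w. (SUP h\<in>{0<..h0}. SUP n\<in>{n. real n * h \<le> max (\<tau> w) (\<tau>h h w)}.
                     ennreal (\<bar>fh h n w 0\<bar> powr p)) \<partial>M) < \<infinity>"
    \<comment> \<open>(pi-T) with p = 16\<close>
    and piT_meas: "\<forall>h\<in>{0<..h0}. \<xi>b h \<in> borel_measurable (stopped_sigma M F (bm_filtration_inf M d W) (\<tau>h h))"
    and piT_int: "(\<integral>\<^sup>+ w. (SUP h\<in>{0<..h0}. ennreal (\<bar>\<xi>b h w\<bar> ^ 16)) \<partial>M) < \<infinity>"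
    \<comment> \<open>Hoelder regularity of Y\<close>
    and alpha_pos: "\<alpha> > 0"
    and holder: "\<forall>p\<ge>2. \<exists>Cp>0. \<forall>s\<ge>0. \<forall>t\<ge>0. \<bar>s - t\<bar> \<le> 1 \<longrightarrow>
                   (\<integral>\<^sup>+ w. ennreal (\<bar>Y s w - Y t w\<bar> powr p) \<partial>M) \<le> ennreal (Cp * \<bar>s - t\<bar> powr (\<alpha> * p))"
  shows "(\<exists>V. V \<in> borel_measurable M \<and> integrable M (\<lambda>w. (V w) ^ 4) \<and>
      (\<forall>\<epsilon>>0. \<exists>C>0. \<forall>h\<in>{0<..h0}. \<forall>R. scheme_fixed_point M F Lf h (\<tau>h h) (\<xi>b h) (fh h) R \<longrightarrow>
         (\<integral>\<^sup>+ w. (SUP n. SUP t\<in>{real n * h .. real n * h + h}.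
              ennreal ((Y t w - scheme_value h (\<tau>h h) (\<xi>b h) R n w)\<^sup>2)) \<partial>M)
         \<le> ennreal (C * h powr (2 * (\<alpha> - \<epsilon>))) + ennreal (C * h)
           + ennreal C * esqrt (\<integral>\<^sup>+ w. ennreal (exp (6 * Lf * max (\<tau> w) (\<tau>h h w))
                                  * \<bar>\<xi> w - \<xi>b h w\<bar> ^ 4) \<partial>M)
           + ennreal C * esqrt (\<integral>\<^sup>+ w. ennreal (exp (6 * Lf * max (\<tau> w) (\<tau>h h w))
                                  * (V w)\<^sup>2 * \<bar>\<tau> w - \<tau>h h w\<bar>\<^sup>2) \<partial>M)
           + ennreal C * esqrt (\<integral>\<^sup>+ w. ennreal (exp (6 * Lf * max (\<tau> w) (\<tau>h h w)))
                 * (\<integral>\<^sup>+ s\<in>{0..\<tau> w}.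
                      ennreal ((f s w (Y s w) - fh h (nat \<lfloor>s / h\<rfloor>) w (Y s w))\<^sup>2) \<partial>lborel) ^ 2 \<partial>M)))"
proof -
  interpret prob_space M by (rule prob)
  interpret brownian_space M d W by unfold_locales (rule bm)
  note F_eq = F_def
  have \<tau>: "is_stopping_time M \<F> \<tau>" using tau_st by (simp add: F_eq)
  have \<tau>0: "0 \<le> \<tau> w" if "w \<in> space M" for w using \<tau> that by (simp add: is_stopping_time_def)
  have \<tau>_meas[measurable]: "\<tau> \<in> borel_measurable M" by (rule stopping_time_measurable[OF \<tau>])
  have \<xi>_meas[measurable]: "\<xi> \<in> borel_measurable M"
    using xi_meas stopped_sigma_subset unfolding F_eq by (auto simp: measurable_def space_stopped_sigma)
  have YF: "Y t \<in> borel_measurable (\<F> t)" if "0 \<le> t" for t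
    using sol that by (simp add: bsde_solution_def Let_def)
  have Y_meas: "Y t \<in> borel_measurable M" if "0 \<le> t" for t
    using YF[OF that] by (rule measurable_bm_filtrationD)
  obtain I where I: "is_ito_integral M \<F> d W Z I" and path: "AE w in M.
     continuous_on {0..} (\<lambda>t. Y t w) \<and> (\<forall>t\<ge>\<tau> w. Y t w = \<xi> w) \<and>
     set_integrable lborel {0..\<tau> w} (\<lambda>s. f s w (Y s w)) \<and>
     (\<forall>s t. 0 \<le> s \<longrightarrow> s \<le> t \<longrightarrow> (LINT r:{min s (\<tau> w)..min t (\<tau> w)}|lborel. f r w (Y r w))
        = Y s w - Y t w + (I (min t (\<tau> w)) w - I (min s (\<tau> w)) w))"
    using bsde_solution_paths[OF sol \<tau>0] by blast
  have cont: "AE w in M. continuous_on {0..} (\<lambda>t. Y t w)"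
    and const: "AE w in M. \<forall>t\<ge>\<tau> w. Y t w = \<xi> w"
    using path by (auto elim: eventually_mono)
  have "(\<integral>\<^sup>+w. (SUP t\<in>{0..}. ennreal (\<bar>Y t w\<bar> ^ 8)) \<partial>M) < \<infinity>"
    using sol by (simp add: bsde_solution_def Let_def)
  from ex_sup_process[OF Y_meas cont this, of 4]
  obtain S where S_meas[measurable]: "S \<in> borel_measurable M" and S0: "\<And>w. 0 \<le> S w"
    and S4: "integrable M (\<lambda>w. S w ^ 4)" and YS: "AE w in M. \<forall>t\<ge>0. \<bar>Y t w\<bar> \<le> S w" by auto
  have S2: "integrable M (\<lambda>w. (S w)\<^sup>2)"
    using S4 S0 by (intro integrable_power_le[where m = 4]) (auto simp: nn_integral_eq_integral)
  have Y2: "integrable M (\<lambda>w. (Y t w)\<^sup>2)" if t: "0 \<le> t" for t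
  proof (rule Bochner_Integration.integrable_bound[OF S2])
    show "(\<lambda>w. (Y t w)\<^sup>2) \<in> borel_measurable M" using Y_meas[OF t] by measurable
    show "AE w in M. norm ((Y t w)\<^sup>2) \<le> norm ((S w)\<^sup>2)"
      using YS by eventually_elim (use t S0 in \<open>auto simp: abs_le_square_iff[symmetric]\<close>)
  qed
  have \<tau>h: "is_stopping_time M \<F> (\<tau>h h)" if "h \<in> {0<..h0}" for h using tauh_st that by (simp add: F_eq)
  have \<tau>h_meas: "\<tau>h h \<in> borel_measurable M" if "h \<in> {0<..h0}" for h
    by (rule stopping_time_measurable[OF \<tau>h[OF that]])
  have fhF: "(\<lambda>w. fh h n w (A w)) \<in> borel_measurable (\<F> (real n * h))"
    if "h \<in> {0<..h0}" "A \<in> borel_measurable (\<F> (real n * h))" for h n A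
    using piF_meas that by (simp add: F_eq)
  obtain p where p: "16 < p" and p_fin: "(\<integral>\<^sup>+ w. (SUP h\<in>{0<..h0}. SUP n\<in>{n. real n * h \<le> max (\<tau> w) (\<tau>h h w)}.
                     ennreal (\<bar>fh h n w 0\<bar> powr p)) \<partial>M) < \<infinity>" using piF_int by blast
  have "\<exists>V\<in>borel_measurable M. (\<forall>w. 0 \<le> V w) \<and> integrable M (\<lambda>w. V w ^ 4) \<and>
    (\<forall>h\<in>{0<..h0}. AE w in M. \<forall>n. real n * h \<le> max (\<tau> w) (\<tau>h h w) \<longrightarrow> \<bar>fh h n w 0\<bar> \<le> V w)"
  proof (rule ex_uniform_grid_bound[OF _ _ _ p_fin])
    show "(\<lambda>w. fh h n w 0) \<in> borel_measurable M" if "h \<in> {0<..h0}" for h n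
      using fhF[OF that, of "\<lambda>_. 0" n] by (rule measurable_bm_filtrationD) simp
    show "(\<lambda>w. max (\<tau> w) (\<tau>h h w)) \<in> borel_measurable M" if "h \<in> {0<..h0}" for h
      using \<tau>h_meas[OF that] by measurable
  qed (use p in simp)
  then obtain Vf where Vf_meas[measurable]: "Vf \<in> borel_measurable M" and Vf0: "\<And>w. 0 \<le> Vf w"
    and Vf4: "integrable M (\<lambda>w. Vf w ^ 4)"
    and Vf: "\<And>h. h \<in> {0<..h0} \<Longrightarrow> AE w in M. \<forall>n. real n * h \<le> max (\<tau> w) (\<tau>h h w) \<longrightarrow> \<bar>fh h n w 0\<bar> \<le> Vf w"
    by blast
  \<comment> \<open>Bounds the driver at Y on the relevant grid points of every step size: its value
    at 0 plus the Lipschitz constant times the bound on Y.\<close>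
  define V where "V w = Vf w + Lf * S w" for w
  have V_meas[measurable]: "V \<in> borel_measurable M" unfolding V_def[abs_def] by measurable
  have V4: "integrable M (\<lambda>w. V w ^ 4)"
  proof (rule Bochner_Integration.integrable_bound)
    show "integrable M (\<lambda>w. 8 * Vf w ^ 4 + 8 * (Lf ^ 4 * S w ^ 4))" using Vf4 S4 by simp
    show "AE w in M. norm (V w ^ 4) \<le> norm (8 * Vf w ^ 4 + 8 * (Lf ^ 4 * S w ^ 4))"
      using add_power4_le[of "Vf _" "Lf * S _"]
      by (intro AE_I2) (simp add: V_def power_mult_distrib Vf0 S0 Lf_pos less_imp_le)
  qed simp
  obtain \<rho> where \<rho>: "32 * Lf < \<rho>" and exp_\<tau>: "integrable M (\<lambda>w. exp (\<rho> * \<tau> w))"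
    and exp_\<tau>h: "(\<integral>\<^sup>+ w. (SUP h\<in>{0<..h0}. ennreal (exp (\<rho> * \<tau>h h w))) \<partial>M) < \<infinity>" using Rq by auto
  have \<rho>0: "0 < \<rho>" using \<rho> Lf_pos by linarith
  define k0 where "k0 = enn2real (\<integral>\<^sup>+ w. (SUP h\<in>{0<..h0}. ennreal (exp (\<rho> * \<tau>h h w))) \<partial>M)"
  define kt where "kt = (\<integral>w. exp (\<rho> * \<tau> w) \<partial>M)"
  have k0: "0 \<le> k0" and kt: "0 \<le> kt" by (auto simp: k0_def kt_def)
  have nn_\<tau>h: "(\<integral>\<^sup>+ w. ennreal (exp (\<rho> * \<tau>h h w)) \<partial>M) \<le> ennreal k0" if "h \<in> {0<..h0}" for h
  proof -
    have "(\<integral>\<^sup>+ w. ennreal (exp (\<rho> * \<tau>h h w)) \<partial>M) \<le> (\<integral>\<^sup>+ w. (SUP h\<in>{0<..h0}. ennreal (exp (\<rho> * \<tau>h h w))) \<partial>M)"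
      using that by (intro nn_integral_mono SUP_upper)
    also have "\<dots> = ennreal k0" using exp_\<tau>h by (simp add: k0_def)
    finally show ?thesis .
  qed
  have nn_\<tau>: "(\<integral>\<^sup>+ w. ennreal (exp (\<rho> * \<tau> w)) \<partial>M) = ennreal kt"
    unfolding kt_def using exp_\<tau> by (intro nn_integral_eq_integral) auto
  define v4 where "v4 = (\<integral>w. V w ^ 4 \<partial>M)"
  have v4: "0 \<le> v4" by (auto simp: v4_def)
  define c where "c j = (real j / \<rho>) ^ j" for j :: nat
  have c0: "0 \<le> c j" for j using \<rho>0 by (simp add: c_def)
  have c: "x ^ j \<le> c j * exp (\<rho> * x)" if "0 \<le> x" "0 < j" for x j
    unfolding c_def using that \<rho>0 by (intro power_le_exp)
  \<comment> \<open>\<open>k1\<close>, \<open>k2\<close> and \<open>k3\<close> bound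
    E[V^2 (\<tau> - \<tau>h)^2], E[exp(6 L_f \<tau>h) \<tau>^4] and E[\<tau>^2] uniformly in h;
    these are the factors left over by \<open>local_error_moment_le\<close>. Powers of the stopping
    times are traded for exponential moments of rate \<rho> by means of \<open>c\<close>.\<close>
  define k1 where "k1 = v4 + c 4 * kt + c 4 * k0"
  define k2 where "k2 = k0 + c 8 * kt"
  define k3 where "k3 = c 2 * kt"
  have kk: "0 \<le> k1" "0 \<le> k2" "0 \<le> k3" using k0 kt v4 c0 by (auto simp: k1_def k2_def k3_def)
  \<comment> \<open>If L_f \<le> 1 then h_0 < L_f gives h_0 \<le> 1; otherwise h_0 \<le> L_f h_0
    \<le> 1/12. The bound by 1 puts each cell in the range of the Hoelder estimate.\<close>
  have h0_le: "h0 \<le> 1" "12 * Lf * h0 \<le> 1"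
  proof -
    have "h0 < 1 / (12 * Lf)" "h0 < Lf" using h0 by auto
    then show *: "12 * Lf * h0 \<le> 1" using Lf_pos by (simp add: field_simps)
    show "h0 \<le> 1"
    proof (cases "Lf \<le> 1")
      case False
      then have "h0 \<le> Lf * h0" using h0 by simp
      moreover have "12 * (Lf * h0) \<le> 1" using * by simp
      ultimately show ?thesis using h0(1) by linarith
    qed (use \<open>h0 < Lf\<close> in simp)
  qed
  show ?thesis
  proof (intro exI[of _ V] conjI allI impI)
    show "V \<in> borel_measurable M" "integrable M (\<lambda>w. V w ^ 4)" by (rule V_meas, rule V4)
    fix \<epsilon> :: real assume \<epsilon>: "0 < \<epsilon>"
    obtain m where m: "0 < m" "integrable M (\<lambda>w. exp (m * \<tau> w))" using tau_exp by blast
    from expectation_sup_increments[OF Y_meas cont const \<tau>_meas m alpha_pos _ \<epsilon>] holder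
    obtain Co where Co: "0 < Co" and O: "\<And>h. h \<in> {0<..1} \<Longrightarrow> \<exists>Os\<in>borel_measurable M. (\<forall>w. 0 \<le> Os w) \<and>
       (AE w in M. \<forall>n::nat. \<forall>t\<in>{real n * h..real n * h + h}. \<bar>Y t w - Y (real n * h) w\<bar> \<le> Os w) \<and>
       (\<integral>\<^sup>+w. ennreal (Os w ^ 4) \<partial>M) \<le> ennreal (Co * h powr (4 * (\<alpha> - \<epsilon>)))" by blast
    \<comment> \<open>The 2 stems from separating the oscillation of Y from the grid error; 64 = 2 *
      8 * 4 collects this 2, the 8 of the scheme bound and the 4 of the local error.\<close>
    define C1 where "C1 = (2 + 64 * Lf\<^sup>2 * sqrt k2) * sqrt Co"
    \<comment> \<open>The remaining coefficients are 16 = 2 * 8 for the terminal error, 64 = 2 * 8 *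
      4 for the stopping time error and 32 = 2 * 8 * 2 for the driver error. Their sum dominates
      each of them, and the 1 ensures positivity.\<close>
    define C where "C = 1 + C1 + 16 + 64 * sqrt k1 + 32 * sqrt k3"
    have C1: "0 \<le> C1" using Co kk by (simp add: C1_def)
    have C_ge: "C1 \<le> C" "16 \<le> C" "64 * sqrt k1 \<le> C" "32 * sqrt k3 \<le> C" "0 < C"
      using C1 kk by (auto simp: C_def add_increasing add_pos_nonneg)
    show "\<exists>C>0. \<forall>h\<in>{0<..h0}. \<forall>R. scheme_fixed_point M F Lf h (\<tau>h h) (\<xi>b h) (fh h) R \<longrightarrow>
         (\<integral>\<^sup>+ w. (SUP n. SUP t\<in>{real n * h .. real n * h + h}.
              ennreal ((Y t w - scheme_value h (\<tau>h h) (\<xi>b h) R n w)\<^sup>2)) \<partial>M)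
         \<le> ennreal (C * h powr (2 * (\<alpha> - \<epsilon>))) + ennreal (C * h)
           + ennreal C * esqrt (\<integral>\<^sup>+ w. ennreal (exp (6 * Lf * max (\<tau> w) (\<tau>h h w))
                                  * \<bar>\<xi> w - \<xi>b h w\<bar> ^ 4) \<partial>M)
           + ennreal C * esqrt (\<integral>\<^sup>+ w. ennreal (exp (6 * Lf * max (\<tau> w) (\<tau>h h w))
                                  * (V w)\<^sup>2 * \<bar>\<tau> w - \<tau>h h w\<bar>\<^sup>2) \<partial>M)
           + ennreal C * esqrt (\<integral>\<^sup>+ w. ennreal (exp (6 * Lf * max (\<tau> w) (\<tau>h h w)))
                 * (\<integral>\<^sup>+ s\<in>{0..\<tau> w}.
                      ennreal ((f s w (Y s w) - fh h (nat \<lfloor>s / h\<rfloor>) w (Y s w))\<^sup>2) \<partial>lborel) ^ 2 \<partial>M)"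
    proof (intro exI[of _ C] conjI ballI allI impI)
      show "0 < C" by (rule C_ge)
      fix h R assume h_in: "h \<in> {0<..h0}" and fp: "scheme_fixed_point M F Lf h (\<tau>h h) (\<xi>b h) (fh h) R"
      let ?th = "\<tau>h h" and ?xb = "\<xi>b h" and ?y = "scheme_value h (\<tau>h h) (\<xi>b h) R"
      let ?G = "\<lambda>w. \<integral>\<^sup>+ s\<in>{0..\<tau> w}. ennreal ((f s w (Y s w) - fh h (nat \<lfloor>s / h\<rfloor>) w (Y s w))\<^sup>2) \<partial>lborel"
      define T3 where "T3 = esqrt (\<integral>\<^sup>+ w. ennreal (exp (6 * Lf * max (\<tau> w) (?th w)) * \<bar>\<xi> w - ?xb w\<bar> ^ 4) \<partial>M)"
      define T4 where "T4 = esqrt (\<integral>\<^sup>+ w. ennreal (exp (6 * Lf * max (\<tau> w) (?th w)) * (V w)\<^sup>2 * \<bar>\<tau> w - ?th w\<bar>\<^sup>2) \<partial>M)"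
      define T5 where "T5 = esqrt (\<integral>\<^sup>+ w. ennreal (exp (6 * Lf * max (\<tau> w) (?th w))) * (?G w)\<^sup>2 \<partial>M)"
      have h: "0 < h" "h \<le> h0" "h \<le> 1" using h_in h0_le by auto
      have Lfh: "12 * Lf * h \<le> 1" 
      proof -
        have "12 * Lf * h \<le> 12 * Lf * h0" using h Lf_pos by (intro mult_left_mono) auto
        then show ?thesis using h0_le(2) by linarith
      qed
      note st = \<tau>h[OF h_in]
      have grid: "\<forall>w\<in>space M. \<exists>n::nat. ?th w = real n * h" using tauh_grid h_in by blast
      have th0: "0 \<le> ?th w" if "w \<in> space M" for w using st that by (simp add: is_stopping_time_def)
      have th_meas[measurable]: "?th \<in> borel_measurable M" by (rule \<tau>h_meas[OF h_in])
      have xb: "?xb \<in> borel_measurable (stopped_sigma M \<F> (bm_filtration_inf M d W) ?th)"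
        using piT_meas h_in by (simp add: F_eq)
      then have xb_meas[measurable]: "?xb \<in> borel_measurable M"
        using stopped_sigma_subset by (auto simp: measurable_def space_stopped_sigma)
      have "(\<integral>\<^sup>+ w. ennreal (\<bar>?xb w\<bar> ^ 16) \<partial>M) \<le> (\<integral>\<^sup>+ w. (SUP h\<in>{0<..h0}. ennreal (\<bar>\<xi>b h w\<bar> ^ 16)) \<partial>M)"
        using h_in by (intro nn_integral_mono SUP_upper)
      then have xb16: "(\<integral>\<^sup>+ w. ennreal (\<bar>?xb w\<bar> ^ 16) \<partial>M) < \<infinity>" using piT_int by (rule le_less_trans)
      have xb2: "integrable M (\<lambda>w. (?xb w)\<^sup>2)" and xb4: "integrable M (\<lambda>w. ?xb w ^ 4)"
        by (rule integrable_power_le[OF xb_meas xb16]; simp)+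
      have lip: "\<bar>fh h n w x - fh h n w y\<bar> \<le> Lf * \<bar>x - y\<bar>" for n w x y using piF_lip h_in by blast
      have nh: "0 \<le> real n * h" "real n * h \<le> real (Suc n) * h" for n using h by (auto intro: mult_right_mono)
      have "\<forall>n. \<exists>D. integrable M D \<and> (AE w in M. D w = I (min (real (Suc n) * h) (\<tau> w)) w - I (min (real n * h) (\<tau> w)) w) \<and>
        (\<forall>B\<in>sets (\<F> (real n * h)). (\<integral>w. indicator B w * D w \<partial>M) = 0)"
        by (intro allI ito_integral_stopped_increment[OF I \<tau> nh])
      from choice[OF this] obtain \<Delta> where \<Delta>: "\<And>n. integrable M (\<Delta> n)"
         "\<And>n. AE w in M. \<Delta> n w = I (min (real (Suc n) * h) (\<tau> w)) w - I (min (real n * h) (\<tau> w)) w"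
         "\<And>n B. B \<in> sets (\<F> (real n * h)) \<Longrightarrow> (\<integral>w. indicator B w * \<Delta> n w \<partial>M) = 0" by blast
      have exp6: "integrable M (\<lambda>w. exp (6 * Lf * ?th w))"
      proof (rule integrableI_bounded)
        have "(\<integral>\<^sup>+w. ennreal (norm (exp (6 * Lf * ?th w))) \<partial>M) \<le> (\<integral>\<^sup>+ w. ennreal (exp (\<rho> * ?th w)) \<partial>M)"
        proof (rule nn_integral_mono)
          fix w assume "w \<in> space M"
          then have "6 * Lf * ?th w \<le> \<rho> * ?th w" using \<rho> Lf_pos th0 by (intro mult_right_mono) auto
          then show "ennreal (norm (exp (6 * Lf * ?th w))) \<le> ennreal (exp (\<rho> * ?th w))" by (simp add: ennreal_leI)
        qed
        also have "\<dots> \<le> ennreal k0" by (rule nn_\<tau>h[OF h_in])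
        finally show "(\<integral>\<^sup>+w. ennreal (norm (exp (6 * Lf * ?th w))) \<partial>M) < \<infinity>" by (simp add: le_less_trans)
      qed measurable
      define e where "e n w = Y (real n * h) w - Y (real (Suc n) * h) w + \<Delta> n w
         - indicator {w \<in> space M. real n * h < ?th w} w * (h * fh h n w (Y (real n * h) w))" for n w
      define E where "E w = (\<Sum>n. ennreal \<bar>e n w\<bar>)" for w
      note seb = scheme_error_bound[OF h(1) Lf_pos Lfh st grid xb xb2 xb4 lip fhF[OF h_in] fp[unfolded F_eq] YF Y2 \<Delta>(1,3)
          \<tau>_meas \<xi>_meas const S_meas S4 YS exp6]
      have D_le: "(\<integral>\<^sup>+w. (SUP n. ennreal \<bar>Y (real n * h) w - ?y n w\<bar>)\<^sup>2 \<partial>M)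
        \<le> 8 * (\<integral>\<^sup>+w. ennreal (exp (3 * Lf * ?th w) * (\<xi> w - ?xb w)\<^sup>2) \<partial>M)
         + 8 * (\<integral>\<^sup>+w. ennreal (exp (3 * Lf * ?th w)) * (E w)\<^sup>2 \<partial>M)"
        unfolding E_def e_def by (rule seb(1); assumption)
      have e_meas[measurable]: "e n \<in> borel_measurable M" for n
        unfolding e_def[abs_def] by (rule seb(2); assumption)
      have E_meas: "E \<in> borel_measurable M" unfolding E_def[abs_def] by measurable
      obtain Os where Os_meas[measurable]: "Os \<in> borel_measurable M" and Os0: "\<And>w. 0 \<le> Os w"
        and Os: "AE w in M. \<forall>n::nat. \<forall>t\<in>{real n * h..real n * h + h}. \<bar>Y t w - Y (real n * h) w\<bar> \<le> Os w"
        and Os4: "(\<integral>\<^sup>+w. ennreal (Os w ^ 4) \<partial>M) \<le> ennreal (Co * h powr (4 * (\<alpha> - \<epsilon>)))"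
        using O[of h] h by auto
      \<comment> \<open>Square root of the bound on the fourth moment of \<open>Os\<close>; it
        carries the rate h^(2 (\<alpha> - \<epsilon>)) of the theorem.\<close>
      define ob where "ob = sqrt Co * h powr (2 * (\<alpha> - \<epsilon>))"
      have ob0: "0 \<le> ob" using Co by (simp add: ob_def)
      have Os4': "esqrt (\<integral>\<^sup>+w. ennreal (Os w ^ 4) \<partial>M) \<le> ennreal ob"
      proof (rule esqrt_le)
        have "h powr (4 * (\<alpha> - \<epsilon>)) = (h powr (2 * (\<alpha> - \<epsilon>)))\<^sup>2"
          by (simp add: power2_eq_square powr_add[symmetric])
        then have "Co * h powr (4 * (\<alpha> - \<epsilon>)) = ob\<^sup>2" using Co by (simp add: ob_def power_mult_distrib)
        then show "(\<integral>\<^sup>+w. ennreal (Os w ^ 4) \<partial>M) \<le> (ennreal ob)\<^sup>2" using Os4 ob0 by (simp add: ennreal_power)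
      qed
      have E_le: "AE w in M. E w \<le> ennreal (V w * \<bar>\<tau> w - ?th w\<bar> + Lf * \<tau> w * Os w) + esqrt (ennreal (\<tau> w) * ?G w)"
      proof -
        have "AE w in M. \<forall>n. \<Delta> n w = I (min (real (Suc n) * h) (\<tau> w)) w - I (min (real n * h) (\<tau> w)) w"
          using \<Delta>(2) by (simp add: AE_all_countable)
        then show ?thesis using path Os Vf[OF h_in] YS AE_space
        proof eventually_elim
          case (elim w)
          obtain k where k: "?th w = real k * h" using grid elim(6) by blast
          show ?case unfolding E_def
          proof (rule local_error_sum_le[OF h(1) \<tau>0[OF elim(6)] k less_imp_le[OF Lf_pos],
              where f = "\<lambda>s. f s w (Y s w)" and y = "\<lambda>s. Y s w" and g = "\<lambda>n. fh h n w" and e = "\<lambda>n. e n w"])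
            show "continuous_on {0..} (\<lambda>t. Y t w)" "set_integrable lborel {0..\<tau> w} (\<lambda>s. f s w (Y s w))"
              using elim(2) by auto
            show "\<bar>fh h n w a - fh h n w b\<bar> \<le> Lf * \<bar>a - b\<bar>" for n a b by (rule lip)
            show "t \<in> {real n * h..real n * h + h} \<Longrightarrow> \<bar>Y t w - Y (real n * h) w\<bar> \<le> Os w" for n t
              using elim(3) by blast
            show "\<bar>fh h n w (Y (real n * h) w)\<bar> \<le> V w" if n: "real n * h \<le> max (\<tau> w) (?th w)" for n
            proof -
              have "\<bar>fh h n w (Y (real n * h) w) - fh h n w 0\<bar> \<le> Lf * \<bar>Y (real n * h) w - 0\<bar>" by (rule lip)
              also have "\<dots> \<le> Lf * S w" using elim(5) nh(1)[of n] Lf_pos by (intro mult_left_mono) auto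
              finally show ?thesis using elim(4) n unfolding V_def by fastforce
            qed
            show "e n w = (LINT s:{min (real n * h) (\<tau> w)..min (real (Suc n) * h) (\<tau> w)}|lborel. f s w (Y s w))
                - (if real n * h < ?th w then h * fh h n w (Y (real n * h) w) else 0)" for n
            proof -
              have "(LINT s:{min (real n * h) (\<tau> w)..min (real (Suc n) * h) (\<tau> w)}|lborel. f s w (Y s w))
                = Y (real n * h) w - Y (real (Suc n) * h) w + \<Delta> n w"
              proof -
                have "\<forall>s t. 0 \<le> s \<longrightarrow> s \<le> t \<longrightarrow> (LINT r:{min s (\<tau> w)..min t (\<tau> w)}|lborel. f r w (Y r w))
                  = Y s w - Y t w + (I (min t (\<tau> w)) w - I (min s (\<tau> w)) w)" using elim(2) by blast
                from this[rule_format, OF nh] show ?thesis using spec[OF elim(1), of n] by (simp only:)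
              qed
              then show ?thesis using elim(6) by (simp add: e_def)
            qed
          qed
        qed
      qed
      note loc = local_error_moment_le[OF E_meas \<tau>_meas th_meas V_meas Os_meas Lf_pos \<tau>0 E_le]
      have K1: "esqrt (\<integral>\<^sup>+w. ennreal ((V w)\<^sup>2 * (\<tau> w - ?th w)\<^sup>2) \<partial>M) \<le> ennreal (sqrt k1)"
      proof -
        have "(\<integral>\<^sup>+w. ennreal ((V w)\<^sup>2 * (\<tau> w - ?th w)\<^sup>2) \<partial>M)
           \<le> (\<integral>\<^sup>+w. ennreal (V w ^ 4) + (ennreal (c 4) * ennreal (exp (\<rho> * \<tau> w)) + ennreal (c 4) * ennreal (exp (\<rho> * ?th w))) \<partial>M)"
        proof (rule nn_integral_mono)
          fix w assume w: "w \<in> space M"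
          have "\<bar>\<tau> w - ?th w\<bar> \<le> max (\<tau> w) (?th w)" using \<tau>0[OF w] th0[OF w] by auto
          then have "\<bar>\<tau> w - ?th w\<bar> ^ 4 \<le> max (\<tau> w) (?th w) ^ 4" by (intro power_mono) auto
          also have "\<dots> \<le> \<tau> w ^ 4 + ?th w ^ 4" by (simp add: max_def)
          also have "\<dots> \<le> c 4 * exp (\<rho> * \<tau> w) + c 4 * exp (\<rho> * ?th w)"
            using c[OF \<tau>0[OF w], of 4] c[OF th0[OF w], of 4] by simp
          finally have "(V w)\<^sup>2 * (\<tau> w - ?th w)\<^sup>2 \<le> V w ^ 4 + (c 4 * exp (\<rho> * \<tau> w) + c 4 * exp (\<rho> * ?th w))"
            using mult_powers_le[of "V w" "\<tau> w - ?th w"] by simp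
          then have "ennreal ((V w)\<^sup>2 * (\<tau> w - ?th w)\<^sup>2) \<le> ennreal (V w ^ 4 + (c 4 * exp (\<rho> * \<tau> w) + c 4 * exp (\<rho> * ?th w)))"
            by (rule ennreal_leI)
          then show "ennreal ((V w)\<^sup>2 * (\<tau> w - ?th w)\<^sup>2)
             \<le> ennreal (V w ^ 4) + (ennreal (c 4) * ennreal (exp (\<rho> * \<tau> w)) + ennreal (c 4) * ennreal (exp (\<rho> * ?th w)))"
            using c0[of 4] by (simp add: ennreal_plus ennreal_mult)
        qed
        also have "\<dots> = ennreal v4 + (ennreal (c 4) * ennreal kt + ennreal (c 4) * (\<integral>\<^sup>+w. ennreal (exp (\<rho> * ?th w)) \<partial>M))"
          using V4 by (simp add: nn_integral_add nn_integral_cmult nn_\<tau> nn_integral_eq_integral v4_def)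
        also have "\<dots> \<le> ennreal v4 + (ennreal (c 4) * ennreal kt + ennreal (c 4) * ennreal k0)"
          by (intro add_left_mono mult_left_mono nn_\<tau>h[OF h_in]) simp
        also have "\<dots> = ennreal k1"
          using c0[of 4] k0 kt v4 by (simp add: k1_def ennreal_plus ennreal_mult add.assoc)
        finally show ?thesis using kk by (subst esqrt_ennreal[symmetric]) (auto intro: esqrt_mono)
      qed
      have K2: "esqrt (\<integral>\<^sup>+w. ennreal (exp (6 * Lf * ?th w) * \<tau> w ^ 4) \<partial>M) \<le> ennreal (sqrt k2)"
      proof -
        have "(\<integral>\<^sup>+w. ennreal (exp (6 * Lf * ?th w) * \<tau> w ^ 4) \<partial>M)
           \<le> (\<integral>\<^sup>+w. ennreal (exp (\<rho> * ?th w)) + ennreal (c 8) * ennreal (exp (\<rho> * \<tau> w)) \<partial>M)"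
        proof (rule nn_integral_mono)
          fix w assume w: "w \<in> space M"
          let ?a = "exp (6 * Lf * ?th w)" and ?b = "\<tau> w ^ 4"
          have "2 * (?a * ?b) \<le> ?a\<^sup>2 + ?b\<^sup>2" using sum_squares_bound[of ?a ?b] by (simp add: mult.assoc)
          moreover have "0 \<le> ?a * ?b" by simp
          moreover have "?a\<^sup>2 \<le> exp (\<rho> * ?th w)"
          proof -
            have "?a\<^sup>2 = exp (12 * Lf * ?th w)" by (simp add: exp_double[symmetric])
            \<comment> \<open>(R-q) with q = 8 provides \<rho> > 32 L_f, which covers the doubled
              rate 12 L_f.\<close>
            also have "12 * Lf * ?th w \<le> \<rho> * ?th w" using \<rho> Lf_pos th0[OF w] by (intro mult_right_mono) auto
            finally show ?thesis by simp
          qed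
          moreover have "?b\<^sup>2 \<le> c 8 * exp (\<rho> * \<tau> w)"
            using c[OF \<tau>0[OF w], of 8] by (simp add: power_mult[symmetric])
          ultimately have "?a * ?b \<le> exp (\<rho> * ?th w) + c 8 * exp (\<rho> * \<tau> w)" by linarith
          then have "ennreal (?a * ?b) \<le> ennreal (exp (\<rho> * ?th w) + c 8 * exp (\<rho> * \<tau> w))" by (rule ennreal_leI)
          then show "ennreal (?a * ?b) \<le> ennreal (exp (\<rho> * ?th w)) + ennreal (c 8) * ennreal (exp (\<rho> * \<tau> w))"
            using c0[of 8] by (simp add: ennreal_plus ennreal_mult)
        qed
        also have "\<dots> = (\<integral>\<^sup>+w. ennreal (exp (\<rho> * ?th w)) \<partial>M) + ennreal (c 8) * ennreal kt"
          by (simp add: nn_integral_add nn_integral_cmult nn_\<tau>)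
        also have "\<dots> \<le> ennreal k0 + ennreal (c 8) * ennreal kt" by (intro add_right_mono nn_\<tau>h[OF h_in])
        also have "\<dots> = ennreal k2" using c0[of 8] k0 kt by (simp add: k2_def ennreal_plus ennreal_mult)
        finally show ?thesis using kk by (subst esqrt_ennreal[symmetric]) (auto intro: esqrt_mono)
      qed
      have K3: "esqrt (\<integral>\<^sup>+w. ennreal ((\<tau> w)\<^sup>2) \<partial>M) \<le> ennreal (sqrt k3)"
      proof -
        have "(\<integral>\<^sup>+w. ennreal ((\<tau> w)\<^sup>2) \<partial>M) \<le> (\<integral>\<^sup>+w. ennreal (c 2) * ennreal (exp (\<rho> * \<tau> w)) \<partial>M)"
          using c[OF \<tau>0, of _ 2] c0[of 2] by (intro nn_integral_mono) (simp add: ennreal_mult[symmetric] ennreal_leI)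
        also have "\<dots> = ennreal k3" using c0[of 2] kt by (simp add: nn_integral_cmult nn_\<tau> k3_def ennreal_mult)
        finally show ?thesis using kk by (subst esqrt_ennreal[symmetric]) (auto intro: esqrt_mono)
      qed
      have X3: "(\<integral>\<^sup>+w. ennreal (exp (3 * Lf * ?th w) * (\<xi> w - ?xb w)\<^sup>2) \<partial>M) \<le> T3"
      proof -
        have "(\<integral>\<^sup>+w. ennreal (exp (3 * Lf * ?th w) * (\<xi> w - ?xb w)\<^sup>2) \<partial>M)
          \<le> esqrt (\<integral>\<^sup>+w. (ennreal (exp (3 * Lf * ?th w) * (\<xi> w - ?xb w)\<^sup>2))\<^sup>2 \<partial>M)"
          by (rule nn_integral_le_esqrt) measurable
        also have "\<dots> \<le> T3" unfolding T3_def
        proof (intro esqrt_mono nn_integral_mono)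
          fix w
          have "(ennreal (exp (3 * Lf * ?th w) * (\<xi> w - ?xb w)\<^sup>2))\<^sup>2 = ennreal (exp (6 * Lf * ?th w) * \<bar>\<xi> w - ?xb w\<bar> ^ 4)"
            by (simp add: ennreal_power power_mult_distrib exp_double[symmetric] power_mult[symmetric])
          also have "\<dots> \<le> ennreal (exp (6 * Lf * max (\<tau> w) (?th w)) * \<bar>\<xi> w - ?xb w\<bar> ^ 4)"
            using Lf_pos by (intro ennreal_leI mult_right_mono) auto
          finally show "(ennreal (exp (3 * Lf * ?th w) * (\<xi> w - ?xb w)\<^sup>2))\<^sup>2
             \<le> ennreal (exp (6 * Lf * max (\<tau> w) (?th w)) * \<bar>\<xi> w - ?xb w\<bar> ^ 4)" .
        qed
        finally show ?thesis .
      qed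
      have XE: "(\<integral>\<^sup>+w. ennreal (exp (3 * Lf * ?th w)) * (E w)\<^sup>2 \<partial>M)
        \<le> 4 * (T4 * ennreal (sqrt k1)) + 4 * ennreal (Lf\<^sup>2) * (ennreal (sqrt k2) * ennreal ob) + 2 * (T5 * ennreal (sqrt k3))"
        by (rule order_trans[OF loc], assumption) (unfold T4_def T5_def, intro add_mono mult_mono order_refl K1 K2 K3 Os4' zero_le)
      have XO: "(\<integral>\<^sup>+w. (ennreal (Os w))\<^sup>2 \<partial>M) \<le> ennreal ob"
      proof -
        have "(\<integral>\<^sup>+w. (ennreal (Os w))\<^sup>2 \<partial>M) \<le> esqrt (\<integral>\<^sup>+w. ((ennreal (Os w))\<^sup>2)\<^sup>2 \<partial>M)"
          by (rule nn_integral_le_esqrt) measurable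
        also have "(\<integral>\<^sup>+w. ((ennreal (Os w))\<^sup>2)\<^sup>2 \<partial>M) = (\<integral>\<^sup>+w. ennreal (Os w ^ 4) \<partial>M)"
          by (intro nn_integral_cong) (simp add: ennreal_power Os0 power_mult[symmetric])
        finally show ?thesis using Os4' by (rule order_trans)
      qed
      have "(\<integral>\<^sup>+ w. (SUP n. SUP t\<in>{real n * h .. real n * h + h}. ennreal ((Y t w - ?y n w)\<^sup>2)) \<partial>M)
         \<le> (\<integral>\<^sup>+ w. 2 * (ennreal (Os w))\<^sup>2 + 2 * (SUP n. ennreal \<bar>Y (real n * h) w - ?y n w\<bar>)\<^sup>2 \<partial>M)"
      \<comment> \<open>Each Y_t is compared with Y at the left end of its cell. The resulting
        majorant involves only countably many times and is measurable, so its integral can be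
        split.\<close>
      proof (rule nn_integral_mono_AE, use Os in eventually_elim)
        case (elim w)
        let ?D = "\<lambda>n. ennreal \<bar>Y (real n * h) w - ?y n w\<bar>"
        show ?case
        proof (intro SUP_least)
          fix n t assume t: "t \<in> {real n * h .. real n * h + h}"
          have "\<bar>Y t w - ?y n w\<bar> \<le> Os w + \<bar>Y (real n * h) w - ?y n w\<bar>" using elim t by fastforce
          then have "ennreal \<bar>Y t w - ?y n w\<bar> \<le> ennreal (Os w) + ?D n"
            using Os0[of w] by (simp add: ennreal_plus[symmetric] ennreal_leI del: ennreal_plus)
          also have "\<dots> \<le> ennreal (Os w) + (SUP n. ?D n)" by (intro add_left_mono SUP_upper) simp
          finally have "(ennreal \<bar>Y t w - ?y n w\<bar>)\<^sup>2 \<le> (ennreal (Os w) + (SUP n. ?D n))\<^sup>2" by (rule power_mono) simp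
          also have "\<dots> \<le> 2 * (ennreal (Os w))\<^sup>2 + 2 * (SUP n. ?D n)\<^sup>2" by (rule ennreal_add_power2_le)
          finally show "ennreal ((Y t w - ?y n w)\<^sup>2) \<le> 2 * (ennreal (Os w))\<^sup>2 + 2 * (SUP n. ?D n)\<^sup>2"
            by (simp add: ennreal_power)
        qed
      qed
      also have "\<dots> = 2 * (\<integral>\<^sup>+w. (ennreal (Os w))\<^sup>2 \<partial>M) + 2 * (\<integral>\<^sup>+w. (SUP n. ennreal \<bar>Y (real n * h) w - ?y n w\<bar>)\<^sup>2 \<partial>M)"
      proof -
        have R: "R n \<in> borel_measurable M" for n
          using fp unfolding F_eq by (auto simp: scheme_fixed_point_def intro: measurable_bm_filtrationD)
        have [measurable]: "(\<lambda>w. Y (real n * h) w - ?y n w) \<in> borel_measurable M" for n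
          unfolding scheme_value_def using Y_meas[OF nh(1)[of n]] R[of n] by measurable
        show ?thesis by (simp add: nn_integral_add nn_integral_cmult)
      qed
      also have "\<dots> \<le> 2 * ennreal ob + 2 * (8 * T3 + 8 * (4 * (T4 * ennreal (sqrt k1)) + 4 * ennreal (Lf\<^sup>2) * (ennreal (sqrt k2) * ennreal ob) + 2 * (T5 * ennreal (sqrt k3))))"
        by (intro add_mono mult_left_mono XO order_trans[OF D_le] X3 XE zero_le)
      also have "\<dots> = (2 * ennreal ob + 64 * (ennreal (Lf\<^sup>2) * (ennreal (sqrt k2) * ennreal ob)))
          + 16 * T3 + 64 * ennreal (sqrt k1) * T4 + 32 * ennreal (sqrt k3) * T5"
      proof -
        have "2 * u + 2 * (8 * t3 + 8 * (4 * (t4 * s1) + 4 * l * (s2 * u) + 2 * (t5 * s3)))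
          = (2 * u + 64 * (l * (s2 * u))) + 16 * t3 + 64 * s1 * t4 + 32 * s3 * t5" for u l s1 s2 s3 t3 t4 t5 :: ennreal
          by (simp add: algebra_simps)
        then show ?thesis .
      qed
      also have "\<dots> = ennreal (C1 * h powr (2 * (\<alpha> - \<epsilon>))) + ennreal 16 * T3 + ennreal (64 * sqrt k1) * T4 + ennreal (32 * sqrt k3) * T5"
      proof -
        have "2 * ennreal ob + 64 * (ennreal (Lf\<^sup>2) * (ennreal (sqrt k2) * ennreal ob)) = ennreal (C1 * h powr (2 * (\<alpha> - \<epsilon>)))"
        proof -
          have "C1 * h powr (2 * (\<alpha> - \<epsilon>)) = 2 * ob + 64 * (Lf\<^sup>2 * (sqrt k2 * ob))"
            by (simp add: C1_def ob_def algebra_simps)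
          then show ?thesis using ob0 kk by (simp add: ennreal_plus ennreal_mult)
        qed
        then show ?thesis by (simp add: ennreal_mult' kk)
      qed
      also have "\<dots> \<le> ennreal (C * h powr (2 * (\<alpha> - \<epsilon>))) + ennreal C * T3 + ennreal C * T4 + ennreal C * T5"
        by (intro add_mono mult_right_mono ennreal_leI C_ge) auto
      also have "\<dots> \<le> ennreal (C * h powr (2 * (\<alpha> - \<epsilon>))) + ennreal (C * h) + ennreal C * T3 + ennreal C * T4 + ennreal C * T5"
        by (intro add_right_mono) simp
      finally show "(\<integral>\<^sup>+ w. (SUP n. SUP t\<in>{real n * h .. real n * h + h}. ennreal ((Y t w - ?y n w)\<^sup>2)) \<partial>M)
         \<le> ennreal (C * h powr (2 * (\<alpha> - \<epsilon>))) + ennreal (C * h)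
           + ennreal C * esqrt (\<integral>\<^sup>+ w. ennreal (exp (6 * Lf * max (\<tau> w) (?th w)) * \<bar>\<xi> w - ?xb w\<bar> ^ 4) \<partial>M)
           + ennreal C * esqrt (\<integral>\<^sup>+ w. ennreal (exp (6 * Lf * max (\<tau> w) (?th w)) * (V w)\<^sup>2 * \<bar>\<tau> w - ?th w\<bar>\<^sup>2) \<partial>M)
           + ennreal C * esqrt (\<integral>\<^sup>+ w. ennreal (exp (6 * Lf * max (\<tau> w) (?th w))) * (?G w) ^ 2 \<partial>M)"
        unfolding T3_def T4_def T5_def .
    qed
  qed
qed

end
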